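(* The $\gamma$-polynomials of uniform matroids satisfy the following. (i) For all integers $m,d\ge1$, $\Gamma_{U_{m,d}}(x)\prec\Gamma_{U_{m,d+1}}(x)$. (ii) For all integers $m\ge1$ and $d\ge2$, $\Gamma_{U_{m,d}}(x)\prec\Gamma_{U_{m+1,d}}(x)$. (iii) For all integers $m,d\ge1$, $\Gamma_{U_{m,d}}(x)\prec\Gamma_{U_{m+1,d+1}}(x)$.
   Context: $U_{m,d}$ denotes the uniform matroid of rank $d$ and corank $m$, i.e. the uniform matroid of rank $d$ on $m+d$ elements. For a matroid $M$, let $L(M)$ be its lattice of flats, $\operatorname{rk}$ its rank function, $M|F$ the restriction to a flat $F$ and $M/F$ the contraction by $F$. Let $\chi_{M|F}(x)=\sum_{G\in L(M),\,G\subseteq F}\mu(\hat 0,G)\,x^{\operatorname{rk}F-\operatorname{rk}G}$ be the characteristic polynomial, with $\mu$ the Möbius function of $L(M)$ and $\hat 0$ its minimum. The Kazhdan--Lusztig polynomial $P_M(x)\in\mathbb Z[x]$ depends only on $L(M)$ and is the unique assignment such that: $P_M(x)=1$ if $\operatorname{rk}M=0$; $\deg P_M<\tfrac12\operatorname{rk}M$ if $\operatorname{rk}M>0$; and $x^{\operatorname{rk}M}P_M(x^{-1})=\sum_{F\in L(M)}\chi_{M|F}(x)P_{M/F}(x)$ for every $M$. The $Z$-polynomial is $Z_M(x)=\sum_{F\in L(M)}x^{\operatorname{rk}F}P_{M/F}(x)$; it is palindromic of degree $d=\operatorname{rk}M$. The $\gamma$-polynomial $\Gamma_M(x)$ is the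 unique polynomial of degree at most $\lfloor d/2\rfloor$ with $Z_M(x)=(1+x)^d\,\Gamma_M\!\left(\frac{x}{(1+x)^2}\right)$. Interlacing convention: let $P,Q$ be nonzero real-rooted polynomials with positive leading coefficients and degrees $q$ and $r\in\{q,q+1\}$, with roots (counted with multiplicity) $a_1\le\cdots\le a_q$ and $b_1\le\cdots\le b_r$ respectively. Write $P\preccurlyeq Q$ if $a_1\le b_1\le a_2\le b_2\le\cdots\le a_q\le b_q$ when $r=q$, or $b_1\le a_1\le b_2\le\cdots\le b_q\le a_q\le b_{q+1}$ when $r=q+1$ (for $q=0$ these are the empty chain and the single-term chain $b_1$). Write $P\prec Q$ if $P\preccurlyeq Q$, all the inequalities in the chain are strict, and $P$ and $Q$ have no common root. (Thus $P\prec Q$ includes the assertion that both polynomials are real-rooted.) *)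

theory Defs
  imports Complex_Main "HOL-Library.Multiset" "HOL-Computational_Algebra.Polynomial"
begin

section \<open>Matroids, flats and contractions\<close>

record 'a matroid =
  ground :: "'a set"
  indeps :: "'a set set"

definition is_matroid :: "'a matroid \<Rightarrow> bool" where
  "is_matroid M \<longleftrightarrow>
     finite (ground M) \<and> indeps M \<subseteq> Pow (ground M) \<and> {} \<in> indeps M \<and>
     (\<forall>I\<in>indeps M. \<forall>J\<subseteq>I. J \<in> indeps M) \<and>
     (\<forall>I\<in>indeps M. \<forall>J\<in>indeps M. card J < card I \<longrightarrow>
        (\<exists>e\<in>I - J. insert e J \<in> indeps M))"

definition rank_of :: "'a matroid \<Rightarrow> 'a set \<Rightarrow> nat" where
  "rank_of M X = Max (card ` {I \<in> indeps M. I \<subseteq> X})"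

definition mrank :: "'a matroid \<Rightarrow> nat" where
  "mrank M = rank_of M (ground M)"

definition flats :: "'a matroid \<Rightarrow> 'a set set" where
  "flats M = {F. F \<subseteq> ground M \<and> (\<forall>e\<in>ground M - F. rank_of M F < rank_of M (insert e F))}"

text \<open>The rank function of the contraction by \<open>F\<close> is \<open>X \<mapsto> rk (X \<union> F) - rk F\<close>, and a set is
  independent iff its rank is its cardinality.\<close>

definition contraction :: "'a matroid \<Rightarrow> 'a set \<Rightarrow> 'a matroid" where
  "contraction M F =
     \<lparr>ground = ground M - F,
      indeps = {I. I \<subseteq> ground M - F \<and> rank_of M (I \<union> F) = card I + rank_of M F}\<rparr>"

definition uniform_matroid :: "nat \<Rightarrow> nat \<Rightarrow> nat matroid" where
  "uniform_matroid m d = \<lparr>ground = {..<m + d}, indeps = {I. I \<subseteq> {..<m + d} \<and> card I \<le> d}\<rparr>"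

lemma is_matroid_uniform_matroid: "is_matroid (uniform_matroid m d)"
proof -
  have aug: "\<exists>e\<in>I - J. insert e J \<subseteq> {..<m + d} \<and> card (insert e J) \<le> d"
    if I: "I \<subseteq> {..<m + d}" "card I \<le> d" and J: "J \<subseteq> {..<m + d}" and lt: "card J < card I" for I J
  proof -
    have fin: "finite J" using J finite_subset by blast
    have "\<not> I \<subseteq> J" using lt card_mono[OF fin, of I] by linarith
    then obtain e where e: "e \<in> I" "e \<notin> J" by blast
    have "card (insert e J) \<le> d" using e fin lt I(2) by simp
    then show ?thesis using e I(1) J by blast
  qed
  have sub: "J \<subseteq> {..<m + d} \<and> card J \<le> d" if "I \<subseteq> {..<m + d}" "card I \<le> d" "J \<subseteq> I" for I J
  proof -
    have "finite I" using that(1) finite_subset by blast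
    then have "card J \<le> card I" using that(3) by (rule card_mono)
    then show ?thesis using that by (meson le_trans subset_trans)
  qed
  let ?M = "uniform_matroid m d"
  have in_iff: "I \<in> indeps ?M \<longleftrightarrow> I \<subseteq> {..<m + d} \<and> card I \<le> d" for I
    by (simp only: uniform_matroid_def matroid.simps mem_Collect_eq)
  have ground: "ground ?M = {..<m + d}"
    by (simp only: uniform_matroid_def matroid.simps)
  show ?thesis
    unfolding is_matroid_def
  proof (intro conjI ballI allI impI)
    show "finite (ground ?M)" unfolding ground by (rule finite_lessThan)
    show "indeps ?M \<subseteq> Pow (ground ?M)" unfolding ground using in_iff by blast
    show "{} \<in> indeps ?M" unfolding in_iff by simp
    show "J \<in> indeps ?M" if "I \<in> indeps ?M" "J \<subseteq> I" for I J
      using that sub unfolding in_iff by blast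
    show "\<exists>e\<in>I - J. insert e J \<in> indeps ?M"
      if "I \<in> indeps ?M" "J \<in> indeps ?M" "card J < card I" for I J
      using aug[of I J] that unfolding in_iff by blast
  qed
qed


section \<open>Moebius function and characteristic polynomial\<close>

text \<open>Moebius function of the finite subposet \<open>L\<close>: \<open>\<mu>(x, x) = 1\<close> and
  \<open>\<mu>(x, y) = - (\<Sum>x \<le> z < y. \<mu>(x, z))\<close> for \<open>x < y\<close>. The conjunct \<open>finite L\<close> serves only termination.\<close>

function moebius :: "'b::order set \<Rightarrow> 'b \<Rightarrow> 'b \<Rightarrow> int" where
  "moebius L x y =
     (if x = y then 1
      else if x < y \<and> finite L then - (\<Sum>z\<in>{z\<in>L. x \<le> z \<and> z < y}. moebius L x z)
      else 0)"
  by auto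
termination
proof (relation "measure (\<lambda>(L, x, y). card {z\<in>L. z < y})", goal_cases)
  case 1
  show ?case by simp
next
  case (2 L x y z)
  then have "{w\<in>L. w < z} \<subset> {w\<in>L. w < y}" by auto
  then show ?case using 2 by (auto intro!: psubset_card_mono)
qed

declare moebius.simps [simp del]

text \<open>\<open>charpoly_restr M F\<close> is the characteristic polynomial of the restriction of \<open>M\<close> to \<open>F\<close>,
  expressed through the lattice of flats of \<open>M\<close>, whose minimum is the \<open>LEAST\<close> term.\<close>

definition charpoly_restr :: "'a matroid \<Rightarrow> 'a set \<Rightarrow> int poly" where
  "charpoly_restr M F =
     (\<Sum>G\<in>{G\<in>flats M. G \<subseteq> F}.
        monom (moebius (flats M) (LEAST H. H \<in> flats M) G) (rank_of M F - rank_of M G))"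


section \<open>Kazhdan--Lusztig, $Z$- and gamma-polynomials\<close>

text \<open>Identities between rational functions are stated as equalities at all real points at which
  both sides are defined.\<close>

definition kl_assignment :: "('a matroid \<Rightarrow> int poly) \<Rightarrow> bool" where
  "kl_assignment P \<longleftrightarrow>
     (\<forall>M. is_matroid M \<longrightarrow>
        (mrank M = 0 \<longrightarrow> P M = 1) \<and>
        (mrank M > 0 \<longrightarrow> 2 * degree (P M) < mrank M) \<and>
        (\<forall>x::real. x \<noteq> 0 \<longrightarrow>
           x ^ mrank M * poly (map_poly of_int (P M)) (1 / x) =
           poly (map_poly of_int (\<Sum>F\<in>flats M. charpoly_restr M F * P (contraction M F))) x))"

text \<open>An assignment is determined only on matroids, hence the description of its value at \<open>M\<close>.\<close>

definition kl_poly :: "'a matroid \<Rightarrow> int poly" where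
  "kl_poly M = (THE p. \<exists>P. kl_assignment P \<and> P M = p)"

definition Z_poly :: "'a matroid \<Rightarrow> int poly" where
  "Z_poly M = (\<Sum>F\<in>flats M. monom 1 (rank_of M F) * kl_poly (contraction M F))"

definition gamma_poly :: "'a matroid \<Rightarrow> real poly" where
  "gamma_poly M =
     (THE g. degree g \<le> mrank M div 2 \<and>
        (\<forall>x::real. x \<noteq> -1 \<longrightarrow>
           poly (map_poly of_int (Z_poly M)) x =
           (1 + x) ^ mrank M * poly g (x / (1 + x)\<^sup>2)))"


section \<open>Interlacing\<close>

definition real_rooted :: "real poly \<Rightarrow> bool" where
  "real_rooted p \<longleftrightarrow> p \<noteq> 0 \<and> (\<forall>z::complex. poly (map_poly of_real p) z = 0 \<longrightarrow> z \<in> \<real>)"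

definition root_list :: "real poly \<Rightarrow> real list" where
  "root_list p = sorted_list_of_multiset (proots p)"

text \<open>\<open>splice [a\<^sub>1, \<dots>, a\<^sub>q] [b\<^sub>1, \<dots>, b\<^sub>q] = [a\<^sub>1, b\<^sub>1, \<dots>, a\<^sub>q, b\<^sub>q]\<close> and
  \<open>splice [b\<^sub>1, \<dots>, b\<^sub>q\<^sub>+\<^sub>1] [a\<^sub>1, \<dots>, a\<^sub>q] = [b\<^sub>1, a\<^sub>1, \<dots>, a\<^sub>q, b\<^sub>q\<^sub>+\<^sub>1]\<close>.\<close>

definition root_chain :: "real poly \<Rightarrow> real poly \<Rightarrow> real list" where
  "root_chain P Q =
     (if degree Q = degree P then splice (root_list P) (root_list Q)
      else splice (root_list Q) (root_list P))"

definition interlaces :: "real poly \<Rightarrow> real poly \<Rightarrow> bool" where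
  "interlaces P Q \<longleftrightarrow>
     real_rooted P \<and> real_rooted Q \<and> lead_coeff P > 0 \<and> lead_coeff Q > 0 \<and>
     (degree Q = degree P \<or> degree Q = degree P + 1) \<and>
     sorted_wrt (\<le>) (root_chain P Q)"

definition strictly_interlaces :: "real poly \<Rightarrow> real poly \<Rightarrow> bool" where
  "strictly_interlaces P Q \<longleftrightarrow>
     interlaces P Q \<and> sorted_wrt (<) (root_chain P Q) \<and>
     \<not> (\<exists>x. poly P x = 0 \<and> poly Q x = 0)"

end

(* Writing theta for x d/dx and psi_n(j) = j / (j + n), psi_0 = 1, the gamma-polynomial of U_{m,d} has
   the coefficients
     d! / ((d - 2j)! j!^2) * (sum n < m. (m - n) * C(n + d - 1, n) * psi_n(j)) / (j + m).
   Hence it is a positive combination of polynomials obtained from polynomials of Gegenbauer type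
   by operators theta + c with c >= 0; their roots are simple and negative, except for a root 0 if
   c = 0 occurs. For f with only such roots the Wronskian W(f, theta f) is nonnegative on the negative
   axis, and positive if f(0) is nonzero, because theta f / f = sum x / (x - s) over the roots s. Contiguity relations of the coefficients in m
   and in d expand the Wronskian of two neighbouring gamma-polynomials as a positive combination of
   such Wronskians, and a Wronskian without zeros forces strict interlacing.

   The coefficients come from an explicit formula for the Kazhdan-Lusztig polynomials of uniform
   matroids. It satisfies the deletion recursion
     P_{m+1,d} + x P_{m+1,d-1} = P_{m,d} + sum_j tau_{m,j} C(m + d, d - 2j) x^j,
   which turns the Z-polynomial into a sum of terms x^j (1 + x)^(d - 2j); such a sum is palindromic,
   and palindromicity of all Z-polynomials is equivalent to the defining recursion by binomial
   inversion. *)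

theory Submission
  imports Defs
begin

section \<open>Rank, flats and contractions\<close>

text \<open>\<open>kl_poly\<close> and \<open>gamma_poly\<close> are definite descriptions, and a
  Kazhdan-Lusztig assignment ranges over all matroids of a type. A formula for uniform matroids
  therefore says nothing until existence and uniqueness are proved for every matroid. Loops have to
  be faced there: they make the contraction by the least flat differ from M.

  For the interlacing, gamma-polynomials of different d first get the same denominators. Since (d +
  1 - 2j)! = (d + 1 - 2j) (d - 2j)!, the polynomial for (m, d) is d + 1 - 2 theta applied to one
  with the denominators of (m, d + 1). The Wronskians are then reduced to pairs in the span of some
  f and theta f, where each is a 2 by 2 determinant times W(f, theta f).

  Of the summands in the coefficient formula, only n = 0 does not vanish at x = 0. It is the
  reference from which the roots of the whole sum are located, and it supplies the strict sign in
  the final Wronskians; the summands n > 0 need only a nonnegative one. The roots of the second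
  polynomial of a pair need not be known beforehand: the sign of the Wronskian at the roots of the
  first produces them.\<close>

locale finite_matroid =
  fixes M :: "'a matroid"
  assumes matroid: "is_matroid M"
begin

abbreviation "E \<equiv> ground M"
abbreviation "rk \<equiv> rank_of M"

lemma finite_ground: "finite E"
  and indep_subset: "I \<in> indeps M \<Longrightarrow> I \<subseteq> E"
  and indep_empty: "{} \<in> indeps M"
  and indep_mono: "I \<in> indeps M \<Longrightarrow> J \<subseteq> I \<Longrightarrow> J \<in> indeps M"
  using matroid unfolding is_matroid_def by auto

lemma indep_augment:
  assumes "I \<in> indeps M" "J \<in> indeps M" "card J < card I"
  obtains e where "e \<in> I - J" "insert e J \<in> indeps M"
  using matroid assms unfolding is_matroid_def by meson

lemma indep_finite: "I \<in> indeps M \<Longrightarrow> finite I"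
  using indep_subset finite_ground finite_subset by blast

lemma finite_indeps: "finite {I \<in> indeps M. I \<subseteq> X}"
  by (rule finite_subset[of _ "Pow E"]) (use indep_subset finite_ground in auto)

lemma card_le_rank: "I \<in> indeps M \<Longrightarrow> I \<subseteq> X \<Longrightarrow> card I \<le> rk X"
  unfolding rank_of_def by (rule Max_ge) (use finite_indeps in auto)

lemma rank_basis:
  obtains I where "I \<in> indeps M" "I \<subseteq> X" "card I = rk X"
proof -
  have "rk X \<in> card ` {I \<in> indeps M. I \<subseteq> X}"
    unfolding rank_of_def by (rule Max_in) (use finite_indeps indep_empty in auto)
  then show ?thesis using that by auto
qed

lemma rank_le: "(\<And>I. I \<in> indeps M \<Longrightarrow> I \<subseteq> X \<Longrightarrow> card I \<le> k) \<Longrightarrow> rk X \<le> k"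
  using rank_basis by metis

lemma rank_mono: "X \<subseteq> Y \<Longrightarrow> rk X \<le> rk Y"
  by (rule rank_le) (meson card_le_rank order_trans)

lemma rank_empty: "rk {} = 0"
  using rank_le[of "{}" 0] by simp

lemma rank_indep: "I \<in> indeps M \<Longrightarrow> rk I = card I"
  by (meson card_le_rank card_mono dual_order.antisym indep_finite order_refl rank_le)

lemma extend_to_basis:
  assumes "I \<in> indeps M" "I \<subseteq> X"
  obtains J where "J \<in> indeps M" "I \<subseteq> J" "J \<subseteq> X" "card J = rk X"
proof -
  have "\<exists>J. J \<in> indeps M \<and> I \<subseteq> J \<and> J \<subseteq> X \<and> card J = rk X" using assms
  proof (induction "rk X - card I" arbitrary: I rule: less_induct)
    case less
    show ?case
    proof (cases "card I = rk X")
      case True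
      then show ?thesis using less.prems by blast
    next
      case False
      then have lt: "card I < rk X" using card_le_rank[OF less.prems] by simp
      obtain B where B: "B \<in> indeps M" "B \<subseteq> X" "card B = rk X" using rank_basis .
      obtain e where e: "e \<in> B - I" "insert e I \<in> indeps M"
        using indep_augment[OF B(1) less.prems(1)] lt B(3) by auto
      have "card (insert e I) = Suc (card I)"
        using e indep_finite[OF less.prems(1)] by simp
      then have "\<exists>J. J \<in> indeps M \<and> insert e I \<subseteq> J \<and> J \<subseteq> X \<and> card J = rk X"
        by (intro less.hyps) (use lt e B less.prems in auto)
      then show ?thesis by blast
    qed
  qed
  then show ?thesis using that by blast
qed

lemma rank_Un_le: "finite Y \<Longrightarrow> rk (X \<union> Y) \<le> rk X + card Y"
proof (rule rank_le)
  fix I assume Y: "finite Y" and I: "I \<in> indeps M" "I \<subseteq> X \<union> Y"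
  have "card I \<le> card (I \<inter> X) + card (I \<inter> Y)"
    using card_Un_le[of "I \<inter> X" "I \<inter> Y"] I by (metis Int_Un_distrib inf.absorb1)
  moreover have "card (I \<inter> X) \<le> rk X" using I by (intro card_le_rank indep_mono[OF I(1)]) auto
  moreover have "card (I \<inter> Y) \<le> card Y" using Y by (simp add: card_mono)
  ultimately show "card I \<le> rk X + card Y" by simp
qed

text \<open>A basis of X stays maximal in the union: an element e that could be added to it would
  already raise the rank of \<open>insert e X\<close>. With X empty this shows that the loops
  together have rank 0.\<close>

lemma rank_Un_eq:
  assumes "\<And>e. e \<in> Y \<Longrightarrow> rk (insert e X) = rk X"
  shows "rk (X \<union> Y) = rk X"
proof -
  obtain B where B: "B \<in> indeps M" "B \<subseteq> X" "card B = rk X" using rank_basis .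
  obtain J where J: "J \<in> indeps M" "B \<subseteq> J" "J \<subseteq> X \<union> Y" "card J = rk (X \<union> Y)"
    using extend_to_basis[OF B(1), of "X \<union> Y"] B(2) by blast
  have "J \<subseteq> B"
  proof
    fix e assume e: "e \<in> J"
    show "e \<in> B"
    proof (rule ccontr)
      assume ne: "e \<notin> B"
      have ind: "insert e B \<in> indeps M" by (rule indep_mono[OF J(1)]) (use J e in auto)
      have "Suc (rk X) \<le> rk (insert e X)"
        using card_le_rank[OF ind, of "insert e X"] B ne indep_finite[OF B(1)] by auto
      moreover have "rk (insert e X) = rk X"
        using assms[of e] J(3) e by (cases "e \<in> X") (auto simp: insert_absorb)
      ultimately show False by simp
    qed
  qed
  then show ?thesis using J B by auto
qed

context
  fixes F assumes F: "F \<subseteq> E"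
begin

text \<open>A basis J extending B meets F exactly in B, so it splits into B and I. Adding a fixed
  basis of F to both sets then carries the matroid axioms over from M, for which the rank condition
  defining \<open>contraction\<close> is unsuited.\<close>

lemma indep_contraction_iff:
  assumes B: "B \<in> indeps M" "B \<subseteq> F" "card B = rk F"
  shows "I \<in> indeps (contraction M F) \<longleftrightarrow> I \<subseteq> E - F \<and> I \<union> B \<in> indeps M"
proof
  assume "I \<in> indeps (contraction M F)"
  then have I: "I \<subseteq> E - F" "rk (I \<union> F) = card I + rk F" by (auto simp: contraction_def)
  obtain J where J: "J \<in> indeps M" "B \<subseteq> J" "J \<subseteq> I \<union> F" "card J = rk (I \<union> F)"
    using extend_to_basis[OF B(1), of "I \<union> F"] B(2) by blast
  have fin: "finite I" "finite J" using I finite_ground indep_finite J by (auto intro: finite_subset)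
  have JF: "J \<inter> F = B"
  proof -
    have "J \<inter> F \<in> indeps M" using indep_mono[OF J(1)] by blast
    then have "card (J \<inter> F) \<le> card B" using card_le_rank B by simp
    moreover have "B \<subseteq> J \<inter> F" using J B by auto
    ultimately show ?thesis using fin by (metis card_seteq finite_Int)
  qed
  have "card J = card (J \<inter> F) + card (J - F)"
    using fin by (metis card_Int_Diff)
  then have "card (J - F) = card I" using J I JF B by simp
  moreover have "J - F \<subseteq> I" using J by auto
  ultimately have "J - F = I" using fin by (metis card_subset_eq)
  then have "J = I \<union> B" using JF by blast
  then show "I \<subseteq> E - F \<and> I \<union> B \<in> indeps M" using I J by simp
next
  assume I: "I \<subseteq> E - F \<and> I \<union> B \<in> indeps M"
  then have fin: "finite I" "finite B" using finite_ground B indep_finite by (auto intro: finite_subset)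
  have "card (I \<union> B) = card I + card B" using fin I B by (intro card_Un_disjoint) auto
  moreover have "card (I \<union> B) \<le> rk (I \<union> F)" using I B by (intro card_le_rank) auto
  moreover have "rk (I \<union> F) \<le> rk F + card I" using rank_Un_le[OF fin(1), of F] by (simp add: Un_commute)
  ultimately show "I \<in> indeps (contraction M F)" using I B by (auto simp: contraction_def)
qed

lemma ground_contraction: "ground (contraction M F) = E - F"
  by (simp add: contraction_def)

lemma is_matroid_contraction: "is_matroid (contraction M F)"
proof -
  obtain B where B: "B \<in> indeps M" "B \<subseteq> F" "card B = rk F" using rank_basis .
  note iff = indep_contraction_iff[OF B]
  show ?thesis
    unfolding is_matroid_def ground_contraction
  proof (intro conjI ballI allI impI)
    show "finite (E - F)" using finite_ground by simp
    show "indeps (contraction M F) \<subseteq> Pow (E - F)" using iff by auto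
    show "{} \<in> indeps (contraction M F)" using iff B by simp
    show "J \<in> indeps (contraction M F)" if "I \<in> indeps (contraction M F)" "J \<subseteq> I" for I J
      using that iff indep_mono[of "I \<union> B" "J \<union> B"] by auto
    fix I J assume IJ: "I \<in> indeps (contraction M F)" "J \<in> indeps (contraction M F)" "card J < card I"
    then have I: "I \<subseteq> E - F" "I \<union> B \<in> indeps M" and J: "J \<subseteq> E - F" "J \<union> B \<in> indeps M"
      using iff by auto
    have fin: "finite I" "finite J" "finite B"
      using I J finite_ground B indep_finite by (auto intro: finite_subset)
    have "card (I \<union> B) = card I + card B" "card (J \<union> B) = card J + card B"
      using I J B fin by (metis Diff_disjoint card_Un_disjoint disjoint_iff subset_eq Diff_iff)+
    then obtain e where e: "e \<in> (I \<union> B) - (J \<union> B)" "insert e (J \<union> B) \<in> indeps M"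
      using indep_augment[OF I(2) J(2)] IJ(3) by auto
    then show "\<exists>e\<in>I - J. insert e J \<in> indeps (contraction M F)"
      using iff I J by (intro bexI[of _ e]) auto
  qed
qed

lemma rank_contraction:
  assumes X: "X \<subseteq> E - F"
  shows "rank_of (contraction M F) X + rk F = rk (X \<union> F)"
proof -
  obtain B where B: "B \<in> indeps M" "B \<subseteq> F" "card B = rk F" using rank_basis .
  interpret C: finite_matroid "contraction M F"
    by unfold_locales (rule is_matroid_contraction)
  obtain I where I: "I \<in> indeps (contraction M F)" "I \<subseteq> X" "card I = C.rk X" using C.rank_basis .
  have "card I + rk F = rk (I \<union> F)" using I by (auto simp: contraction_def)
  also have "\<dots> \<le> rk (X \<union> F)" using I by (intro rank_mono) auto
  finally have 1: "C.rk X + rk F \<le> rk (X \<union> F)" using I by simp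
  obtain J where J: "J \<in> indeps M" "B \<subseteq> J" "J \<subseteq> X \<union> F" "card J = rk (X \<union> F)"
    using extend_to_basis[OF B(1), of "X \<union> F"] B(2) by blast
  have fin: "finite J" using J indep_finite by auto
  have "J \<inter> F \<in> indeps M" using indep_mono[OF J(1)] by blast
  then have le: "card (J \<inter> F) \<le> rk F" using card_le_rank by simp
  have "J - F \<in> indeps (contraction M F)"
    using indep_contraction_iff[OF B] J X by (auto intro: indep_mono[OF J(1)])
  then have "card (J - F) \<le> C.rk X" using J by (intro C.card_le_rank) auto
  moreover have "card J = card (J \<inter> F) + card (J - F)" using fin by (metis card_Int_Diff)
  ultimately show ?thesis using 1 le J by simp
qed

lemma mrank_contraction: "mrank (contraction M F) + rk F = mrank M"
  using rank_contraction[of "E - F"] F by (simp add: mrank_def ground_contraction Un_absorb2)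

lemma flats_contraction: "flats (contraction M F) = (\<lambda>G. G - F) ` {G \<in> flats M. F \<subseteq> G}"
proof -
  have iff: "X \<in> flats (contraction M F) \<longleftrightarrow> X \<union> F \<in> flats M" if X: "X \<subseteq> E - F" for X
  proof -
    have "rank_of (contraction M F) X < rank_of (contraction M F) (insert e X) \<longleftrightarrow>
        rk (X \<union> F) < rk (insert e (X \<union> F))" if "e \<in> E - (X \<union> F)" for e
      using rank_contraction[OF X] rank_contraction[of "insert e X"] X that
      by simp linarith
    moreover have "E - F - X = E - (X \<union> F)" by blast
    ultimately show ?thesis using X F unfolding flats_def ground_contraction by auto
  qed
  show ?thesis
  proof (intro equalityI subsetI)
    fix X assume X: "X \<in> flats (contraction M F)"
    then have s: "X \<subseteq> E - F" by (auto simp: flats_def ground_contraction)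
    then have "X = (X \<union> F) - F" "X \<union> F \<in> flats M" using iff X by auto
    then show "X \<in> (\<lambda>G. G - F) ` {G \<in> flats M. F \<subseteq> G}" by blast
  next
    fix X assume "X \<in> (\<lambda>G. G - F) ` {G \<in> flats M. F \<subseteq> G}"
    then obtain G where G: "X = G - F" "G \<in> flats M" "F \<subseteq> G" by blast
    then have "X \<subseteq> E - F" "X \<union> F = G" by (auto simp: flats_def)
    then show "X \<in> flats (contraction M F)" using iff G by simp
  qed
qed

lemma contraction_contraction:
  assumes G: "F \<subseteq> G" "G \<subseteq> E"
  shows "contraction (contraction M F) (G - F) = contraction M G"
proof -
  have 1: "E - F - (G - F) = E - G" using G by blast
  have "rank_of (contraction M F) (I \<union> (G - F)) = card I + rank_of (contraction M F) (G - F) \<longleftrightarrow>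
      rk (I \<union> G) = card I + rk G" if "I \<subseteq> E - G" for I
  proof -
    have "I \<union> (G - F) \<union> F = I \<union> G" "G - F \<union> F = G" using G by auto
    moreover have "I \<union> (G - F) \<subseteq> E - F" "G - F \<subseteq> E - F" using that G by auto
    ultimately have "rank_of (contraction M F) (I \<union> (G - F)) + rk F = rk (I \<union> G)"
      "rank_of (contraction M F) (G - F) + rk F = rk G"
      using rank_contraction[of "I \<union> (G - F)"] rank_contraction[of "G - F"] by auto
    then show ?thesis by linarith
  qed
  then show ?thesis
    unfolding contraction_def[of "contraction M F"] ground_contraction 1 contraction_def[of M G] by auto
qed

end

lemma finite_flats: "finite (flats M)"
  by (rule finite_subset[of _ "Pow E"]) (use finite_ground in \<open>auto simp: flats_def\<close>)

lemma flat_subset: "F \<in> flats M \<Longrightarrow> F \<subseteq> E"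
  by (simp add: flats_def)

lemma rank_flat_strict:
  assumes "F \<in> flats M" "G \<in> flats M" "F \<subset> G"
  shows "rk F < rk G"
proof -
  obtain e where e: "e \<in> G - F" using assms by blast
  then have "rk F < rk (insert e F)" using assms unfolding flats_def by blast
  also have "\<dots> \<le> rk G" using e assms by (intro rank_mono) auto
  finally show ?thesis .
qed

lemma rank_flat_le_mrank: "F \<in> flats M \<Longrightarrow> rk F \<le> mrank M"
  unfolding mrank_def by (intro rank_mono flat_subset)

definition bot_flat :: "'a set" where "bot_flat = (LEAST H. H \<in> flats M)"

lemma bot_flat:
  shows bot_flat_flat: "bot_flat \<in> flats M"
    and bot_flat_least: "\<And>G. G \<in> flats M \<Longrightarrow> bot_flat \<subseteq> G"
    and rank_bot_flat: "rk bot_flat = 0"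
proof -
  \<comment> \<open>The loops. No independent set contains one, so adding a loop never raises a
    rank, and every flat contains all of them.\<close>
  define Z where "Z = {e \<in> E. rk {e} = 0}"
  have rZ: "rk Z = 0"
    using rank_Un_eq[of Z "{}"] by (auto simp: Z_def rank_empty)
  have ZF: "Z \<in> flats M"
    unfolding flats_def
  proof (clarsimp simp: rZ, intro conjI ballI)
    show "Z \<subseteq> E" by (auto simp: Z_def)
    fix e assume "e \<in> E - Z"
    then have "rk {e} > 0" by (auto simp: Z_def)
    moreover have "rk {e} \<le> rk (insert e Z)" by (rule rank_mono) auto
    ultimately show "0 < rk (insert e Z)" by simp
  qed
  have least: "Z \<subseteq> G" if "G \<in> flats M" for G
  proof
    fix e assume e: "e \<in> Z"
    show "e \<in> G"
    proof (rule ccontr)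
      assume "e \<notin> G"
      then have lt: "rk G < rk (insert e G)" using that e unfolding flats_def Z_def by blast
      obtain B where B: "B \<in> indeps M" "B \<subseteq> insert e G" "card B = rk (insert e G)" using rank_basis .
      have "e \<notin> B"
      proof
        assume "e \<in> B"
        then have "{e} \<in> indeps M" using indep_mono[OF B(1)] by auto
        then show False using rank_indep e by (fastforce simp: Z_def)
      qed
      then have "card B \<le> rk G" using B by (intro card_le_rank) auto
      then show False using lt B by simp
    qed
  qed
  have "bot_flat = Z" unfolding bot_flat_def by (rule Least_equality) (use ZF least in auto)
  then show "bot_flat \<in> flats M" "\<And>G. G \<in> flats M \<Longrightarrow> bot_flat \<subseteq> G" "rk bot_flat = 0"
    using ZF least rZ by auto
qed

lemma rank_pos_flat: "F \<in> flats M \<Longrightarrow> F \<noteq> bot_flat \<Longrightarrow> rk F > 0"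
  using rank_flat_strict[OF bot_flat_flat, of F] bot_flat_least[of F] by (metis gr_zeroI not_less_zero psubsetI)

end

section \<open>The kernel of a finite ranked poset\<close>

definition interval :: "'b::order set \<Rightarrow> 'b \<Rightarrow> 'b \<Rightarrow> 'b set" where
  "interval L x y = {z \<in> L. x \<le> z \<and> z \<le> y}"

lemma finite_interval: "finite L \<Longrightarrow> finite (interval L x y)"
  by (simp add: interval_def)

lemma moebius_self [simp]: "moebius L x x = 1"
  by (simp add: moebius.simps)

lemma moebius_less:
  "finite L \<Longrightarrow> x < y \<Longrightarrow> moebius L x y = - (\<Sum>z\<in>{z\<in>L. x \<le> z \<and> z < y}. moebius L x z)"
  by (subst moebius.simps) auto

lemma sum_moebius_left:
  assumes "finite L" "x \<in> L" "y \<in> L" "x \<le> y"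
  shows "(\<Sum>z\<in>interval L x y. moebius L x z) = (if x = y then 1 else 0)"
proof (cases "x = y")
  case True
  then have "interval L x y = {x}" using assms by (auto simp: interval_def)
  then show ?thesis using True by simp
next
  case False
  then have xy: "x < y" using assms by simp
  have "interval L x y = insert y {z\<in>L. x \<le> z \<and> z < y}"
    using assms by (auto simp: interval_def order.order_iff_strict)
  then show ?thesis using False assms moebius_less[OF assms(1) xy] by simp
qed

lemma sum_interval_swap:
  fixes f :: "'b::order \<Rightarrow> 'b \<Rightarrow> 'c::comm_monoid_add"
  assumes "finite L"
  shows "(\<Sum>w\<in>interval L x y. \<Sum>z\<in>interval L w y. f w z) = (\<Sum>z\<in>interval L x y. \<Sum>w\<in>interval L x z. f w z)"
proof -
  let ?I = "interval L x y"
  have "(\<Sum>w\<in>?I. \<Sum>z\<in>interval L w y. f w z) = (\<Sum>w\<in>?I. \<Sum>z\<in>{z \<in> ?I. w \<le> z}. f w z)"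
    by (intro sum.cong refl) (auto simp: interval_def)
  also have "\<dots> = (\<Sum>z\<in>?I. \<Sum>w\<in>{w \<in> ?I. w \<le> z}. f w z)"
    by (rule sum.swap_restrict) (simp_all add: finite_interval[OF assms])
  also have "\<dots> = (\<Sum>z\<in>?I. \<Sum>w\<in>interval L x z. f w z)"
    by (intro sum.cong refl) (auto simp: interval_def)
  finally show ?thesis .
qed

text \<open>The recursion for \<open>moebius\<close> gives sums over the second argument; this is
  the dual. Let nu(w) be the sum started at w. Summing mu(x, w) * nu(w) over w gives mu(x, y) after
  a swap. By induction only w = x and w = y contribute, and w = y contributes mu(x, y) again, so
  nu(x) = 0.\<close>

lemma sum_moebius_right:
  assumes L: "finite L" and "x \<in> L" "y \<in> L" "x \<le> y"
  shows "(\<Sum>z\<in>interval L x y. moebius L z y) = (if x = y then 1 else 0)"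
  using assms(2-4)
proof (induction "card (interval L x y)" arbitrary: x rule: less_induct)
  case less
  let ?nu = "\<lambda>w. \<Sum>z\<in>interval L w y. moebius L z y"
  show ?case
  proof (cases "x = y")
    case True
    then have "interval L x y = {x}" using less.prems by (auto simp: interval_def)
    then show ?thesis using True by simp
  next
    case False
    have IH: "?nu w = (if w = y then 1 else 0)" if w: "w \<in> interval L x y" "w \<noteq> x" for w
    proof (rule less.hyps)
      have "interval L w y \<subset> interval L x y"
      proof (rule psubsetI)
        show "interval L w y \<subseteq> interval L x y" using w by (auto simp: interval_def)
        have "x \<in> interval L x y" "x \<notin> interval L w y" using w less.prems by (auto simp: interval_def)
        then show "interval L w y \<noteq> interval L x y" by blast
      qed
      then show "card (interval L w y) < card (interval L x y)"
        by (rule psubset_card_mono[OF finite_interval[OF L]])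
    qed (use w less.prems in \<open>auto simp: interval_def\<close>)
    have "(\<Sum>w\<in>interval L x y. moebius L x w * ?nu w) =
        (\<Sum>z\<in>interval L x y. \<Sum>w\<in>interval L x z. moebius L x w * moebius L z y)"
      unfolding sum_distrib_left by (rule sum_interval_swap[OF L])
    also have "\<dots> = (\<Sum>z\<in>interval L x y. if x = z then moebius L z y else 0)"
      unfolding sum_distrib_right[symmetric]
      by (intro sum.cong refl, subst sum_moebius_left[OF L]) (use less.prems in \<open>auto simp: interval_def\<close>)
    also have "\<dots> = moebius L x y"
      using less.prems by (simp add: sum.delta finite_interval[OF L]) (simp add: interval_def)
    finally have 1: "(\<Sum>w\<in>interval L x y. moebius L x w * ?nu w) = moebius L x y" .
    have xin: "x \<in> interval L x y" and yin: "y \<in> interval L x y - {x}"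
      using less.prems False by (auto simp: interval_def)
    have "(\<Sum>w\<in>interval L x y. moebius L x w * ?nu w) =
        ?nu x + (\<Sum>w\<in>interval L x y - {x}. moebius L x w * ?nu w)"
      by (subst sum.remove[OF finite_interval[OF L] xin]) simp
    also have "(\<Sum>w\<in>interval L x y - {x}. moebius L x w * ?nu w) =
        (\<Sum>w\<in>interval L x y - {x}. if w = y then moebius L x w else 0)"
      by (intro sum.cong refl) (use IH in auto)
    also have "\<dots> = moebius L x y"
      using yin by (simp add: finite_interval[OF L])
    finally show ?thesis using 1 False by simp
  qed
qed

text \<open>The characteristic functions form a \<open>P\<close>-kernel in the sense of Stanley.\<close>

lemma moebius_kernel:
  fixes r :: "'b::order \<Rightarrow> nat" and t :: real
  assumes L: "finite L" and xy: "x \<in> L" "y \<in> L" "x < y"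
    and r: "\<And>u v. u \<in> L \<Longrightarrow> v \<in> L \<Longrightarrow> u \<le> v \<Longrightarrow> r u \<le> r v"
  shows "(\<Sum>w\<in>interval L x y.
      (\<Sum>h\<in>interval L x w. of_int (moebius L x h) * t ^ r h) *
      (\<Sum>k\<in>interval L w y. of_int (moebius L w k) * t ^ (r y - r k))) = 0"
proof -
  let ?a = "\<lambda>h. of_int (moebius L x h) * t ^ r h" and ?b = "\<lambda>k. t ^ (r y - r k)"
  have "(\<Sum>w\<in>interval L x y. (\<Sum>h\<in>interval L x w. ?a h) *
      (\<Sum>k\<in>interval L w y. of_int (moebius L w k) * ?b k)) =
      (\<Sum>w\<in>interval L x y. \<Sum>k\<in>interval L w y. \<Sum>h\<in>interval L x w. ?a h * of_int (moebius L w k) * ?b k)"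
    by (simp add: sum_distrib_left sum_distrib_right mult.assoc)
  also have "\<dots> = (\<Sum>k\<in>interval L x y. \<Sum>w\<in>interval L x k. \<Sum>h\<in>interval L x w. ?a h * of_int (moebius L w k) * ?b k)"
    by (rule sum_interval_swap[OF L])
  \<comment> \<open>The two swaps bring the sum over w inside, between h and k. There the dual
    Moebius sum forces h = k, and the remaining powers of t combine to
    \<open>t ^ r y\<close>.\<close>
  also have "\<dots> = (\<Sum>k\<in>interval L x y. \<Sum>h\<in>interval L x k. \<Sum>w\<in>interval L h k. ?a h * of_int (moebius L w k) * ?b k)"
    by (intro sum.cong refl sum_interval_swap[OF L, symmetric])
  also have "\<dots> = (\<Sum>k\<in>interval L x y. \<Sum>h\<in>interval L x k. if h = k then ?a h * ?b k else 0)"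
  proof (intro sum.cong refl)
    fix k h assume kh: "k \<in> interval L x y" "h \<in> interval L x k"
    have "(\<Sum>w\<in>interval L h k. ?a h * of_int (moebius L w k) * ?b k) =
        ?a h * of_int (\<Sum>w\<in>interval L h k. moebius L w k) * ?b k"
      by (simp add: sum_distrib_left sum_distrib_right)
    also have "\<dots> = (if h = k then ?a h * ?b k else 0)"
      by (subst sum_moebius_right[OF L]) (use kh in \<open>auto simp: interval_def\<close>)
    finally show "(\<Sum>w\<in>interval L h k. ?a h * of_int (moebius L w k) * ?b k) = (if h = k then ?a h * ?b k else 0)" .
  qed
  also have "\<dots> = (\<Sum>k\<in>interval L x y. ?a k * ?b k)"
  proof (intro sum.cong refl)
    fix k assume "k \<in> interval L x y"
    then have "k \<in> interval L x k" by (auto simp: interval_def)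
    then show "(\<Sum>h\<in>interval L x k. if h = k then ?a h * ?b k else 0) = ?a k * ?b k"
      by (simp add: finite_interval[OF L])
  qed
  also have "\<dots> = (\<Sum>k\<in>interval L x y. of_int (moebius L x k) * t ^ r y)"
  proof (intro sum.cong refl)
    fix k assume "k \<in> interval L x y"
    then have "r k \<le> r y" using r xy by (auto simp: interval_def)
    then show "?a k * ?b k = of_int (moebius L x k) * t ^ r y"
      by (simp add: mult.assoc flip: power_add)
  qed
  also have "\<dots> = of_int (\<Sum>k\<in>interval L x y. moebius L x k) * t ^ r y"
    by (simp add: sum_distrib_right)
  also have "\<dots> = 0" using sum_moebius_left[OF L xy(1,2)] xy(3) by simp
  finally show ?thesis .
qed

section \<open>Existence and uniqueness of Kazhdan--Lusztig polynomials\<close>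

definition ev :: "int poly \<Rightarrow> real \<Rightarrow> real" where
  "ev p x = poly (map_poly of_int p) x"

lemma map_poly_of_int_simps:
  "map_poly (of_int :: int \<Rightarrow> real) (p + q) = map_poly of_int p + map_poly of_int q"
  "map_poly (of_int :: int \<Rightarrow> real) (p * q) = map_poly of_int p * map_poly of_int q"
  "map_poly (of_int :: int \<Rightarrow> real) (- p) = - map_poly of_int p"
  by (rule poly_eqI; simp add: coeff_map_poly coeff_mult)+

lemma ev_simps:
  "ev (p + q) x = ev p x + ev q x" "ev (p * q) x = ev p x * ev q x"
  "ev (- p) x = - ev p x" "ev (p - q) x = ev p x - ev q x" "ev 0 x = 0" "ev 1 x = 1"
  "ev (monom c n) x = of_int c * x ^ n"
  unfolding diff_conv_add_uminus
  by (simp_all only: ev_def map_poly_of_int_simps) (simp_all add: map_poly_monom poly_monom)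

lemma ev_sum: "ev (\<Sum>i\<in>A. f i) x = (\<Sum>i\<in>A. ev (f i) x)"
  by (induction A rule: infinite_finite_induct) (simp_all add: ev_simps)

lemma degree_map_poly_of_int: "degree (map_poly (of_int :: int \<Rightarrow> real) p) = degree p"
  by (rule degree_map_poly) simp

lemma poly_eq_sum_coeffs: "degree p \<le> n \<Longrightarrow> poly p x = (\<Sum>i\<le>n. coeff p i * x ^ i)"
  for x :: real
  unfolding poly_altdef by (intro sum.mono_neutral_cong_left) (auto simp: coeff_eq_0)

lemma poly_reversal_eq:
  fixes x :: real
  assumes "degree p \<le> n" "x \<noteq> 0"
  shows "x ^ n * poly p (1 / x) = (\<Sum>i\<le>n. coeff p (n - i) * x ^ i)"
proof -
  have "x ^ n * poly p (1 / x) = (\<Sum>i\<le>n. coeff p i * x ^ (n - i))"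
    unfolding poly_eq_sum_coeffs[OF assms(1)] sum_distrib_left
    using assms(2) by (intro sum.cong refl) (simp add: power_diff power_one_over field_simps)
  also have "\<dots> = (\<Sum>i\<le>n. coeff p (n - i) * x ^ i)"
    by (rule sum.reindex_bij_witness[of _ "\<lambda>i. n - i" "\<lambda>i. n - i"]) auto
  finally show ?thesis .
qed

lemma ev_altdef: "degree p \<le> n \<Longrightarrow> ev p x = (\<Sum>i\<le>n. of_int (coeff p i) * x ^ i)"
  unfolding ev_def by (subst poly_eq_sum_coeffs) (simp_all add: degree_map_poly_of_int coeff_map_poly)

lemma reversal_eq:
  fixes x :: real
  shows "degree p \<le> n \<Longrightarrow> x \<noteq> 0 \<Longrightarrow> x ^ n * ev p (1 / x) = (\<Sum>i\<le>n. of_int (coeff p (n - i)) * x ^ i)"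
  unfolding ev_def by (subst poly_reversal_eq) (simp_all add: degree_map_poly_of_int coeff_map_poly)

lemma coeff_eq_if_poly_sums_eq:
  fixes a b :: "nat \<Rightarrow> real"
  assumes "\<And>x. x \<noteq> 0 \<Longrightarrow> (\<Sum>i\<le>n. a i * x ^ i) = (\<Sum>i\<le>n. b i * x ^ i)" "i \<le> n"
  shows "a i = b i"
proof -
  define p where "p = (\<Sum>i\<le>n. monom (a i - b i) i)"
  have "poly p x = 0" if "x \<noteq> 0" for x
    using assms(1)[OF that] by (simp add: p_def poly_sum poly_monom algebra_simps sum_subtractf)
  then have "- {0} \<subseteq> {x. poly p x = 0}" by auto
  moreover have "infinite (- {0::real})" 
    using infinite_remove[OF infinite_UNIV_char_0, of "0::real"] by (simp add: Compl_eq_Diff_UNIV)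
  ultimately have "p = 0" using poly_roots_finite infinite_super by blast
  then have "coeff p i = 0" by simp
  then show ?thesis using assms(2) by (simp add: p_def coeff_sum)
qed

text \<open>Reversal in length n moves the coefficients of p to degrees above n / 2, where q has
  none. Two different polynomials are allowed because in the uniqueness proof the right side belongs
  to the contraction by the loops.\<close>

lemma eq_0_if_reversal_eq:
  fixes p q :: "real poly"
  assumes "\<And>x. x \<noteq> 0 \<Longrightarrow> x ^ n * poly p (1 / x) = poly q x" "2 * degree p < n" "2 * degree q < n"
  shows "p = 0"
proof (rule poly_eqI)
  fix i
  show "coeff p i = coeff 0 i"
  proof (cases "2 * i < n")
    case True
    have "coeff p (n - (n - i)) = coeff q (n - i)"
      by (rule coeff_eq_if_poly_sums_eq[where n = n and a = "\<lambda>i. coeff p (n - i)" and b = "coeff q"])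
        (use assms poly_reversal_eq[of p n] poly_eq_sum_coeffs[of q n] in auto)
    moreover have "coeff q (n - i) = 0" using True assms(3) by (intro coeff_eq_0) linarith
    ultimately show ?thesis using True by simp
  next
    case False
    then show ?thesis using assms(2) by (simp add: coeff_eq_0)
  qed
qed

text \<open>The Kazhdan--Lusztig polynomial is minus the lower half of the sum of the other terms of its
  defining recursion, once that sum is known to be antisymmetric.\<close>

definition low_part :: "nat \<Rightarrow> int poly \<Rightarrow> int poly" where
  "low_part n S = (\<Sum>i\<in>{i. 2 * i < n}. monom (coeff S i) i)"

lemma finite_low: "finite {i. 2 * i < (n::nat)}"
  by (rule finite_subset[of _ "{..n}"]) auto

lemma coeff_low_part: "coeff (low_part n S) i = (if 2 * i < n then coeff S i else 0)"
  by (simp add: low_part_def coeff_sum finite_low if_distrib[of "\<lambda>x. coeff x _"] cong: if_cong)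

lemma degree_low_part: "n > 0 \<Longrightarrow> 2 * degree (low_part n S) < n"
proof -
  assume "n > 0"
  have "degree (low_part n S) \<le> (n - 1) div 2"
    by (rule degree_le) (auto simp: coeff_low_part)
  then show ?thesis using \<open>n > 0\<close> by linarith
qed

lemma low_part_reversal:
  fixes x :: real
  assumes deg: "degree S \<le> n" and x: "x \<noteq> 0"
    and anti: "\<And>x. x \<noteq> 0 \<Longrightarrow> x ^ n * ev S (1 / x) = - ev S x"
  shows "x ^ n * ev (- low_part n S) (1 / x) = ev (- low_part n S) x + ev S x"
proof -
  have c: "of_int (coeff S (n - i)) = - (of_int (coeff S i) :: real)" if "i \<le> n" for i
    by (rule coeff_eq_if_poly_sums_eq[where n = n and a = "\<lambda>i. of_int (coeff S (n - i))"
          and b = "\<lambda>i. - of_int (coeff S i)", OF _ that])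
      (use anti reversal_eq[OF deg] ev_altdef[OF deg] in \<open>simp add: sum_negf\<close>)
  have dl: "degree (- low_part n S) \<le> n"
    by (rule degree_le) (auto simp: coeff_low_part)
  have "of_int (coeff (- low_part n S) (n - i)) = of_int (coeff (- low_part n S) i) + (of_int (coeff S i) :: real)"
    if "i \<le> n" for i
  proof -
    consider "2 * i < n" | "2 * i = n" | "2 * i > n" by linarith
    then show ?thesis
    proof cases
      case 1
      then have "\<not> 2 * (n - i) < n" by linarith
      then show ?thesis using 1 by (simp add: coeff_low_part)
    next
      \<comment> \<open>The middle coefficient lies in neither half; antisymmetry makes it equal to
        its own negative, hence 0.\<close>
      case 2
      then have "n - i = i" by simp
      then have "coeff S i = 0" using c[OF that] by simp
      then show ?thesis using 2 by (simp add: coeff_low_part)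
    next
      case 3
      then have "2 * (n - i) < n" "\<not> 2 * i < n" using that by linarith+
      then show ?thesis using c[OF that] by (simp add: coeff_low_part)
    qed
  qed
  then show ?thesis
    by (subst reversal_eq[OF dl x])
      (auto simp: ev_altdef[OF dl] ev_altdef[OF deg] distrib_right left_diff_distrib simp flip: sum.distrib intro!: sum.cong)
qed

section \<open>Characteristic polynomials of minors as a kernel\<close>

context finite_matroid
begin

text \<open>The characteristic polynomial of the minor obtained by restricting to G and contracting
  F. It is expressed in the lattice of M, so that all these polynomials can enter one kernel
  identity.\<close>

definition char_fun :: "'a set \<Rightarrow> 'a set \<Rightarrow> int poly" where
  "char_fun F G = (\<Sum>H\<in>interval (flats M) F G. monom (moebius (flats M) F H) (rk G - rk H))"

lemma charpoly_restr_eq: "charpoly_restr M G = char_fun bot_flat G"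
proof -
  have "{H \<in> flats M. H \<subseteq> G} = interval (flats M) bot_flat G"
    using bot_flat_least by (auto simp: interval_def)
  then show ?thesis by (simp add: charpoly_restr_def char_fun_def bot_flat_def)
qed

lemma bot_flat_contraction:
  assumes F: "F \<in> flats M"
  shows "(LEAST H. H \<in> flats (contraction M F)) = {}"
  by (rule Least_equality) (use F in \<open>auto simp: flats_contraction[OF flat_subset[OF F]]\<close>)

lemma bij_betw_interval_contraction:
  assumes F: "F \<in> flats M" and G: "F \<subseteq> G"
  shows "bij_betw (\<lambda>H. H - F) (interval (flats M) F G) (interval (flats (contraction M F)) {} (G - F))"
proof (rule bij_betw_imageI)
  show "inj_on (\<lambda>H. H - F) (interval (flats M) F G)"
    by (rule inj_onI) (auto simp: interval_def)
  show "(\<lambda>H. H - F) ` interval (flats M) F G = interval (flats (contraction M F)) {} (G - F)"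
    using G unfolding flats_contraction[OF flat_subset[OF F]] interval_def by blast
qed

lemma moebius_contraction:
  assumes F: "F \<in> flats M" and "G \<in> flats M" "F \<subseteq> G"
  shows "moebius (flats (contraction M F)) {} (G - F) = moebius (flats M) F G"
  using assms(2,3)
proof (induction "card G" arbitrary: G rule: less_induct)
  case less
  interpret C: finite_matroid "contraction M F"
    by unfold_locales (rule is_matroid_contraction[OF flat_subset[OF F]])
  show ?case
  proof (cases "F = G")
    case False
    then have lt: "F \<subset> G" "{} \<subset> G - F" using less.prems by auto
    have "(\<Sum>z\<in>{z \<in> flats (contraction M F). {} \<subseteq> z \<and> z \<subset> G - F}. moebius (flats (contraction M F)) {} z)
        = (\<Sum>H\<in>{z \<in> flats M. F \<subseteq> z \<and> z \<subset> G}. moebius (flats M) F H)"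
    proof (rule sum.reindex_cong[of "\<lambda>H. H - F"])
      show "inj_on (\<lambda>H. H - F) {z \<in> flats M. F \<subseteq> z \<and> z \<subset> G}"
        by (rule inj_onI) auto
      show "{z \<in> flats (contraction M F). {} \<subseteq> z \<and> z \<subset> G - F} =
          (\<lambda>H. H - F) ` {z \<in> flats M. F \<subseteq> z \<and> z \<subset> G}"
        using less.prems unfolding flats_contraction[OF flat_subset[OF F]] by blast
      fix H assume H: "H \<in> {z \<in> flats M. F \<subseteq> z \<and> z \<subset> G}"
      have "finite G" using less.prems flat_subset finite_ground finite_subset by blast
      then have "card H < card G" using H by (intro psubset_card_mono) auto
      then show "moebius (flats (contraction M F)) {} (H - F) = moebius (flats M) F H"
        using less.hyps H by auto
    qed
    then show ?thesis
      by (simp only: moebius_less[OF finite_flats lt(1)] moebius_less[OF C.finite_flats lt(2)])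
  qed simp
qed

lemma charpoly_restr_contraction:
  assumes F: "F \<in> flats M" and G: "G \<in> flats M" "F \<subseteq> G"
  shows "charpoly_restr (contraction M F) (G - F) = char_fun F G"
proof -
  interpret C: finite_matroid "contraction M F"
    by unfold_locales (rule is_matroid_contraction[OF flat_subset[OF F]])
  have r: "C.rk (G - F) - C.rk (H - F) = rk G - rk H" if "H \<in> flats M" "F \<subseteq> H" "H \<subseteq> G" for H
  proof -
    have "G - F \<subseteq> E - F" "H - F \<subseteq> E - F" "G - F \<union> F = G" "H - F \<union> F = H"
      using that G flat_subset[OF G(1)] flat_subset[OF that(1)] by auto
    then show ?thesis
      using rank_contraction[OF flat_subset[OF F], of "G - F"] rank_contraction[OF flat_subset[OF F], of "H - F"]
      by simp
  qed
  have "{} = C.bot_flat" using bot_flat_contraction[OF F] C.bot_flat_def by simp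
  then have "charpoly_restr (contraction M F) (G - F) = C.char_fun {} (G - F)"
    using C.charpoly_restr_eq by simp
  also have "\<dots> = char_fun F G"
    unfolding C.char_fun_def char_fun_def
    unfolding sum.reindex_bij_betw[OF bij_betw_interval_contraction[OF F G(2)], symmetric]
    by (intro sum.cong refl) (simp add: interval_def moebius_contraction[OF F] r)
  finally show ?thesis .
qed

lemma sum_flats_contraction:
  assumes F: "F \<in> flats M"
  shows "(\<Sum>G\<in>flats (contraction M F). charpoly_restr (contraction M F) G * f (contraction (contraction M F) G)) =
    (\<Sum>G\<in>{G \<in> flats M. F \<subseteq> G}. char_fun F G * f (contraction M G))"
proof -
  have "inj_on (\<lambda>G. G - F) {G \<in> flats M. F \<subseteq> G}" by (rule inj_onI) auto
  then show ?thesis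
    unfolding flats_contraction[OF flat_subset[OF F]]
    by (subst sum.reindex)
      (auto intro!: sum.cong simp: charpoly_restr_contraction[OF F] contraction_contraction[OF flat_subset[OF F]] flat_subset)
qed

lemma char_fun_self: "F \<in> flats M \<Longrightarrow> char_fun F F = 1"
proof -
  assume "F \<in> flats M"
  then have "interval (flats M) F F = {F}" by (auto simp: interval_def)
  then show ?thesis by (simp add: char_fun_def)
qed

lemma degree_char_fun: "degree (char_fun F G) \<le> rk G"
  unfolding char_fun_def
  by (intro degree_sum_le finite_interval finite_flats) (meson degree_monom_le diff_le_self order_trans)

lemma ev_char_fun_reversal:
  assumes "x \<noteq> 0"
  shows "x ^ rk G * ev (char_fun F G) (1 / x) =
    (\<Sum>H\<in>interval (flats M) F G. of_int (moebius (flats M) F H) * x ^ rk H)"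
  unfolding char_fun_def ev_sum ev_simps sum_distrib_left
proof (intro sum.cong refl)
  fix H assume "H \<in> interval (flats M) F G"
  then have le: "rk H \<le> rk G" by (intro rank_mono) (auto simp: interval_def)
  then have "x ^ rk G = x ^ rk H * x ^ (rk G - rk H)" by (simp flip: power_add)
  then show "x ^ rk G * (of_int (moebius (flats M) F H) * (1 / x) ^ (rk G - rk H)) =
      of_int (moebius (flats M) F H) * x ^ rk H"
    using assms by (simp add: power_one_over)
qed

text \<open>Reversing \<open>char_fun bot_flat F\<close> replaces the exponents rk F - rk H by rk H,
  which is the first factor in \<open>moebius_kernel\<close>.\<close>

lemma char_fun_kernel:
  assumes "G \<in> flats M" "G \<noteq> bot_flat" "x \<noteq> 0"
  shows "(\<Sum>F\<in>interval (flats M) bot_flat G.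
    x ^ rk F * ev (char_fun bot_flat F) (1 / x) * ev (char_fun F G) x) = 0"
  using moebius_kernel[of "flats M" bot_flat G rk x] finite_flats bot_flat_flat assms rank_mono
    bot_flat_least[of G]
  unfolding ev_char_fun_reversal[OF assms(3)]
  by (auto simp: char_fun_def ev_sum ev_simps)

end

text \<open>The conditions \<open>F \<noteq> {}\<close> and \<open>finite (ground M)\<close> make
  the ground set strictly smaller in every recursive call. On a matroid the index set is
  \<open>flats M - {bot_flat}\<close>, see \<open>kl_rec_eq\<close>.\<close>

function kl_rec :: "'a matroid \<Rightarrow> int poly" where
  "kl_rec M = (if mrank M = 0 then 1 else
     - low_part (mrank M) (\<Sum>F\<in>{F \<in> flats M. F \<noteq> (LEAST H. H \<in> flats M) \<and> F \<noteq> {} \<and> finite (ground M)}.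
         charpoly_restr M F * kl_rec (contraction M F)))"
  by auto
termination
proof (relation "measure (\<lambda>M. card (ground M))", goal_cases)
  case (2 M F)
  then have "ground (contraction M F) \<subset> ground M" by (auto simp: contraction_def flats_def)
  then show ?case using 2 by (auto intro: psubset_card_mono)
qed simp

declare kl_rec.simps [simp del]

context finite_matroid
begin

definition kl_defect :: "int poly" where
  "kl_defect = (\<Sum>F\<in>flats M - {bot_flat}. charpoly_restr M F * kl_rec (contraction M F))"

lemma kl_rec_eq: "kl_rec M = (if mrank M = 0 then 1 else - low_part (mrank M) kl_defect)"
proof -
  have "{F \<in> flats M. F \<noteq> (LEAST H. H \<in> flats M) \<and> F \<noteq> {} \<and> finite (ground M)} = flats M - {bot_flat}"
    using bot_flat_least finite_ground by (auto simp: bot_flat_def)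
  then show ?thesis by (subst kl_rec.simps) (simp add: kl_defect_def)
qed

lemma kl_rec_degree: "mrank M > 0 \<Longrightarrow> 2 * degree (kl_rec M) < mrank M"
  by (simp add: kl_rec_eq degree_low_part)

lemma kl_rec_degree_le: "degree (kl_rec M) \<le> mrank M"
  using kl_rec_degree by (cases "mrank M = 0") (auto simp: kl_rec_eq)

text \<open>The bottom flat consists of the loops, so the contraction need not be \<open>M\<close> itself.\<close>

lemma kl_rec_contraction_bot: "kl_rec (contraction M bot_flat) = kl_rec M"
proof -
  note b = bot_flat_flat flat_subset[OF bot_flat_flat]
  interpret C: finite_matroid "contraction M bot_flat"
    by unfold_locales (rule is_matroid_contraction[OF b(2)])
  have r: "mrank (contraction M bot_flat) = mrank M"
    using mrank_contraction[OF b(2)] rank_bot_flat by simp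
  have C0: "C.bot_flat = {}" using bot_flat_contraction[OF b(1)] C.bot_flat_def by simp
  have "flats (contraction M bot_flat) - {{}} = (\<lambda>G. G - bot_flat) ` (flats M - {bot_flat})"
    using bot_flat_least unfolding flats_contraction[OF b(2)] by blast
  moreover have "inj_on (\<lambda>G. G - bot_flat) (flats M - {bot_flat})"
    by (rule inj_onI) (use bot_flat_least in blast)
  ultimately have "C.kl_defect = kl_defect"
    unfolding C.kl_defect_def kl_defect_def C0
    by (auto simp: sum.reindex charpoly_restr_contraction[OF b(1)] contraction_contraction[OF b(2)]
        flat_subset bot_flat_least charpoly_restr_eq intro!: sum.cong)
  then show ?thesis by (simp add: kl_rec_eq C.kl_rec_eq r)
qed

end

text \<open>In the reversed defect, every contraction by a flat other than the least one satisfies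
  its own recursion by induction. After exchanging F and G, the kernel identity turns the sum over F
  into the negative of its missing term at \<open>bot_flat\<close>. So the defect is antisymmetric,
  and \<open>low_part_reversal\<close> applies.\<close>

theorem kl_assignment_kl_rec: "kl_assignment (kl_rec :: 'a matroid \<Rightarrow> int poly)"
proof -
  have main: "x ^ mrank M * ev (kl_rec M) (1 / x) =
      ev (\<Sum>F\<in>flats M. charpoly_restr M F * kl_rec (contraction M F)) x"
    if "is_matroid M" "x \<noteq> 0" for M :: "'a matroid" and x
    using that
  proof (induction "mrank M" arbitrary: M x rule: less_induct)
    case less
    then interpret finite_matroid M by unfold_locales
    note b = bot_flat_flat
    let ?r = "mrank M" and ?P = "\<lambda>F. kl_rec (contraction M F)"
    have split: "(\<Sum>F\<in>flats M. charpoly_restr M F * ?P F) = kl_rec M + kl_defect"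
      unfolding kl_defect_def
      by (subst sum.remove[OF finite_flats b]) (simp add: charpoly_restr_eq char_fun_self[OF b] kl_rec_contraction_bot)
    show ?case
    proof (cases "?r = 0")
      case True
      have "F = bot_flat" if "F \<in> flats M" for F
        using rank_pos_flat[OF that] rank_flat_le_mrank[OF that] True by linarith
      then have "flats M - {bot_flat} = {}" by blast
      then have "kl_defect = 0" unfolding kl_defect_def by (metis sum.empty)
      then show ?thesis unfolding split by (simp add: True kl_rec_eq ev_simps)
    next
      case False
      have deg: "degree kl_defect \<le> ?r"
        unfolding kl_defect_def
      proof (rule degree_sum_le)
        fix F assume F: "F \<in> flats M - {bot_flat}"
        then interpret C: finite_matroid "contraction M F"
          by (intro finite_matroid.intro is_matroid_contraction flat_subset) auto
        have "degree (charpoly_restr M F * ?P F) \<le> degree (charpoly_restr M F) + degree (?P F)"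
          by (rule degree_mult_le)
        also have "\<dots> \<le> rk F + mrank (contraction M F)"
          using degree_char_fun C.kl_rec_degree_le by (intro add_mono) (auto simp: charpoly_restr_eq)
        also have "\<dots> = ?r" using mrank_contraction[of F] F flat_subset by simp
        finally show "degree (charpoly_restr M F * ?P F) \<le> ?r" .
      qed (use finite_flats in auto)
      have anti: "y ^ ?r * ev kl_defect (1 / y) = - ev kl_defect y" if y: "y \<noteq> 0" for y
      proof -
        let ?c = "\<lambda>F. y ^ rk F * ev (char_fun bot_flat F) (1 / y)"
        have IH: "y ^ (?r - rk F) * ev (?P F) (1 / y) =
            (\<Sum>G\<in>{G \<in> flats M. F \<subseteq> G}. ev (char_fun F G) y * ev (?P G) y)"
          if F: "F \<in> flats M - {bot_flat}" for F
        proof -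
          have r: "mrank (contraction M F) = ?r - rk F" using mrank_contraction[of F] F flat_subset by simp
          have "mrank (contraction M F) < ?r" using r rank_pos_flat[of F] F False by simp
          have Ff: "F \<in> flats M" using F by simp
          from less.hyps[OF \<open>mrank (contraction M F) < ?r\<close> is_matroid_contraction[OF flat_subset[OF Ff]] y]
          show ?thesis unfolding r sum_flats_contraction[OF Ff] ev_sum ev_simps .
        qed
        have "y ^ ?r * ev kl_defect (1 / y) =
            (\<Sum>F\<in>flats M - {bot_flat}. ?c F * (y ^ (?r - rk F) * ev (?P F) (1 / y)))"
          unfolding kl_defect_def ev_sum ev_simps sum_distrib_left charpoly_restr_eq
        proof (intro sum.cong refl)
          fix F assume "F \<in> flats M - {bot_flat}"
          then have "y ^ ?r = y ^ rk F * y ^ (?r - rk F)"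
            using rank_flat_le_mrank[of F] by (simp flip: power_add)
          then show "y ^ ?r * (ev (char_fun bot_flat F) (1 / y) * ev (?P F) (1 / y)) =
            ?c F * (y ^ (?r - rk F) * ev (?P F) (1 / y))" by simp
        qed
        also have "\<dots> = (\<Sum>F\<in>flats M - {bot_flat}. \<Sum>G\<in>{G \<in> flats M. F \<subseteq> G}.
            ?c F * ev (char_fun F G) y * ev (?P G) y)"
          by (intro sum.cong refl) (simp add: IH sum_distrib_left mult.assoc)
        \<comment> \<open>A flat containing some F other than the least flat is not the least one
          either, so both indices can range over the same set before the exchange.\<close>
        also have "\<dots> = (\<Sum>F\<in>flats M - {bot_flat}. \<Sum>G\<in>{G \<in> flats M - {bot_flat}. F \<subseteq> G}.
            ?c F * ev (char_fun F G) y * ev (?P G) y)"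
          using bot_flat_least by (intro sum.cong refl) auto
        also have "\<dots> = (\<Sum>G\<in>flats M - {bot_flat}. \<Sum>F\<in>{F \<in> flats M - {bot_flat}. F \<subseteq> G}.
            ?c F * ev (char_fun F G) y * ev (?P G) y)"
          using finite_flats by (intro sum.swap_restrict) auto
        also have "\<dots> = (\<Sum>G\<in>flats M - {bot_flat}. - ev (char_fun bot_flat G) y * ev (?P G) y)"
        proof (intro sum.cong refl)
          fix G assume G: "G \<in> flats M - {bot_flat}"
          have "interval (flats M) bot_flat G = insert bot_flat {F \<in> flats M - {bot_flat}. F \<subseteq> G}"
            using G b bot_flat_least by (auto simp: interval_def)
          then have "(\<Sum>F\<in>interval (flats M) bot_flat G. ?c F * ev (char_fun F G) y) =
              ev (char_fun bot_flat G) y + (\<Sum>F\<in>{F \<in> flats M - {bot_flat}. F \<subseteq> G}. ?c F * ev (char_fun F G) y)"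
            using finite_flats by (simp add: char_fun_self[OF b] rank_bot_flat ev_simps)
          then have "(\<Sum>F\<in>{F \<in> flats M - {bot_flat}. F \<subseteq> G}. ?c F * ev (char_fun F G) y) = - ev (char_fun bot_flat G) y"
            using char_fun_kernel[of G y] G y by simp
          then show "(\<Sum>F\<in>{F \<in> flats M - {bot_flat}. F \<subseteq> G}. ?c F * ev (char_fun F G) y * ev (?P G) y) =
              - ev (char_fun bot_flat G) y * ev (?P G) y"
            by (simp only: sum_distrib_right[symmetric])
        qed
        also have "\<dots> = - ev kl_defect y"
          by (simp add: kl_defect_def ev_sum ev_simps charpoly_restr_eq sum_negf)
        finally show ?thesis .
      qed
      have "kl_rec M = - low_part ?r kl_defect" using False kl_rec_eq by simp
      then show ?thesis unfolding split ev_simps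
        using low_part_reversal[OF deg less.prems(2) anti] by simp
    qed
  qed
  show ?thesis
    unfolding kl_assignment_def
  proof (intro allI impI conjI)
    fix M :: "'a matroid" assume M: "is_matroid M"
    interpret finite_matroid M by unfold_locales (rule M)
    show "kl_rec M = 1" if "mrank M = 0" using that kl_rec_eq by simp
    show "2 * degree (kl_rec M) < mrank M" if "0 < mrank M" using that kl_rec_degree by simp
    fix x :: real assume "x \<noteq> 0"
    from main[OF M this] show "x ^ mrank M * poly (map_poly of_int (kl_rec M)) (1 / x) =
      poly (map_poly of_int (\<Sum>F\<in>flats M. charpoly_restr M F * kl_rec (contraction M F))) x"
      by (simp add: ev_def)
  qed
qed

lemma kl_assignment_unique:
  assumes P: "kl_assignment P" and Q: "kl_assignment Q" and "is_matroid M"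
  shows "P M = Q M"
  using assms(3)
proof (induction "mrank M" arbitrary: M rule: less_induct)
  case less
  then interpret finite_matroid M by unfold_locales
  show ?case
  proof (cases "mrank M = 0")
    case True
    then show ?thesis using P Q less.prems unfolding kl_assignment_def by metis
  next
    case False
    \<comment> \<open>Contracting the loops keeps the rank, so the induction hypothesis does not
      reach \<open>?Z\<close>. It is enough that the difference of P and Q at M reverses to their
      difference at \<open>?Z\<close> and that both have small degree.\<close>
    let ?Z = "contraction M bot_flat"
    have Z: "is_matroid ?Z" "mrank ?Z = mrank M"
      using is_matroid_contraction[of bot_flat] mrank_contraction[of bot_flat] flat_subset[OF bot_flat_flat] rank_bot_flat by auto
    have deg: "2 * degree (P M - Q M) < mrank M" if "is_matroid M" "mrank M \<noteq> 0" for M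
    proof -
      have "2 * degree (P M) < mrank M" "2 * degree (Q M) < mrank M"
        using P Q that unfolding kl_assignment_def by auto
      then show ?thesis using degree_diff_le_max[of "P M" "Q M"] by linarith
    qed
    let ?R = "map_poly of_int :: int poly \<Rightarrow> real poly"
    have "?R (P M - Q M) = 0"
    proof (rule eq_0_if_reversal_eq[of "mrank M" _ "?R (P ?Z - Q ?Z)"])
      fix x :: real assume x: "x \<noteq> 0"
      have eq: "x ^ mrank M * ev (R M) (1 / x) = ev (R ?Z) x +
          (\<Sum>F\<in>flats M - {bot_flat}. ev (charpoly_restr M F) x * ev (R (contraction M F)) x)"
        if "kl_assignment R" for R
      proof -
        have "x ^ mrank M * ev (R M) (1 / x) = ev (\<Sum>F\<in>flats M. charpoly_restr M F * R (contraction M F)) x"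
          using that less.prems x unfolding kl_assignment_def ev_def by blast
        then show ?thesis
          by (subst (asm) sum.remove[OF finite_flats bot_flat_flat])
            (simp add: ev_simps ev_sum charpoly_restr_eq char_fun_self[OF bot_flat_flat])
      qed
      have "P (contraction M F) = Q (contraction M F)" if F: "F \<in> flats M - {bot_flat}" for F
      proof (rule less.hyps)
        show "mrank (contraction M F) < mrank M"
          using mrank_contraction[of F] F flat_subset rank_pos_flat[of F] by fastforce
        show "is_matroid (contraction M F)" using F flat_subset by (intro is_matroid_contraction) auto
      qed
      then have "(\<Sum>F\<in>flats M - {bot_flat}. ev (charpoly_restr M F) x * ev (P (contraction M F)) x) =
          (\<Sum>F\<in>flats M - {bot_flat}. ev (charpoly_restr M F) x * ev (Q (contraction M F)) x)"
        by (intro sum.cong) auto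
      then show "x ^ mrank M * poly (?R (P M - Q M)) (1 / x) = poly (?R (P ?Z - Q ?Z)) x"
        using eq[OF P] eq[OF Q] by (simp add: ev_simps right_diff_distrib flip: ev_def)
    qed (use deg[OF less.prems] deg[OF Z(1)] Z(2) False in \<open>simp_all add: degree_map_poly_of_int\<close>)
    then show ?thesis by (simp add: map_poly_eq_0_iff)
  qed
qed

lemma kl_poly_eq:
  assumes "is_matroid M" shows "kl_poly M = kl_rec M"
  unfolding kl_poly_def
  by (rule the_equality) (use kl_assignment_kl_rec kl_assignment_unique assms in blast)+

section \<open>Wronskians and strict interlacing\<close>

text \<open>The list of roots is carried along because \<open>root_chain\<close> splices root lists;
  its strict order encodes that the roots are simple.\<close>

definition neg_rooted :: "real poly \<Rightarrow> real list \<Rightarrow> bool" where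
  "neg_rooted f xs \<longleftrightarrow> sorted_wrt (<) xs \<and> (\<forall>x\<in>set xs. x < 0) \<and>
     (\<exists>c>0. f = smult c (\<Prod>x\<leftarrow>xs. [:- x, 1:]))"

lemma poly_prod_linear: "poly (\<Prod>x\<leftarrow>xs. [:- x, 1:]) t = (\<Prod>x\<leftarrow>xs. t - x)"
  for t :: "'a::comm_ring_1"
  by (induction xs) (auto simp: algebra_simps)

lemma prod_linear_nonzero: "(\<Prod>x\<leftarrow>xs. [:- x, 1:]) \<noteq> (0 :: 'a::idom poly)"
  by (auto simp: prod_list_zero_iff)

lemma degree_prod_linear: "degree (\<Prod>x\<leftarrow>xs. [:- x, 1 :: 'a::idom:]) = length xs"
proof (induction xs)
  case (Cons a xs)
  have "degree ([:- a, 1:] * (\<Prod>x\<leftarrow>xs. [:- x, 1:])) = 1 + length xs"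
    using Cons prod_linear_nonzero[of xs] by (subst degree_mult_eq) auto
  then show ?case by simp
qed simp

lemma lead_coeff_prod_linear: "lead_coeff (\<Prod>x\<leftarrow>xs. [:- x, 1 :: 'a::idom:]) = 1"
proof (induction xs)
  case (Cons a xs)
  have "lead_coeff ([:- a, 1:] * (\<Prod>x\<leftarrow>xs. [:- x, 1:])) = 1"
    using Cons by (subst lead_coeff_mult) auto
  then show ?case by simp
qed simp

text \<open>At a root the derivative is the product of the differences to all other roots, and the
  \<open>length xs - Suc i\<close> differences to larger roots are the negative ones.\<close>

lemma sign_pderiv_prod_linear:
  fixes xs :: "real list"
  assumes "sorted_wrt (<) xs" "i < length xs"
  shows "(-1) ^ (length xs - Suc i) * poly (pderiv (\<Prod>x\<leftarrow>xs. [:- x, 1:])) (xs ! i) > 0"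
  using assms
proof (induction xs arbitrary: i)
  case (Cons a xs)
  let ?g = "\<Prod>x\<leftarrow>xs. [:- x, 1:]"
  have der: "poly (pderiv (\<Prod>x\<leftarrow>a # xs. [:- x, 1:])) t = (t - a) * poly (pderiv ?g) t + poly ?g t" for t
    by (simp add: pderiv_diff pderiv_pCons pderiv_smult algebra_simps)
  show ?case
  proof (cases i)
    case 0
    have "\<forall>x\<in>set ys. a < x \<Longrightarrow> (-1) ^ length ys * (\<Prod>x\<leftarrow>ys. a - x) > 0" for ys
    proof (induction ys)
      case (Cons b ys)
      then have "(b - a) * ((-1) ^ length ys * (\<Prod>x\<leftarrow>ys. a - x)) > 0" by simp
      then show ?case by (simp add: algebra_simps)
    qed simp
    then have "(-1) ^ length xs * poly ?g a > 0"
      using Cons.prems by (simp add: poly_prod_linear)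
    then show ?thesis unfolding der using 0 by simp
  next
    case (Suc j)
    have j: "j < length xs" using Suc Cons.prems by simp
    have z: "poly ?g (xs ! j) = 0" using j by (auto simp: poly_prod_linear prod_list_zero_iff)
    have gt: "xs ! j - a > 0" using j Cons.prems by simp
    have "(-1) ^ (length xs - Suc j) * poly (pderiv ?g) (xs ! j) > 0"
      using Cons j by simp
    from mult_pos_pos[OF gt this] show ?thesis
      unfolding der using Suc z by (simp add: algebra_simps)
  qed
qed simp

lemma neg_rooted_degree: "neg_rooted f xs \<Longrightarrow> degree f = length xs"
  unfolding neg_rooted_def by (auto simp: degree_prod_linear)

lemma neg_rooted_lead_coeff: "neg_rooted f xs \<Longrightarrow> lead_coeff f > 0"
  unfolding neg_rooted_def by (auto simp: lead_coeff_prod_linear[unfolded degree_prod_linear] degree_prod_linear)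

lemma neg_rooted_root_iff: "neg_rooted f xs \<Longrightarrow> poly f x = 0 \<longleftrightarrow> x \<in> set xs"
  unfolding neg_rooted_def by (auto simp: poly_prod_linear prod_list_zero_iff)

lemma neg_rooted_pderiv_sign:
  assumes "neg_rooted f xs" "i < length xs"
  shows "(-1) ^ (length xs - Suc i) * poly (pderiv f) (xs ! i) > 0"
proof -
  obtain c where c: "c > 0" "f = smult c (\<Prod>x\<leftarrow>xs. [:- x, 1:])" and s: "sorted_wrt (<) xs"
    using assms(1) unfolding neg_rooted_def by blast
  show ?thesis
    using mult_pos_pos[OF c(1) sign_pderiv_prod_linear[OF s assms(2)]]
    by (simp add: c(2) pderiv_smult algebra_simps)
qed

lemma neg_rooted_pos:
  assumes "neg_rooted f xs" "x \<ge> 0"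
  shows "poly f x > 0"
proof -
  have "\<forall>y\<in>set ys. y < 0 \<Longrightarrow> (\<Prod>y\<leftarrow>ys. x - y) > 0" for ys
    using assms(2) by (induction ys) auto
  then show ?thesis
    using assms(1) unfolding neg_rooted_def by (auto simp: poly_prod_linear)
qed

lemma poly_eq_smult_prod_linear:
  fixes g :: "real poly"
  assumes "distinct ys" "\<forall>y\<in>set ys. poly g y = 0" "degree g = length ys"
  shows "g = smult (lead_coeff g) (\<Prod>x\<leftarrow>ys. [:- x, 1:])"
  using assms
proof (induction ys arbitrary: g)
  case Nil
  then show ?case by (auto elim: degree_eq_zeroE)
next
  case (Cons y ys)
  then obtain h where h: "g = [:- y, 1:] * h"
    using poly_eq_0_iff_dvd[of g y] by (auto elim: dvdE)
  have "h \<noteq> 0" using Cons.prems h by auto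
  then have deg: "degree h = length ys" using Cons.prems h by (simp add: degree_mult_eq del: mult_pCons_left)
  have roots: "\<forall>z\<in>set ys. poly h z = 0"
    using Cons.prems h by (auto simp: algebra_simps)
  have lc: "lead_coeff g = lead_coeff h" unfolding h by (subst lead_coeff_mult) simp
  have "h = smult (lead_coeff h) (\<Prod>x\<leftarrow>ys. [:- x, 1:])"
    using Cons.IH[of h] Cons.prems deg roots by simp
  then show ?case unfolding lc using h by (metis (no_types, lifting) list.simps(9) mult_smult_right prod_list.Cons)
qed

lemma poly_sign_at_minus_infinity:
  fixes g :: "real poly"
  assumes "lead_coeff g > 0"
  shows "\<exists>x<b. (-1) ^ degree g * poly g x > 0"
proof -
  let ?h = "smult ((-1) ^ degree g) (pcompose g [:0, -1:])"
  have "lead_coeff ?h = lead_coeff g"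
    by (simp add: lead_coeff_comp flip: power_add mult_2 power_mult_distrib)
  then obtain n where n: "\<forall>x\<ge>n. poly ?h x \<ge> lead_coeff g"
    using poly_pinfty_gt_lc[of ?h] assms by auto
  have "poly ?h (max n (1 - b)) > 0" using n assms by (smt (verit, best) max.cobounded1)
  then have "(-1) ^ degree g * poly g (- max n (1 - b)) > 0" by (simp add: poly_pcompose)
  moreover have "- max n (1 - b) < b" by simp
  ultimately show ?thesis by blast
qed

lemma set_splice: "set (splice xs ys) = set xs \<union> set ys"
  by (induction xs ys rule: splice.induct) auto

lemma sorted_wrt_splice:
  fixes xs ys :: "real list"
  assumes "length xs = length ys" "\<forall>i<length xs. xs ! i < ys ! i"
    "\<forall>i. Suc i < length xs \<longrightarrow> ys ! i < xs ! Suc i"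
  shows "sorted_wrt (<) (splice xs ys)"
  using assms
proof (induction xs ys rule: list_induct2)
  case (Cons x xs y ys)
  have IH: "sorted_wrt (<) (splice xs ys)"
    by (rule Cons.IH) (use Cons.prems in fastforce)+
  have xy: "x < y" using Cons.prems(1) by (auto dest: spec[of _ 0])
  show ?case
  proof (cases xs)
    case Nil
    then show ?thesis using Cons xy by simp
  next
    case (Cons x' xs')
    have "y < x'" using Cons.prems(2)[rule_format, of 0] Cons by simp
    then show ?thesis using IH xy Cons by (simp add: sorted_wrt2 del: sorted_wrt.simps)
  qed
qed simp

section \<open>Interlacing from the sign of the Wronskian\<close>

definition wronskian :: "real poly \<Rightarrow> real poly \<Rightarrow> real \<Rightarrow> real" where
  "wronskian f g x = poly f x * poly (pderiv g) x - poly (pderiv f) x * poly g x"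

text \<open>At a root of f the Wronskian is - f' g, so g has the sign opposite to f' and alternates
  along the roots of f. Together with g > 0 at 0 this yields as many sign changes as f has roots,
  and the sign of g at minus infinity yields one more if its degree is larger. These zeros exhaust
  the degree of g.\<close>

lemma neg_rooted_interlace:
  assumes f: "neg_rooted f xs"
    and W: "\<And>x. x < 0 \<Longrightarrow> poly f x = 0 \<Longrightarrow> wronskian f g x > 0"
    and g0: "poly g 0 > 0" and lc: "lead_coeff g > 0"
    and deg: "degree g = degree f \<or> degree g = Suc (degree f)"
  obtains ys where "neg_rooted g ys"
    "length ys = length xs \<longrightarrow> sorted_wrt (<) (splice xs ys)"
    "length ys \<noteq> length xs \<longrightarrow> sorted_wrt (<) (splice ys xs)"
proof -
  define k where "k = length xs"
  have degf: "degree f = k" using neg_rooted_degree[OF f] k_def by simp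
  have srt: "sorted_wrt (<) xs" and neg: "\<forall>x\<in>set xs. x < 0"
    using f unfolding neg_rooted_def by auto
  define zs where "zs = xs @ [0]"
  have mono: "zs ! i < zs ! Suc i" if "i < k" for i
    using that srt neg unfolding zs_def k_def
    by (auto simp: nth_append sorted_wrt_iff_nth_less)
  have sgn: "(-1) ^ (k - i) * poly g (zs ! i) > 0" if "i \<le> k" for i
  proof (cases "i = k")
    case True
    then show ?thesis using g0 by (simp add: zs_def k_def nth_append)
  next
    case False
    then have i: "i < k" using that by simp
    have z: "zs ! i = xs ! i" using i by (simp add: zs_def k_def nth_append)
    have "poly f (xs ! i) = 0" "xs ! i < 0" using neg_rooted_root_iff[OF f] i neg k_def by auto
    from W[OF this(2,1)] this have lt: "poly (pderiv f) (xs ! i) * poly g (xs ! i) < 0"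
      by (simp add: wronskian_def)
    have d: "(-1) ^ (k - Suc i) * poly (pderiv f) (xs ! i) > 0"
      using neg_rooted_pderiv_sign[OF f] i k_def by simp
    have e: "k - i = Suc (k - Suc i)" using i by simp
    consider "even (k - Suc i)" | "odd (k - Suc i)" by blast
    then show ?thesis using lt d unfolding e z by cases (auto simp: mult_less_0_iff zero_less_mult_iff)
  qed
  have "\<exists>y. zs ! i < y \<and> y < zs ! Suc i \<and> poly g y = 0" if i: "i < k" for i
  proof -
    have "(-1) ^ (k - i) * poly g (zs ! i) > 0" "(-1) ^ (k - Suc i) * poly g (zs ! Suc i) > 0"
      using sgn i by auto
    moreover have "k - i = Suc (k - Suc i)" using i by simp
    ultimately have "poly g (zs ! i) * poly g (zs ! Suc i) < 0"
      by (cases "even (k - Suc i)") (auto simp: mult_less_0_iff zero_less_mult_iff)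
    then show ?thesis using poly_IVT[OF mono[OF i]] by blast
  qed
  then obtain y where y: "\<And>i. i < k \<Longrightarrow> zs ! i < y i \<and> y i < zs ! Suc i \<and> poly g (y i) = 0"
    by metis
  define ys where "ys = map y [0..<k]"
  have len: "length ys = length xs" by (simp add: ys_def k_def)
  have ys_nth: "ys ! i = y i" if "i < k" for i using that by (simp add: ys_def)
  have s1: "sorted_wrt (<) (splice xs ys)"
  proof (rule sorted_wrt_splice)
    show "\<forall>i<length xs. xs ! i < ys ! i"
      using y by (auto simp: ys_nth zs_def nth_append k_def)
    show "\<forall>i. Suc i < length xs \<longrightarrow> ys ! i < xs ! Suc i"
    proof (intro allI impI)
      fix i assume i: "Suc i < length xs"
      then have "y i < zs ! Suc i" using y[of i] k_def by simp
      then show "ys ! i < xs ! Suc i" using i ys_nth[of i] k_def by (simp add: zs_def nth_append)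
    qed
  qed (simp add: len)
  have ysub: "\<forall>t\<in>set ys. zs ! 0 < t \<and> t < 0 \<and> poly g t = 0"
  proof
    fix t assume "t \<in> set ys"
    then obtain i where i: "i < k" "t = y i" by (auto simp: ys_def)
    have "zs ! 0 \<le> zs ! i'" if "i' \<le> k" for i'
      using that
    proof (induction i')
      case (Suc i')
      then show ?case using mono[of i'] by simp
    qed simp
    from this[of i] have "zs ! 0 \<le> zs ! i" using i by simp
    moreover have "zs ! Suc i \<le> 0" using i neg by (cases "Suc i = k") (auto simp: zs_def nth_append k_def less_imp_le)
    ultimately show "zs ! 0 < t \<and> t < 0 \<and> poly g t = 0" using y[OF i(1)] i by force
  qed
  have sys: "sorted_wrt (<) ys"
  proof (subst sorted_wrt_iff_nth_less, intro allI impI)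
    fix i j assume ij: "i < j" "j < length ys"
    have lj: "zs ! Suc i \<le> zs ! j" using ij(2,1)
    proof (induction j)
      case (Suc j)
      show ?case
      proof (cases "i = j")
        case False
        then have "zs ! Suc i \<le> zs ! j" using Suc by simp
        also have "\<dots> < zs ! Suc j" by (rule mono) (use Suc.prems len k_def in simp)
        finally show ?thesis by simp
      qed simp
    qed simp
    have "ys ! i = y i" "ys ! j = y j" "i < k" "j < k" using ij len k_def ys_nth by auto
    then show "ys ! i < ys ! j" using y[of i] y[of j] lj by simp
  qed
  show ?thesis
  proof (cases "degree g = degree f")
    case True
    have "neg_rooted g ys"
      unfolding neg_rooted_def
      using poly_eq_smult_prod_linear[of ys g] sys ysub True degf len k_def lc
      by (auto simp: strict_sorted_iff)
    then show ?thesis using that s1 len by blast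
  next
    case False
    then have dg: "degree g = Suc k" using deg degf by simp
    obtain x0 where x0: "x0 < zs ! 0" "(-1) ^ Suc k * poly g x0 > 0"
      using poly_sign_at_minus_infinity[OF lc, of "zs ! 0"] dg by auto
    have "(-1) ^ k * poly g (zs ! 0) > 0" using sgn[of 0] by simp
    with x0(2) have "poly g x0 * poly g (zs ! 0) < 0"
      by (cases "even k") (auto simp: mult_less_0_iff zero_less_mult_iff)
    then obtain w where w: "w < zs ! 0" "poly g w = 0" using poly_IVT[OF x0(1)] by blast
    have z0: "zs ! 0 \<le> 0" using neg by (cases xs) (auto simp: zs_def)
    have sw: "sorted_wrt (<) (w # ys)" using sys ysub w by auto
    have "neg_rooted g (w # ys)"
      unfolding neg_rooted_def
      using poly_eq_smult_prod_linear[of "w # ys" g] sw ysub w z0 dg len k_def lc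
      by (auto simp: strict_sorted_iff simp del: sorted_wrt.simps)
    moreover have "sorted_wrt (<) (splice (w # ys) xs)"
    proof -
      have "w < t" if "t \<in> set xs" for t
      proof -
        have "\<forall>t\<in>set xs. zs ! 0 \<le> t" using srt by (cases xs) (auto simp: zs_def)
        then show ?thesis using that w by force
      qed
      then show ?thesis using s1 ysub w by (auto simp: set_splice len)
    qed
    ultimately show ?thesis using that[of "w # ys"] len by simp
  qed
qed

lemma root_list_neg_rooted:
  assumes "neg_rooted f xs" shows "root_list f = xs"
proof -
  obtain c where c: "c > 0" "f = smult c (\<Prod>x\<leftarrow>xs. [:- x, 1:])" and s: "sorted_wrt (<) xs"
    using assms unfolding neg_rooted_def by blast
  have "proots (\<Prod>x\<leftarrow>ys. [:- x, 1::real:]) = mset ys" for ys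
  proof (induction ys)
    case (Cons a ys)
    have "proots ([:- a, 1:] * (\<Prod>x\<leftarrow>ys. [:- x, 1:])) = mset (a # ys)"
      using Cons prod_linear_nonzero[of ys] by (subst proots_mult) auto
    then show ?case by simp
  qed simp
  then have "proots f = mset xs" using c by simp
  then show ?thesis unfolding root_list_def
    using s by (simp add: sorted_list_of_multiset_mset sorted_sort_id strict_sorted_imp_sorted)
qed

lemma real_rooted_neg_rooted:
  assumes "neg_rooted f xs" shows "real_rooted f"
proof -
  obtain c where c: "c > 0" "f = smult c (\<Prod>x\<leftarrow>xs. [:- x, 1:])"
    using assms unfolding neg_rooted_def by blast
  have lin: "map_poly of_real ([:- x, 1:] * q) = [:- of_real x, 1 :: complex:] * map_poly of_real q"
    for x and q :: "real poly"
    by (rule poly_eqI) (simp add: coeff_map_poly coeff_pCons split: nat.splits)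
  have m: "poly (map_poly of_real (\<Prod>x\<leftarrow>ys. [:- x, 1::real:])) z = (\<Prod>x\<leftarrow>ys. z - of_real x)"
    for ys and z :: complex
  proof (induction ys)
    case (Cons a ys)
    have "poly (map_poly of_real (\<Prod>x\<leftarrow>a # ys. [:- x, 1::real:])) z =
        poly (map_poly of_real ([:- a, 1:] * (\<Prod>x\<leftarrow>ys. [:- x, 1::real:]))) z" by simp
    also have "\<dots> = (z - of_real a) * (\<Prod>x\<leftarrow>ys. z - of_real x)"
      unfolding lin poly_mult Cons.IH by simp
    finally show ?case by simp
  qed simp
  have sm: "map_poly of_real (smult c q) = smult (of_real c) (map_poly of_real q :: complex poly)" for q
    by (rule poly_eqI) (simp add: coeff_map_poly)
  show ?thesis unfolding real_rooted_def
  proof (intro conjI allI impI)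
    show "f \<noteq> 0" using c prod_linear_nonzero[of xs] by simp
    fix z :: complex assume "poly (map_poly of_real f) z = 0"
    then have "(\<Prod>x\<leftarrow>xs. z - of_real x) = 0" using c by (simp add: sm m)
    then show "z \<in> \<real>" by (auto simp: prod_list_zero_iff)
  qed
qed

theorem strictly_interlaces_if_wronskian_pos:
  assumes f: "neg_rooted f xs"
    and W: "\<And>x. x < 0 \<Longrightarrow> wronskian f g x > 0"
    and g0: "poly g 0 > 0" and lc: "lead_coeff g > 0"
    and deg: "degree g = degree f \<or> degree g = Suc (degree f)"
  shows "strictly_interlaces f g"
proof -
  obtain ys where g: "neg_rooted g ys"
    and s: "length ys = length xs \<longrightarrow> sorted_wrt (<) (splice xs ys)"
      "length ys \<noteq> length xs \<longrightarrow> sorted_wrt (<) (splice ys xs)"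
    using neg_rooted_interlace[OF f W g0 lc deg] by blast
  have chain: "sorted_wrt (<) (root_chain f g)"
    unfolding root_chain_def root_list_neg_rooted[OF f] root_list_neg_rooted[OF g]
      neg_rooted_degree[OF f] neg_rooted_degree[OF g]
    using s by simp
  have "\<not> (\<exists>x. poly f x = 0 \<and> poly g x = 0)"
  proof
    assume "\<exists>x. poly f x = 0 \<and> poly g x = 0"
    then obtain x where x: "poly f x = 0" "poly g x = 0" by blast
    then have "x < 0" using neg_rooted_pos[OF f, of x] by force
    then show False using W[of x] x by (simp add: wronskian_def)
  qed
  then show ?thesis
    unfolding strictly_interlaces_def interlaces_def
    using chain real_rooted_neg_rooted f g neg_rooted_lead_coeff deg
    by (auto simp: strict_sorted_imp_sorted sorted_wrt_mono_rel[of _ "(<)"])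
qed

lemma wronskian_simps:
  "wronskian (f + g) h x = wronskian f h x + wronskian g h x"
  "wronskian h (f + g) x = wronskian h f x + wronskian h g x"
  "wronskian (smult c f) h x = c * wronskian f h x"
  "wronskian h (smult c f) x = c * wronskian h f x"
  "wronskian f f x = 0"
  by (simp_all add: wronskian_def pderiv_add pderiv_smult algebra_simps)

lemma wronskian_swap: "wronskian g f x = - wronskian f g x"
  by (simp add: wronskian_def algebra_simps)

lemma wronskian_0 [simp]: "wronskian 0 f x = 0" "wronskian f 0 x = 0"
  by (simp_all add: wronskian_def)

lemma wronskian_sum:
  "wronskian (\<Sum>i\<in>A. f i) h x = (\<Sum>i\<in>A. wronskian (f i) h x)"
  "wronskian h (\<Sum>i\<in>A. f i) x = (\<Sum>i\<in>A. wronskian h (f i) x)"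
  by (induction A rule: infinite_finite_induct) (auto simp: wronskian_simps)

section \<open>The operator theta and the Wronskian of f and theta f\<close>

definition euler_op :: "real poly \<Rightarrow> real poly" where
  "euler_op f = pCons 0 (pderiv f)"

lemma poly_euler_op: "poly (euler_op f) x = x * poly (pderiv f) x"
  by (simp add: euler_op_def)

lemma coeff_euler_op: "coeff (euler_op f) n = real n * coeff f n"
  by (auto simp: euler_op_def coeff_pCons coeff_pderiv split: nat.splits)

text \<open>Since W(f, h) = f^2 (h / f)', this is the additivity of theta f / f over products,
  multiplied out so that it also holds at the roots.\<close>

lemma wronskian_euler_op_mult:
  "wronskian (f * g) (euler_op (f * g)) x =
     (poly g x)\<^sup>2 * wronskian f (euler_op f) x + (poly f x)\<^sup>2 * wronskian g (euler_op g) x"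
  by (simp add: wronskian_def euler_op_def pderiv_mult pderiv_pCons pderiv_add algebra_simps power2_eq_square)

lemma wronskian_euler_op_pos:
  assumes f: "neg_rooted f xs" and ne: "degree f > 0" and x: "x < 0"
  shows "wronskian f (euler_op f) x > 0"
proof -
  obtain c where c: "c > 0" "f = smult c (\<Prod>x\<leftarrow>xs. [:- x, 1:])"
    and s: "sorted_wrt (<) xs" "\<forall>x\<in>set xs. x < 0"
    using f unfolding neg_rooted_def by blast
  have "0 \<le> wronskian p (euler_op p) x \<and> (ys \<noteq> [] \<longrightarrow> 0 < wronskian p (euler_op p) x)"
    if "distinct ys" "\<forall>y\<in>set ys. y < 0" "p = (\<Prod>x\<leftarrow>ys. [:- x, 1:])" for ys p
    using that
  proof (induction ys arbitrary: p)
    case Nil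
    then show ?case by (simp add: wronskian_def euler_op_def)
  next
    case (Cons a ys)
    let ?h = "\<Prod>x\<leftarrow>ys. [:- x, 1:]"
    have p: "p = [:- a, 1:] * ?h" using Cons.prems by simp
    have "wronskian [:- a, 1:] (euler_op [:- a, 1:]) x = - a"
      by (simp add: wronskian_def euler_op_def pderiv_pCons)
    then have W: "wronskian p (euler_op p) x =
        (poly ?h x)\<^sup>2 * (- a) + (x - a)\<^sup>2 * wronskian ?h (euler_op ?h) x"
      unfolding p wronskian_euler_op_mult by (simp add: algebra_simps)
    have a: "a < 0" and IH: "0 \<le> wronskian ?h (euler_op ?h) x"
      "ys \<noteq> [] \<Longrightarrow> 0 < wronskian ?h (euler_op ?h) x"
      using Cons.IH[of ?h] Cons.prems by auto
    have "0 < wronskian p (euler_op p) x"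
    \<comment> \<open>At a root of the remaining factors only the second summand is left; there x
      differs from a because the roots are distinct.\<close>
    proof (cases "poly ?h x = 0")
      case True
      then have "x \<in> set ys" by (auto simp: poly_prod_linear prod_list_zero_iff)
      then have "ys \<noteq> []" "x \<noteq> a" using Cons.prems by auto
      then show ?thesis unfolding W using True IH(2) by simp
    next
      case False
      then have "(poly ?h x)\<^sup>2 * (- a) > 0" using a by (simp add: mult_pos_neg)
      then show ?thesis unfolding W using IH(1) by (simp add: add_pos_nonneg del: mult_minus_right)
    qed
    then show ?case by simp
  qed
  from this[of xs "\<Prod>x\<leftarrow>xs. [:- x, 1:]"] have
    "0 < wronskian (\<Prod>x\<leftarrow>xs. [:- x, 1:]) (euler_op (\<Prod>x\<leftarrow>xs. [:- x, 1:])) x"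
    using s ne neg_rooted_degree[OF f] by (auto simp: strict_sorted_iff)
  moreover have "euler_op (smult c p) = smult c (euler_op p)" for p
    by (simp add: euler_op_def pderiv_smult)
  ultimately show ?thesis unfolding c(2) using c(1) by (simp add: wronskian_simps)
qed

lemma neg_rooted_pderiv_nonzero:
  assumes "neg_rooted f xs" "poly f x = 0"
  shows "poly (pderiv f) x \<noteq> 0"
proof -
  have "x \<in> set xs" using neg_rooted_root_iff assms by simp
  then obtain i where "i < length xs" "x = xs ! i" by (metis in_set_conv_nth)
  then show ?thesis using neg_rooted_pderiv_sign[OF assms(1), of i] by force
qed

text \<open>At a root of f the Wronskian with theta f + c f is - x f'^2, positive for x < 0. With c
  > 0 the value at 0 is positive as well, whereas theta f alone has the root 0 and is not
  \<open>neg_rooted\<close>.\<close>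

lemma neg_rooted_euler_op:
  assumes f: "neg_rooted f xs" and c: "c > 0"
  obtains ys where "neg_rooted (euler_op f + smult c f) ys"
proof -
  let ?g = "euler_op f + smult c f"
  have cf: "coeff ?g n = (real n + c) * coeff f n" for n
    by (simp add: coeff_euler_op algebra_simps)
  have lf: "lead_coeff f > 0" using neg_rooted_lead_coeff f .
  have "degree ?g \<le> degree f" by (rule degree_le) (simp only: cf, simp add: coeff_eq_0)
  moreover have "coeff ?g (degree f) > 0" unfolding cf using lf c by simp
  ultimately have dg: "degree ?g = degree f" using le_degree[of ?g "degree f"] by simp
  have "\<exists>ys. neg_rooted ?g ys"
  proof (rule neg_rooted_interlace[OF f, of ?g])
    show "wronskian f ?g x > 0" if "x < 0" "poly f x = 0" for x
    proof -
      have "wronskian f ?g x = - x * (poly (pderiv f) x)\<^sup>2"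
        using that by (simp add: wronskian_def poly_euler_op power2_eq_square)
      then show ?thesis using neg_rooted_pderiv_nonzero[OF f that(2)] that(1)
        by (simp add: mult_neg_pos)
    qed
    show "poly ?g 0 > 0" using neg_rooted_pos[OF f, of 0] c by (simp add: poly_euler_op)
    show "lead_coeff ?g > 0" unfolding dg cf using lf c by simp
  qed (use dg in auto)
  then show ?thesis using that by blast
qed

section \<open>Weighted trinomial coefficients and Gegenbauer polynomials\<close>

definition trinom_poly :: "nat \<Rightarrow> (nat \<Rightarrow> real) \<Rightarrow> real poly" where
  "trinom_poly D \<phi> = (\<Sum>j\<le>D div 2. monom (\<phi> j / (fact (D - 2 * j) * fact j * fact j)) j)"

lemma coeff_trinom_poly:
  "coeff (trinom_poly D \<phi>) j = (if 2 * j \<le> D then \<phi> j / (fact (D - 2 * j) * fact j * fact j) else 0)"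
proof -
  have "coeff (trinom_poly D \<phi>) j =
      (\<Sum>i\<le>D div 2. if i = j then \<phi> i / (fact (D - 2 * i) * fact i * fact i) else 0)"
    by (simp add: trinom_poly_def coeff_sum if_distrib cong: if_cong)
  also have "\<dots> = (if 2 * j \<le> D then \<phi> j / (fact (D - 2 * j) * fact j * fact j) else 0)"
    by (auto simp: sum.delta)
  finally show ?thesis .
qed

text \<open>Multiplying the weight by j + c applies theta + c. Identities between polynomials can
  therefore be proved as pointwise identities between weights, with
  \<open>trinom_poly_cong\<close>.\<close>

lemma trinom_poly_simps:
  "trinom_poly D (\<lambda>j. \<phi> j + \<psi> j) = trinom_poly D \<phi> + trinom_poly D \<psi>"
  "trinom_poly D (\<lambda>j. c * \<phi> j) = smult c (trinom_poly D \<phi>)"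
  "trinom_poly D (\<lambda>j. real j * \<phi> j) = euler_op (trinom_poly D \<phi>)"
  by (rule poly_eqI; simp add: coeff_trinom_poly coeff_euler_op add_divide_distrib)+

lemma trinom_poly_sum:
  "trinom_poly D (\<lambda>j. \<Sum>n\<in>A. \<phi> n j) = (\<Sum>n\<in>A. trinom_poly D (\<phi> n))"
  by (rule poly_eqI) (simp add: coeff_trinom_poly coeff_sum sum_divide_distrib)

lemma trinom_poly_cong:
  "(\<And>j. 2 * j \<le> D \<Longrightarrow> \<phi> j = \<psi> j) \<Longrightarrow> trinom_poly D \<phi> = trinom_poly D \<psi>"
  by (rule poly_eqI) (simp add: coeff_trinom_poly)

text \<open>This makes gamma-polynomials of neighbouring rank comparable. The factor D + 1 - 2j
  cancels against (D + 1 - 2j)! and is 0 at the additional index 2j = D + 1.\<close>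

lemma trinom_poly_Suc:
  "trinom_poly (Suc D) (\<lambda>j. (real D + 1 - 2 * real j) * \<phi> j) = trinom_poly D \<phi>"
proof (rule poly_eqI)
  fix j
  have 1: "real D + 1 - 2 * real j = 0" if "2 * j \<le> Suc D" "\<not> 2 * j \<le> D"
    using that by linarith
  have 2: "(real D + 1 - 2 * real j) / fact (Suc D - 2 * j) = 1 / (fact (D - 2 * j) :: real)" if "2 * j \<le> D"
  proof -
    have "real D + 1 - 2 * real j = real (Suc (D - 2 * j))" using that by (simp add: of_nat_diff)
    then show ?thesis using that by (simp add: Suc_diff_le del: of_nat_Suc)
  qed
  have "(real D + 1 - 2 * real j) * \<phi> j / (fact (Suc D - 2 * j) * fact j * fact j) =
      (real D + 1 - 2 * real j) / fact (Suc D - 2 * j) * (\<phi> j / (fact j * fact j))" by simp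
  moreover have "\<phi> j / (fact (D - 2 * j) * fact j * fact j) =
      1 / fact (D - 2 * j) * (\<phi> j / (fact j * fact j))" by simp
  ultimately show "coeff (trinom_poly (Suc D) (\<lambda>j. (real D + 1 - 2 * real j) * \<phi> j)) j = coeff (trinom_poly D \<phi>) j"
    using 1 2 by (cases "2 * j \<le> D") (simp_all only: coeff_trinom_poly, auto)
qed

lemma poly_0_trinom_poly: "poly (trinom_poly D \<phi>) 0 = \<phi> 0 / fact D"
  by (simp add: poly_0_coeff_0 coeff_trinom_poly)

lemma trinom_poly_degree:
  assumes "\<phi> (D div 2) > 0"
  shows "degree (trinom_poly D \<phi>) = D div 2" "lead_coeff (trinom_poly D \<phi>) > 0"
proof -
  have "degree (trinom_poly D \<phi>) \<le> D div 2" by (rule degree_le) (auto simp: coeff_trinom_poly)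
  moreover have pos: "coeff (trinom_poly D \<phi>) (D div 2) > 0" using assms by (simp add: coeff_trinom_poly)
  ultimately show *: "degree (trinom_poly D \<phi>) = D div 2"
    using le_degree[of "trinom_poly D \<phi>" "D div 2"] by simp
  show "lead_coeff (trinom_poly D \<phi>) > 0" using pos * by simp
qed

text \<open>The coefficients are \<open>1 / ((D - 2j)! j! (j + \<mu>)!)\<close>, so these are reversed Gegenbauer
  polynomials; the step uses their raising operator.\<close>

lemma neg_rooted_gegenbauer: "\<exists>xs. neg_rooted (trinom_poly D (\<lambda>j. fact j / fact (j + \<mu>))) xs"
proof (induction D arbitrary: \<mu>)
  case 0
  have "trinom_poly 0 (\<lambda>j. fact j / fact (j + \<mu>)) = smult (1 / fact \<mu>) 1"
    by (simp add: trinom_poly_def monom_0 flip: one_pCons)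
  then have "neg_rooted (trinom_poly 0 (\<lambda>j. fact j / fact (j + \<mu>))) []"
    unfolding neg_rooted_def by (auto intro!: exI[of _ "1 / fact \<mu>"])
  then show ?case by blast
next
  case (Suc D)
  define f where "f = trinom_poly D (\<lambda>j. fact j / fact (j + Suc \<mu>))"
  define g where "g = trinom_poly (Suc D) (\<lambda>j. fact j / fact (j + \<mu>))"
  obtain xs where f: "neg_rooted f xs" using Suc f_def by blast
  have cf: "coeff f n = (if 2 * n \<le> D then 1 / (fact (D - 2 * n) * fact n * fact (n + Suc \<mu>)) else 0)" for n
    by (simp add: f_def coeff_trinom_poly)
  have cg: "coeff g n = (if 2 * n \<le> Suc D then 1 / (fact (Suc D - 2 * n) * fact n * fact (n + \<mu>)) else 0)" for n
    by (simp add: g_def coeff_trinom_poly)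
  \<comment> \<open>The raising operator, (D + 1) g = x (1 - 4x) f' + (\<mu> + 1 + 2 D x) f, which
    raises D and lowers \<mu>. At a root of f only the first term survives, and x (1 - 4x) < 0 for x
    < 0.\<close>
  have rel: "smult (real D + 1) g =
      euler_op f + smult (real \<mu> + 1) f + pCons 0 (smult 2 (smult (real D) f - smult 2 (euler_op f)))"
  proof (rule poly_eqI)
    fix n
    show "coeff (smult (real D + 1) g) n = coeff (euler_op f + smult (real \<mu> + 1) f +
        pCons 0 (smult 2 (smult (real D) f - smult 2 (euler_op f)))) n"
    proof (cases n)
      case 0
      then show ?thesis by (simp add: cf cg coeff_euler_op divide_simps del: of_nat_Suc) (simp add: algebra_simps)
    next
      case (Suc j)
      \<comment> \<open>The coefficients of f and of g end at different indices, depending on the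
        parity of D, so the top indices are treated separately.\<close>
      have "2 * Suc j \<le> D \<or> 2 * Suc j = Suc D \<or> 2 * j = D \<or> 2 * j > D" by arith
      then consider "2 * Suc j \<le> D" | "2 * Suc j = Suc D" | "2 * j = D" | "2 * j > D" by blast
      then show ?thesis
      proof cases
        case 1
        then obtain e where e: "D = 2 * Suc j + e" using le_Suc_ex by blast
        have "Suc D - 2 * Suc j = Suc e" "D - 2 * Suc j = e" "D - 2 * j = Suc (Suc e)" using e by auto
        then show ?thesis using Suc 1
          by (simp add: cf cg coeff_euler_op e divide_simps del: of_nat_Suc) (simp add: algebra_simps)
      next
        case 2
        then have D: "D = 2 * j + 1" by simp
        show ?thesis using Suc
          by (simp add: cf cg coeff_euler_op D divide_simps)
      next
        case 3
        then show ?thesis using Suc by (auto simp: cf cg coeff_euler_op)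
      next
        case 4
        then show ?thesis using Suc by (auto simp: cf cg coeff_euler_op)
      qed
    qed
  qed
  have df: "degree f = D div 2" unfolding f_def by (rule trinom_poly_degree) simp
  have dg: "degree g = Suc D div 2" and lg: "lead_coeff g > 0"
    unfolding g_def by (rule trinom_poly_degree, simp)+
  have "\<exists>ys. neg_rooted g ys"
  proof (rule neg_rooted_interlace[OF f, of g])
    show "wronskian f g x > 0" if "x < 0" "poly f x = 0" for x
    proof -
      have "poly (smult (real D + 1) g) x = x * (1 - 4 * x) * poly (pderiv f) x"
        unfolding rel using that by (simp add: poly_euler_op algebra_simps)
      then have eq: "(real D + 1) * poly g x = x * (1 - 4 * x) * poly (pderiv f) x" by simp
      have "(real D + 1) * wronskian f g x = - poly (pderiv f) x * ((real D + 1) * poly g x)"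
        using that by (simp add: wronskian_def)
      also have "\<dots> = - x * (1 - 4 * x) * (poly (pderiv f) x)\<^sup>2"
        unfolding eq by (simp add: power2_eq_square)
      also have "\<dots> > 0"
        using neg_rooted_pderiv_nonzero[OF f that(2)] that(1)
        by (intro mult_pos_pos) auto
      finally show ?thesis by (simp add: zero_less_mult_iff)
    qed
    show "poly g 0 > 0" by (simp add: g_def poly_0_trinom_poly)
    show "lead_coeff g > 0" using lg .
    show "degree g = degree f \<or> degree g = Suc (degree f)" using df dg by linarith
  qed blast
  then show ?case unfolding g_def by blast
qed

section \<open>Weights with linear denominators\<close>

definition inv_linear_prod :: "nat set \<Rightarrow> nat \<Rightarrow> real" where
  "inv_linear_prod S j = (\<Prod>l\<in>S. 1 / (real j + real l))"

text \<open>For S = {1..\<mu>} this is the Gegenbauer case. Removing l from the set multiplies the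
  weight by j + l, that is, applies theta + l with l > 0, which keeps the roots simple and negative.
  Any S is reached from an interval by such removals.\<close>

lemma neg_rooted_inv_linear_prod:
  assumes "finite S" "0 \<notin> S"
  obtains xs where "neg_rooted (trinom_poly D (inv_linear_prod S)) xs"
proof -
  obtain \<mu> where mu: "S \<subseteq> {1..\<mu>}"
    using finite_nat_iff_bounded_le[of S] assms by (metis Suc_le_eq atLeastAtMost_iff atMost_iff gr0I subset_eq One_nat_def)
  have base: "inv_linear_prod {1..\<mu>} j = fact j / fact (j + \<mu>)" for j
  proof (induction \<mu>)
    case (Suc \<mu>)
    have "{1..Suc \<mu>} = insert (Suc \<mu>) {1..\<mu>}" by auto
    then have "inv_linear_prod {1..Suc \<mu>} j = 1 / (real j + real (Suc \<mu>)) * inv_linear_prod {1..\<mu>} j"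
      unfolding inv_linear_prod_def by (simp only:) (subst prod.insert, auto)
    then show ?case unfolding Suc by (simp add: algebra_simps)
  qed (simp add: inv_linear_prod_def)
  have "\<exists>xs. neg_rooted (trinom_poly D (inv_linear_prod S)) xs"
    if "finite U" "finite S" "0 \<notin> U" "S \<inter> U = {}" "\<exists>xs. neg_rooted (trinom_poly D (inv_linear_prod (S \<union> U))) xs" for U S
    using that
  proof (induction U arbitrary: S rule: finite_induct)
    case (insert l U)
    have "\<exists>xs. neg_rooted (trinom_poly D (inv_linear_prod (insert l S))) xs"
      by (rule insert.IH) (use insert in auto)
    then obtain xs where xs: "neg_rooted (trinom_poly D (inv_linear_prod (insert l S))) xs" by blast
    have l: "l > 0" "l \<notin> S" using insert by auto
    have "inv_linear_prod S j = real j * inv_linear_prod (insert l S) j + real l * inv_linear_prod (insert l S) j" for j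
    proof -
      have "inv_linear_prod (insert l S) j = 1 / (real j + real l) * inv_linear_prod S j"
        using l insert by (simp add: inv_linear_prod_def)
      then show ?thesis using l by (simp add: divide_simps) (simp add: algebra_simps)
    qed
    then have "trinom_poly D (inv_linear_prod S) =
        euler_op (trinom_poly D (inv_linear_prod (insert l S))) + smult (real l) (trinom_poly D (inv_linear_prod (insert l S)))"
      by (simp flip: trinom_poly_simps cong: trinom_poly_cong)
    then show ?case using neg_rooted_euler_op[OF xs, of "real l"] l by auto
  qed auto
  moreover have "S \<union> ({1..\<mu>} - S) = {1..\<mu>}" using mu by blast
  moreover have "inv_linear_prod {1..\<mu>} = (\<lambda>j. fact j / fact (j + \<mu>))" using base by blast
  ultimately have "\<exists>xs. neg_rooted (trinom_poly D (inv_linear_prod S)) xs"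
    using neg_rooted_gegenbauer[of D \<mu>] assms
    by (metis Diff_disjoint Diff_iff atLeastAtMost_iff finite_Diff finite_atLeastAtMost not_one_le_zero)
  then show ?thesis using that by blast
qed

lemma neg_rooted_smult: "neg_rooted f xs \<Longrightarrow> c > 0 \<Longrightarrow> neg_rooted (smult c f) xs"
  unfolding neg_rooted_def by (metis mult_pos_pos smult_smult)

lemma euler_op_simps:
  "euler_op (f + g) = euler_op f + euler_op g" "euler_op (smult c f) = smult c (euler_op f)"
  by (simp_all add: euler_op_def pderiv_add pderiv_smult)

text \<open>The later sign computations write both arguments in the span of a suitable f and its
  theta f; the sign is then that of a determinant, given the one of W(f, theta f).\<close>

lemma wronskian_linear_comb:
  "wronskian (smult a f + smult b (euler_op f)) (smult c f + smult d (euler_op f)) x =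
     (a * d - b * c) * wronskian f (euler_op f) x"
  using wronskian_swap[of "euler_op f" f x] by (simp add: wronskian_simps algebra_simps)

lemma wronskian_euler_op_nonneg:
  assumes "neg_rooted f xs" "x < 0"
  shows "wronskian f (euler_op f) x \<ge> 0"
proof (cases "degree f > 0")
  case True
  then show ?thesis using wronskian_euler_op_pos assms less_imp_le by blast
next
  case False
  then have "euler_op f = 0" by (simp add: euler_op_def pderiv_eq_0_iff)
  then show ?thesis by simp
qed

text \<open>The limit \<open>c \<rightarrow> 0\<close> of the inequality for \<open>euler_op f + c f\<close>.\<close>

lemma wronskian_euler_op_euler_op_nonneg:
  assumes f: "neg_rooted f xs" and x: "x < 0"
  shows "wronskian (euler_op f) (euler_op (euler_op f)) x \<ge> 0"
proof -
  define A where "A = wronskian (euler_op f) (euler_op (euler_op f)) x"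
  define B where "B = wronskian f (euler_op (euler_op f)) x"
  define E where "E = wronskian f (euler_op f) x"
  have ge: "A + c * B + c * c * E \<ge> 0" if c: "c > 0" for c
  proof -
    obtain ys where "neg_rooted (euler_op f + smult c f) ys" using neg_rooted_euler_op[OF f c] .
    from wronskian_euler_op_nonneg[OF this x] show ?thesis
      by (simp add: wronskian_simps euler_op_simps A_def B_def E_def algebra_simps)
  qed
  have "((\<lambda>c. A + c * B + c * c * E) \<longlongrightarrow> A + 0 * B + 0 * 0 * E) (at_right 0)"
    by (intro tendsto_intros)
  moreover have "eventually (\<lambda>c. A + c * B + c * c * E \<ge> 0) (at_right 0)"
    using ge by (auto simp: eventually_at_filter)
  ultimately show ?thesis
    using tendsto_lowerbound[of _ _ "at_right (0::real)" 0] A_def by fastforce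
qed

text \<open>\<open>shift_quot 0 0 = 1\<close>, although \<open>0 / 0 = 0\<close>.\<close>

definition shift_quot :: "nat \<Rightarrow> nat \<Rightarrow> real" where
  "shift_quot n j = (if n = 0 then 1 else real j / (real j + real n))"

lemma shift_quot_mult: "(real j + real n) * shift_quot n j = real j"
  by (simp add: shift_quot_def)

lemma shift_quot_nonneg: "shift_quot n j \<ge> 0"
  by (simp add: shift_quot_def)

text \<open>The building blocks of the gamma-polynomials. For n > 0 the numerator j of
  \<open>shift_quot n\<close> is an application of theta, so every block except n = 0 has constant
  term 0.\<close>

definition quot_poly :: "nat \<Rightarrow> nat set \<Rightarrow> nat \<Rightarrow> real poly" where
  "quot_poly D S n = trinom_poly D (\<lambda>j. shift_quot n j * inv_linear_prod S j)"

lemma inv_linear_prod_pos: "0 \<notin> S \<Longrightarrow> inv_linear_prod S j > 0"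
  by (auto simp: inv_linear_prod_def intro!: prod_pos) (metis add_nonneg_pos gr0I of_nat_0_le_iff of_nat_0_less_iff)

lemma quot_poly_0: "quot_poly D S 0 = trinom_poly D (inv_linear_prod S)"
  by (simp add: quot_poly_def shift_quot_def)

lemma quot_poly_pos:
  assumes "finite S" "n \<notin> S" "n > 0"
  shows "quot_poly D S n = euler_op (trinom_poly D (inv_linear_prod (insert n S)))"
  unfolding quot_poly_def using assms
  by (subst trinom_poly_simps(3)[symmetric])
    (auto simp: shift_quot_def inv_linear_prod_def intro!: trinom_poly_cong)

lemma wronskian_quot_poly_nonneg:
  assumes S: "finite S" "0 \<notin> S" "n \<notin> S" and x: "x < 0"
  shows "wronskian (quot_poly D S n) (euler_op (quot_poly D S n)) x \<ge> 0"
proof (cases "n = 0")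
  case True
  obtain xs where "neg_rooted (trinom_poly D (inv_linear_prod S)) xs"
    using neg_rooted_inv_linear_prod S by blast
  then show ?thesis using wronskian_euler_op_nonneg x True by (simp add: quot_poly_0)
next
  case False
  obtain xs where "neg_rooted (trinom_poly D (inv_linear_prod (insert n S))) xs"
    using neg_rooted_inv_linear_prod[of "insert n S" D] S False by auto
  then show ?thesis using wronskian_euler_op_euler_op_nonneg x False S by (simp add: quot_poly_pos)
qed

lemma wronskian_quot_poly_0_pos:
  assumes S: "finite S" "0 \<notin> S" and x: "x < 0" and D: "D \<ge> 2"
  shows "wronskian (quot_poly D S 0) (euler_op (quot_poly D S 0)) x > 0"
proof -
  obtain xs where xs: "neg_rooted (trinom_poly D (inv_linear_prod S)) xs"
    using neg_rooted_inv_linear_prod S by blast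
  have "degree (trinom_poly D (inv_linear_prod S)) > 0"
    using trinom_poly_degree(1)[of "inv_linear_prod S" D] inv_linear_prod_pos S D by simp
  from wronskian_euler_op_pos[OF xs this x] show ?thesis by (simp add: quot_poly_0)
qed

text \<open>Applying theta + n cancels the denominator of \<open>shift_quot n\<close>, so the right
  side is the same for all n. A sum of blocks can thus be tested termwise against this one
  polynomial.\<close>

lemma quot_poly_shift:
  "euler_op (quot_poly D S n) + smult (real n) (quot_poly D S n) =
     trinom_poly D (\<lambda>j. real j * inv_linear_prod S j)"
proof -
  have "real j * (shift_quot n j * inv_linear_prod S j) + real n * (shift_quot n j * inv_linear_prod S j)
      = real j * inv_linear_prod S j" for j
    using shift_quot_mult[of j n] by (metis distrib_right mult.assoc)
  then show ?thesis unfolding quot_poly_def by (simp flip: trinom_poly_simps)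
qed

text \<open>Each block is compared with block 0. For n > 0 let u have the denominators j + m and j +
  n; then block 0 is (theta + n) u and block n is theta u, with Wronskian n W(u, theta u) > 0. Hence
  the sum of blocks alternates in sign along the roots of block 0.\<close>

lemma neg_rooted_sum_quot_poly:
  fixes w :: "nat \<Rightarrow> real"
  assumes w: "\<And>n. n < m \<Longrightarrow> w n > 0" and m: "m > 0"
  obtains xs where "neg_rooted (\<Sum>n<m. smult (w n) (quot_poly D {m} n)) xs"
proof -
  let ?p = "quot_poly D {m}" and ?f = "\<Sum>n<m. smult (w n) (quot_poly D {m} n)"
  obtain xs where p0: "neg_rooted (?p 0) xs"
    using neg_rooted_inv_linear_prod[of "{m}"] m quot_poly_0 by auto
  have f: "?f = trinom_poly D (\<lambda>j. \<Sum>n<m. w n * (shift_quot n j * inv_linear_prod {m} j))"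
    by (simp add: trinom_poly_sum trinom_poly_simps quot_poly_def)
  have pos: "(\<Sum>n<m. w n * (shift_quot n j * inv_linear_prod {m} j)) > 0" for j
  proof (rule sum_pos2[of _ 0])
    show "0 < w 0 * (shift_quot 0 j * inv_linear_prod {m} j)"
      using w[of 0] m inv_linear_prod_pos[of "{m}" j] by (simp add: shift_quot_def)
    show "0 \<le> w n * (shift_quot n j * inv_linear_prod {m} j)" if "n \<in> {..<m}" for n
      using w[of n] that shift_quot_nonneg[of n j] inv_linear_prod_pos[of "{m}" j] m
      by (simp add: less_imp_le)
  qed (use m in auto)
  have deg: "degree ?f = D div 2" and lc: "lead_coeff ?f > 0"
    unfolding f by (rule trinom_poly_degree, rule pos)+
  have dp: "degree (?p 0) = D div 2"
    unfolding quot_poly_0 by (rule trinom_poly_degree) (use inv_linear_prod_pos m in auto)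
  have "\<exists>xs. neg_rooted ?f xs"
  proof (cases "m = 1")
    case True
    then show ?thesis using neg_rooted_smult[OF p0 w[of 0]] by auto
  next
    case False
    show ?thesis
    proof (rule neg_rooted_interlace[OF p0, of ?f])
      fix x :: real assume x: "x < 0" "poly (?p 0) x = 0"
      then have "xs \<noteq> []" using neg_rooted_root_iff[OF p0] by auto
      then have D: "D \<ge> 2" using neg_rooted_degree[OF p0] dp
        by (metis One_nat_def div_greater_zero_iff length_greater_0_conv pos2)
      have W: "wronskian (?p 0) (?p n) x > 0" if n: "n < m" "n > 0" for n
      proof -
        let ?u = "quot_poly D {n, m} 0"
        have pn: "?p n = euler_op ?u"
          using n quot_poly_pos[of "{m}" n D] by (simp add: quot_poly_0)
        have "inv_linear_prod {m} j = (real j + real n) * inv_linear_prod {n, m} j" for j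
          using n by (simp add: inv_linear_prod_def)
        then have "?p 0 = smult (real n) ?u + smult 1 (euler_op ?u)"
          unfolding quot_poly_0 trinom_poly_simps(3)[symmetric] trinom_poly_simps(2)[symmetric]
            trinom_poly_simps(1)[symmetric]
          by (intro trinom_poly_cong) (simp add: algebra_simps)
        moreover have "?p n = smult 0 ?u + smult 1 (euler_op ?u)" using pn by simp
        ultimately have "wronskian (?p 0) (?p n) x = real n * wronskian ?u (euler_op ?u) x"
          by (simp only: wronskian_linear_comb) simp
        then show ?thesis using wronskian_quot_poly_0_pos[of "{n, m}" x D] x D n by simp
      qed
      have "0 < (\<Sum>n<m. w n * wronskian (?p 0) (?p n) x)"
      \<comment> \<open>Index 1 supplies strictness, since n = 0 contributes the Wronskian of a
        polynomial with itself. For m = 1 there is no such index, hence the case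
        distinction.\<close>
      proof (rule sum_pos2[of _ 1])
        show "0 < w 1 * wronskian (?p 0) (?p 1) x" using w[of 1] W[of 1] m False by simp
        show "0 \<le> w n * wronskian (?p 0) (?p n) x" if "n \<in> {..<m}" for n
          using w[of n] W[of n] that by (cases "n = 0") (auto simp: wronskian_simps less_imp_le)
      qed (use m False in auto)
      then show "wronskian (?p 0) ?f x > 0" by (simp add: wronskian_sum wronskian_simps)
    next
      show "poly ?f 0 > 0" unfolding f poly_0_trinom_poly using pos[of 0] by simp
    qed (use lc deg dp in auto)
  qed
  then show ?thesis using that by blast
qed

section \<open>The gamma weights and their contiguity relations\<close>

definition gamma_weight :: "nat \<Rightarrow> nat \<Rightarrow> nat \<Rightarrow> real" where
  "gamma_weight m d j =
     (\<Sum>n<m. (real m - real n) * real (n + d - 1 choose n) * shift_quot n j) / (real j + real m)"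

text \<open>The definition exhibits positive coefficients of \<open>shift_quot n\<close>. Here m
  occurs only in the range of the sum and in one last term, so that changes of m and d can be
  followed. The proof multiplies by j + m, inducts on m, and uses that (j + m)
  \<open>shift_quot m j\<close> is j.\<close>

lemma gamma_weight_eq:
  assumes d: "d > 0"
  shows "gamma_weight m d j = (\<Sum>n<m. real (n + d - 1 choose n) * shift_quot n j)
           - real (m + d - 1 choose d) * (real j / (real j + real m))"
proof -
  define V where "V m = (\<Sum>n<m. real (n + d - 1 choose n) * shift_quot n j)" for m
  define U where "U m = (\<Sum>n<m. (real m - real n) * real (n + d - 1 choose n) * shift_quot n j)" for m
  have U: "U m = (real j + real m) * V m - real (m + d - 1 choose d) * real j"
  proof (induction m)
    case 0
    then show ?case using d by (simp add: U_def V_def)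
  next
    case (Suc m)
    have "U (Suc m) = U m + V (Suc m)"
      by (simp add: U_def V_def algebra_simps sum.distrib sum_subtractf)
    moreover have "V (Suc m) = V m + real (m + d - 1 choose m) * shift_quot m j"
      by (simp add: V_def)
    moreover have "(real j + real m) * (real (m + d - 1 choose m) * shift_quot m j) = real (m + d - 1 choose m) * real j"
      using shift_quot_mult[of j m] by (metis mult.left_commute)
    moreover have "Suc m + d - 1 choose d = (m + d - 1 choose m) + (m + d - 1 choose d)"
    proof -
      obtain e where e: "d = Suc e" using d gr0_conv_Suc by blast
      show ?thesis unfolding e using binomial_symmetric[of m "m + e"] by simp
    qed
    ultimately show ?case using Suc by (simp add: algebra_simps)
  qed
  show ?thesis
  proof (cases "j + m = 0")
    case True
    then show ?thesis using d by (simp add: gamma_weight_def)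
  next
    case False
    then have "real j + real m \<noteq> 0" by linarith
    moreover have "gamma_weight m d j = U m / (real j + real m)"
      by (simp add: gamma_weight_def U_def)
    ultimately show ?thesis unfolding V_def[symmetric] U by (simp add: field_simps)
  qed
qed

text \<open>By Pascal's rule the new summand and the old fraction add up to C(m + d, d) j / (j + m),
  and the new fraction leaves a difference of partial fractions. The case m = 0 < j starts the
  induction in \<open>gamma_coeff_eq\<close>; at m = j = 0 the left side is 1 and the right side
  0.\<close>

lemma gamma_weight_Suc_left:
  assumes d: "d > 0" and m: "m > 0 \<or> j > 0"
  shows "gamma_weight (Suc m) d j =
    gamma_weight m d j + real (m + d choose d) * (real j / ((real j + real m) * (real j + real (Suc m))))"
proof -
  obtain e where e: "d = Suc e" using d gr0_conv_Suc by blast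
  define q1 q2 q3 where "q1 = real j / (real j + real m)" and "q2 = real j / (real j + real (Suc m))"
    and "q3 = real j / ((real j + real m) * (real j + real (Suc m)))"
  define B where "B = real (m + d choose d)"
  have q: "q3 = q1 - q2" using m by (auto simp: q1_def q2_def q3_def divide_simps) (auto simp: algebra_simps)
  have sm: "shift_quot m j = q1" using m by (auto simp: shift_quot_def q1_def)
  have "m + d choose d = (m + d - 1 choose m) + (m + d - 1 choose d)"
    unfolding e using binomial_symmetric[of m "m + e"] by simp
  then have B: "real (m + d - 1 choose m) = B - real (m + d - 1 choose d)" by (simp add: B_def)
  have B': "real (Suc m + d - 1 choose d) = B" by (simp add: B_def)
  show ?thesis
    unfolding gamma_weight_eq[OF d] B' q1_def[symmetric] q2_def[symmetric] q3_def[symmetric] B_def[symmetric] q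
    by (simp only: sum.lessThan_Suc sm B) (simp add: algebra_simps)
qed

text \<open>The factor d - j arises termwise: d C(n + d, n) = (n + d) C(n + d - 1, n), and (n + d) q
  = (d - j) q + j for q = \<open>shift_quot n j\<close>. The leftover multiples of j are summed by
  the hockey-stick identity.\<close>

lemma gamma_weight_Suc_right:
  assumes d: "d > 0" and m: "m > 0"
  shows "real d * gamma_weight m (Suc d) j =
    (real d - real j) * gamma_weight m d j + real (m + d choose Suc d) * (real j / (real j + real m))"
proof -
  obtain e where e: "d = Suc e" using d gr0_conv_Suc by blast
  define C where "C = real (m + d - 1 choose d)"
  define r where "r = real j / (real j + real m)"
  have r: "r * (real j + real m) = real j" using m by (simp add: r_def)
  have summand: "real d * (real (n + Suc d - 1 choose n) * shift_quot n j) =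
      (real d - real j) * (real (n + d - 1 choose n) * shift_quot n j) + real j * real (n + d - 1 choose n)" for n
  proof -
    have "Suc e * (n + Suc e choose n) = (n + Suc e) * (n + e choose n)"
      using Suc_times_binomial[of e "n + e"] binomial_symmetric[of n "n + e"]
        binomial_symmetric[of n "n + Suc e"] by (simp del: binomial_Suc_Suc)
    then have b: "real d * real (n + d choose n) = (real n + real d) * real (n + d - 1 choose n)"
      unfolding e by (metis add_Suc_right diff_Suc_1 of_nat_add of_nat_mult)
    have "real n * shift_quot n j = real j - real j * shift_quot n j"
      using shift_quot_mult[of j n] by (simp add: algebra_simps)
    then have split: "(real n + real d) * c * shift_quot n j = (real d - real j) * (c * shift_quot n j) + real j * c" for c
      by algebra
    have "real d * (real (n + Suc d - 1 choose n) * shift_quot n j) = real d * real (n + d choose n) * shift_quot n j"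
      by simp
    then show ?thesis unfolding b split .
  qed
  have "(\<Sum>n<k. n + d - 1 choose n) = k + d - 1 choose d" for k
  proof (induction k)
    case (Suc k)
    then show ?case unfolding e using binomial_symmetric[of k "k + e"] by simp
  qed (use d in simp)
  from this[of m] have sum: "(\<Sum>n<m. real (n + d - 1 choose n)) = C"
    unfolding C_def by (metis of_nat_sum)
  have V: "real d * (\<Sum>n<m. real (n + Suc d - 1 choose n) * shift_quot n j) =
      (real d - real j) * (\<Sum>n<m. real (n + d - 1 choose n) * shift_quot n j) + real j * C"
    unfolding sum_distrib_left summand sum.distrib by (simp only: sum_distrib_left[symmetric] sum)
  have "Suc d * (m + d choose Suc d) = (m + d) * (m + d - 1 choose d)"
    using binomial_absorption[of d "m + d"] by simp
  then have abs: "(real d + 1) * real (m + d choose Suc d) = (real m + real d) * C"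
    unfolding C_def by (metis of_nat_Suc of_nat_add of_nat_mult add.commute)
  define K where "K = real (m + d choose Suc d)"
  have "real d * gamma_weight m (Suc d) j - (real d - real j) * gamma_weight m d j
      = real j * C + (real d - real j) * (C * r) - real d * K * r"
    unfolding gamma_weight_eq[OF d] gamma_weight_eq[OF zero_less_Suc]
    using V by (simp add: right_diff_distrib C_def r_def K_def mult.assoc)
  also have "\<dots> = r * ((real m + real d) * C - real d * K)"
  proof -
    have "real j * C + (real d - real j) * (C * r) - real d * K * r - r * ((real m + real d) * C - real d * K)
        = C * (real j - r * (real j + real m))" by (simp add: algebra_simps)
    then show ?thesis unfolding r by simp
  qed
  also have "\<dots> = K * r"
    unfolding abs[folded K_def, symmetric] by (simp add: algebra_simps)
  finally show ?thesis by (simp add: r_def K_def)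
qed

definition uniform_gamma :: "nat \<Rightarrow> nat \<Rightarrow> real poly" where
  "uniform_gamma m d = smult (fact d) (trinom_poly d (gamma_weight m d))"

lemma gamma_weight_sum:
  "gamma_weight m d = (\<lambda>j. \<Sum>n<m. ((real m - real n) * real (n + d - 1 choose n)) *
     (shift_quot n j * inv_linear_prod {m} j))"
  by (rule ext) (simp add: gamma_weight_def inv_linear_prod_def sum_divide_distrib mult.assoc)

lemma trinom_poly_gamma_weight:
  "trinom_poly D (gamma_weight m d) =
     (\<Sum>n<m. smult ((real m - real n) * real (n + d - 1 choose n)) (quot_poly D {m} n))"
  unfolding gamma_weight_sum by (simp add: trinom_poly_sum trinom_poly_simps quot_poly_def)

lemma gamma_weight_coeff_pos:
  "d > 0 \<Longrightarrow> n < m \<Longrightarrow> (real m - real n) * real (n + d - 1 choose n) > 0"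
  by (simp add: zero_less_binomial)

lemma gamma_weight_pos:
  assumes "d > 0" "m > 0"
  shows "gamma_weight m d j > 0"
  unfolding gamma_weight_sum
proof (rule sum_pos2[of _ 0])
  show "0 < (real m - real 0) * real (0 + d - 1 choose 0) * (shift_quot 0 j * inv_linear_prod {m} j)"
    using assms by (simp add: shift_quot_def inv_linear_prod_def)
  show "0 \<le> (real m - real n) * real (n + d - 1 choose n) * (shift_quot n j * inv_linear_prod {m} j)"
    if "n \<in> {..<m}" for n
    using that shift_quot_nonneg[of n j] by (simp add: inv_linear_prod_def)
qed (use assms in auto)

lemma neg_rooted_gamma_weight:
  assumes "d > 0" "m > 0"
  obtains xs where "neg_rooted (trinom_poly D (gamma_weight m d)) xs"
  unfolding trinom_poly_gamma_weight
  using neg_rooted_sum_quot_poly[of m "\<lambda>n. (real m - real n) * real (n + d - 1 choose n)" D]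
    gamma_weight_coeff_pos assms by blast

lemma uniform_gamma_properties:
  assumes "d > 0" "m > 0"
  shows "degree (uniform_gamma m d) = d div 2" "lead_coeff (uniform_gamma m d) > 0"
    "poly (uniform_gamma m d) 0 > 0" "\<exists>xs. neg_rooted (uniform_gamma m d) xs"
proof -
  note pos = gamma_weight_pos[OF assms]
  show "degree (uniform_gamma m d) = d div 2" "lead_coeff (uniform_gamma m d) > 0"
    unfolding uniform_gamma_def using trinom_poly_degree[of "gamma_weight m d" d] pos by simp_all
  show "poly (uniform_gamma m d) 0 > 0"
    unfolding uniform_gamma_def using pos by (simp add: poly_0_trinom_poly)
  show "\<exists>xs. neg_rooted (uniform_gamma m d) xs"
    unfolding uniform_gamma_def
    using neg_rooted_gamma_weight[OF assms, of d] neg_rooted_smult fact_gt_zero by metis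
qed

text \<open>The polynomial on the right, with the weight for d but the denominators for d + 1, is
  shared with \<open>uniform_gamma_Suc_Suc\<close>. Up to a correction both gamma-polynomials lie in
  the span of it and its image under theta.\<close>

lemma uniform_gamma_Suc:
  "uniform_gamma m d = smult (fact d)
     (smult (real d + 1) (trinom_poly (Suc d) (gamma_weight m d)) +
      smult (- 2) (euler_op (trinom_poly (Suc d) (gamma_weight m d))))"
  unfolding uniform_gamma_def trinom_poly_Suc[of d, symmetric]
    trinom_poly_simps(3)[symmetric] trinom_poly_simps(2)[symmetric] trinom_poly_simps(1)[symmetric]
  by (intro trinom_poly_cong) (simp add: algebra_simps)

lemma uniform_gamma_Suc_Suc:
  assumes "d > 0" "m > 0"
  shows "smult (real d) (uniform_gamma m (Suc d)) = smult (fact (Suc d))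
     (smult (real d) (trinom_poly (Suc d) (gamma_weight m d)) +
      smult (- 1) (euler_op (trinom_poly (Suc d) (gamma_weight m d))) +
      smult (real (m + d choose Suc d)) (trinom_poly (Suc d) (\<lambda>j. real j * inv_linear_prod {m} j)))"
  unfolding uniform_gamma_def smult_smult mult.commute[of "real d"]
  unfolding smult_smult[symmetric]
    trinom_poly_simps(3)[symmetric] trinom_poly_simps(2)[symmetric] trinom_poly_simps(1)[symmetric]
  by (intro trinom_poly_cong arg_cong[of _ _ "smult _"])
    (simp add: gamma_weight_Suc_right[OF assms] inv_linear_prod_def algebra_simps add_divide_distrib)

lemma uniform_gamma_Suc_left:
  assumes "d > 0" "m > 0"
  shows "uniform_gamma (Suc m) d = uniform_gamma m d +
    smult (fact d * real (m + d choose d)) (trinom_poly d (\<lambda>j. real j * inv_linear_prod {m, Suc m} j))"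
  unfolding uniform_gamma_def smult_smult[symmetric] smult_add_right[symmetric]
    trinom_poly_simps(2)[symmetric] trinom_poly_simps(1)[symmetric]
  by (intro trinom_poly_cong arg_cong[of _ _ "smult _"])
    (simp add: gamma_weight_Suc_left[OF assms(1) disjI1[OF assms(2)]] inv_linear_prod_def distrib_left)

section \<open>Positivity of the three Wronskians\<close>

lemma wronskian_sum_quot_poly_pos:
  assumes "\<And>n. n < m \<Longrightarrow> wronskian (quot_poly D {m} n) g x \<ge> 0"
    and "wronskian (quot_poly D {m} 0) g x > 0" and "d > 0" "m > 0"
  shows "wronskian (trinom_poly D (gamma_weight m d)) g x > 0"
  unfolding trinom_poly_gamma_weight wronskian_sum wronskian_simps
proof (rule sum_pos2[of _ 0])
  show "0 < (real m - real 0) * real (0 + d - 1 choose 0) * wronskian (quot_poly D {m} 0) g x"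
    using assms by simp
qed (use assms in auto)

lemma quot_poly_insert_Suc:
  assumes "m > 0"
  shows "quot_poly D {m} n =
     smult (real m + 1) (quot_poly D {m, Suc m} n) + smult 1 (euler_op (quot_poly D {m, Suc m} n))"
  unfolding quot_poly_def
    trinom_poly_simps(3)[symmetric] trinom_poly_simps(2)[symmetric] trinom_poly_simps(1)[symmetric]
  using assms
  by (intro trinom_poly_cong) (simp add: inv_linear_prod_def divide_simps, simp add: algebra_simps)

lemma quot_poly_shift':
  "trinom_poly D (\<lambda>j. real j * inv_linear_prod S j) =
     smult (real n) (quot_poly D S n) + smult 1 (euler_op (quot_poly D S n))"
  using quot_poly_shift[of D S n] by (simp add: add.commute)

text \<open>As W(f, f) = 0, only the correction term in \<open>uniform_gamma_Suc_left\<close>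
  counts. For d = 1 both gamma-polynomials are constant and the Wronskian is 0, hence d \<ge>
  2.\<close>

lemma wronskian_uniform_gamma_Suc_left:
  assumes "d \<ge> 2" "m > 0" and x: "x < 0"
  shows "wronskian (uniform_gamma m d) (uniform_gamma (Suc m) d) x > 0"
proof -
  let ?e = "trinom_poly d (\<lambda>j. real j * inv_linear_prod {m, Suc m} j)"
  let ?v = "quot_poly d {m, Suc m}"
  have d: "d > 0" using assms by simp
  \<comment> \<open>With v = \<open>?v n\<close> the two arguments are (theta + m + 1) v and (theta
    + n) v, whose determinant is m + 1 - n.\<close>
  have W: "wronskian (quot_poly d {m} n) ?e x = (real m + 1 - real n) * wronskian (?v n) (euler_op (?v n)) x" for n
    unfolding quot_poly_insert_Suc[OF \<open>m > 0\<close>] quot_poly_shift'[of _ _ n] wronskian_linear_comb by simp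
  have "wronskian (trinom_poly d (gamma_weight m d)) ?e x > 0"
  proof (rule wronskian_sum_quot_poly_pos[OF _ _ d \<open>m > 0\<close>])
    show "0 \<le> wronskian (quot_poly d {m} n) ?e x" if "n < m" for n
      unfolding W using wronskian_quot_poly_nonneg[of "{m, Suc m}" n x d] assms that by simp
    show "0 < wronskian (quot_poly d {m} 0) ?e x"
      unfolding W using wronskian_quot_poly_0_pos[of "{m, Suc m}" x d] assms by simp
  qed
  then show ?thesis
    unfolding uniform_gamma_Suc_left[OF d \<open>m > 0\<close>]
    by (simp add: wronskian_simps uniform_gamma_def zero_less_binomial)
qed

context
  fixes m d :: nat and x :: real
  assumes m: "m > 0" and d: "d > 0" and x: "x < 0"
begin

text \<open>\<open>F\<close> is the gamma-polynomial for (m, d) divided by d!, written with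
  denominators of index d + 1. \<open>e\<close> and \<open>eps\<close> are the corrections that
  arise when d, respectively m, is raised.\<close>

private abbreviation "p n \<equiv> quot_poly (Suc d) {m} n"
private abbreviation "v n \<equiv> quot_poly (Suc d) {m, Suc m} n"
private abbreviation "T \<equiv> trinom_poly (Suc d) (gamma_weight m d)"
private abbreviation "F \<equiv> smult (real d + 1) T + smult (- 2) (euler_op T)"
private abbreviation "e \<equiv> trinom_poly (Suc d) (\<lambda>j. real j * inv_linear_prod {m} j)"
private abbreviation "eps \<equiv> trinom_poly (Suc d) (\<lambda>j. real j * inv_linear_prod {m, Suc m} j)"

private lemma euler_op_sum: "euler_op (sum f A) = (\<Sum>n\<in>A. euler_op (f n))"
  by (induction A rule: infinite_finite_induct) (auto simp: euler_op_simps, simp_all add: euler_op_def)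

private lemma smult_sum_right: "smult c (sum f A) = (\<Sum>n\<in>A. smult c (f n))" for c :: real
  by (induction A rule: infinite_finite_induct) (auto simp: smult_add_right)

private lemma F_eq: "F = (\<Sum>n<m. smult ((real m - real n) * real (n + d - 1 choose n))
    (smult (real d + 1) (p n) + smult (- 2) (euler_op (p n))))"
  unfolding trinom_poly_gamma_weight euler_op_sum smult_sum_right sum.distrib[symmetric]
  by (rule sum.cong) (simp_all add: euler_op_simps smult_add_right smult_diff_right mult.commute)

private lemma wronskian_F_pos:
  assumes "\<And>n. n < m \<Longrightarrow> wronskian (smult (real d + 1) (p n) + smult (- 2) (euler_op (p n))) g x \<ge> 0"
    and "wronskian (smult (real d + 1) (p 0) + smult (- 2) (euler_op (p 0))) g x > 0"
  shows "wronskian F g x > 0"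
  unfolding F_eq wronskian_sum(1) wronskian_simps(3)
proof (rule sum_pos2[of _ 0])
  show "0 < (real m - real 0) * real (0 + d - 1 choose 0) *
    wronskian (smult (real d + 1) (p 0) + smult (- 2) (euler_op (p 0))) g x"
    using assms m by simp
qed (use assms m in auto)

text \<open>Termwise this compares (d + 1 - 2 theta) p with (theta + n) p for p =
  \<open>p n\<close>; the determinant is d + 1 + 2n.\<close>

private lemma wronskian_F_e: "wronskian F e x > 0"
proof (rule wronskian_F_pos)
  have W: "wronskian (smult (real d + 1) (p n) + smult (- 2) (euler_op (p n))) e x =
      (real d + 1 + 2 * real n) * wronskian (p n) (euler_op (p n)) x" for n
    unfolding quot_poly_shift'[of _ _ n] wronskian_linear_comb by simp
  show "0 \<le> wronskian (smult (real d + 1) (p n) + smult (- 2) (euler_op (p n))) e x" if "n < m" for n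
    unfolding W using wronskian_quot_poly_nonneg[of "{m}" n x] that x by simp
  show "0 < wronskian (smult (real d + 1) (p 0) + smult (- 2) (euler_op (p 0))) e x"
    unfolding W using wronskian_quot_poly_0_pos[of "{m}" x] m d x by simp
qed

text \<open>With \<open>c = d + 1\<close> the identity used is
  \<open>(c - 2j)(j + m + 1) = (j + n)(a - 2j) + (c + 2n)(m + 1 - n)\<close>.\<close>

private lemma wronskian_F_eps: "wronskian F eps x > 0"
proof (rule wronskian_F_pos)
  define b where "b n = (real d + 1 + 2 * real n) * (real m + 1 - real n)" for n
  have eps0: "eps = euler_op (v 0)" using quot_poly_shift'[of _ _ 0] by simp
  have W: "wronskian (smult (real d + 1) (p n) + smult (- 2) (euler_op (p n))) eps x =
      2 * wronskian eps (euler_op eps) x + b n * wronskian (v n) (euler_op (v n)) x" for n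
  proof -
    \<comment> \<open>Division of (c - 2j)(j + m + 1) by j + n: the remainder \<open>b n\<close> is
      the value at j = -n, positive for n \<le> m. The term with a drops out because W(eps, eps) =
      0.\<close>
    define a where "a = real d + 1 - 2 * (real m + 1) + 2 * real n"
    have "smult (real d + 1) (p n) + smult (- 2) (euler_op (p n)) =
        smult a eps + smult (- 2) (euler_op eps) + smult (b n) (v n)"
      unfolding quot_poly_insert_Suc[OF m] quot_poly_shift'[of _ _ n]
      by (rule poly_eqI)
        (simp add: coeff_euler_op a_def b_def, algebra)
    then have "wronskian (smult (real d + 1) (p n) + smult (- 2) (euler_op (p n))) eps x =
        wronskian (smult a eps + smult (- 2) (euler_op eps)) (smult 1 eps + smult 0 (euler_op eps)) x +
        b n * wronskian (smult 1 (v n) + smult 0 (euler_op (v n))) eps x"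
      by (simp add: wronskian_simps)
    also have "\<dots> = 2 * wronskian eps (euler_op eps) x + b n * wronskian (v n) (euler_op (v n)) x"
      unfolding wronskian_linear_comb
      by (subst (3) quot_poly_shift'[of _ _ n]) (simp only: wronskian_linear_comb, simp)
    finally show ?thesis .
  qed
  obtain xs where "neg_rooted (v 0) xs"
    using neg_rooted_inv_linear_prod[of "{m, Suc m}" "Suc d"] m by (auto simp: quot_poly_0)
  then have 0: "wronskian eps (euler_op eps) x \<ge> 0"
    unfolding eps0 using wronskian_euler_op_euler_op_nonneg x by blast
  show "0 \<le> wronskian (smult (real d + 1) (p n) + smult (- 2) (euler_op (p n))) eps x" if "n < m" for n
    unfolding W using wronskian_quot_poly_nonneg[of "{m, Suc m}" n x "Suc d"] that x 0 by (simp add: b_def)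
  show "0 < wronskian (smult (real d + 1) (p 0) + smult (- 2) (euler_op (p 0))) eps x"
    unfolding W using wronskian_quot_poly_0_pos[of "{m, Suc m}" x "Suc d"] m d x 0
    by (simp add: b_def add_nonneg_pos)
qed

text \<open>The determinant is d - 1, which is 0 for d = 1. Strict positivity of the full Wronskian
  has to come from the corrections.\<close>

private lemma wronskian_F_T:
  "wronskian F (smult (real d) T + smult (- 1) (euler_op T)) x \<ge> 0"
proof -
  obtain xs where "neg_rooted T xs" using neg_rooted_gamma_weight[OF d m] .
  then have "wronskian T (euler_op T) x \<ge> 0" using wronskian_euler_op_nonneg x by blast
  then show ?thesis unfolding wronskian_linear_comb using d by simp
qed

lemma wronskian_uniform_gamma_Suc_right:
  "wronskian (uniform_gamma m d) (uniform_gamma m (Suc d)) x > 0"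
proof -
  have "real d * wronskian (uniform_gamma m d) (uniform_gamma m (Suc d)) x =
      wronskian (uniform_gamma m d) (smult (real d) (uniform_gamma m (Suc d))) x"
    by (simp add: wronskian_simps)
  also have "\<dots> = fact d * (fact (Suc d) *
      (wronskian F (smult (real d) T + smult (- 1) (euler_op T)) x + real (m + d choose Suc d) * wronskian F e x))"
    unfolding uniform_gamma_Suc_Suc[OF d m] unfolding uniform_gamma_Suc
    by (simp only: wronskian_simps(2-4)) (simp add: algebra_simps)
  also have "\<dots> > 0"
    using wronskian_F_T wronskian_F_e m by (intro mult_pos_pos add_nonneg_pos) (auto simp: zero_less_binomial)
  finally show ?thesis using d by (simp add: zero_less_mult_iff)
qed

lemma wronskian_uniform_gamma_Suc_both:
  "wronskian (uniform_gamma m d) (uniform_gamma (Suc m) (Suc d)) x > 0"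
proof -
  define C where "C = real (m + d choose d)"
  \<comment> \<open>Raising both parameters produces (d - j) C j / ((j + m)(j + m + 1)) and a
    multiple of j / (j + m + 1). P and q are the coefficients when C is factored out and their sum
    is rewritten through the weights of \<open>e\<close> and \<open>eps\<close>; both turn out
    positive.\<close>
  define P where "P = real m / (real d + 1)"
  define q where "q = (real d + real m + 1) * real d / (real d + 1)"
  have pos: "C > 0" "P > 0" "q > 0" using m d by (auto simp: C_def P_def q_def zero_less_binomial)
  have bin: "real (Suc m + d choose Suc d) = C * (real m + real d + 1) / (real d + 1)"
  proof -
    have "Suc d * (Suc m + d choose Suc d) = Suc (m + d) * (m + d choose d)"
      using Suc_times_binomial[of d "m + d"] by simp
    then have "(real d + 1) * real (Suc m + d choose Suc d) = (real m + real d + 1) * C"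
      unfolding C_def by (metis of_nat_Suc of_nat_add of_nat_mult add.commute)
    then show ?thesis by (simp add: field_simps)
  qed
  have key: "real d * gamma_weight (Suc m) (Suc d) j =
      (real d - real j) * gamma_weight m d j +
      C * (P * (real j * inv_linear_prod {m} j) + q * (real j * inv_linear_prod {m, Suc m} j))" for j
  proof -
    have "real d * gamma_weight (Suc m) (Suc d) j = (real d - real j) * gamma_weight m d j +
       ((real d - real j) * (C * (real j / ((real j + real m) * (real j + real (Suc m))))) +
       C * (real m + real d + 1) / (real d + 1) * (real j / (real j + real (Suc m))))"
      using gamma_weight_Suc_right[OF d, of "Suc m" j] gamma_weight_Suc_left[OF d disjI1[OF m], of j]
      unfolding bin C_def[symmetric] by (simp add: distrib_left)
    also have "(real d - real j) * (C * (real j / ((real j + real m) * (real j + real (Suc m))))) +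
       C * (real m + real d + 1) / (real d + 1) * (real j / (real j + real (Suc m))) =
       C * (P * (real j * inv_linear_prod {m} j) + q * (real j * inv_linear_prod {m, Suc m} j))"
      using m unfolding P_def q_def
      by (simp add: inv_linear_prod_def divide_simps add_pos_pos) (simp add: algebra_simps)
    finally show ?thesis .
  qed
  have eq: "smult (real d) (uniform_gamma (Suc m) (Suc d)) = smult (fact (Suc d))
     (smult (real d) T + smult (- 1) (euler_op T) + smult C (smult P e + smult q eps))"
    unfolding uniform_gamma_def smult_smult mult.commute[of "real d"]
    unfolding smult_smult[symmetric]
      trinom_poly_simps(3)[symmetric] trinom_poly_simps(2)[symmetric] trinom_poly_simps(1)[symmetric]
    by (intro trinom_poly_cong) (simp only: mult.assoc key, simp add: algebra_simps)
  have "real d * wronskian (uniform_gamma m d) (uniform_gamma (Suc m) (Suc d)) x =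
      wronskian (uniform_gamma m d) (smult (real d) (uniform_gamma (Suc m) (Suc d))) x"
    by (simp add: wronskian_simps)
  also have "\<dots> = fact d * (fact (Suc d) *
      (wronskian F (smult (real d) T + smult (- 1) (euler_op T)) x +
       C * (P * wronskian F e x + q * wronskian F eps x)))"
    unfolding eq unfolding uniform_gamma_Suc
    by (simp only: wronskian_simps(2-4)) (simp add: algebra_simps)
  also have "\<dots> > 0"
    using wronskian_F_T wronskian_F_e wronskian_F_eps pos
    by (intro mult_pos_pos add_nonneg_pos add_pos_pos) auto
  finally show ?thesis using d by (simp add: zero_less_mult_iff)
qed

end

theorem uniform_gamma_interlacing:
  assumes m: "m > 0" and d: "d > 0"
  shows "strictly_interlaces (uniform_gamma m d) (uniform_gamma m (Suc d))"
    and "d \<ge> 2 \<Longrightarrow> strictly_interlaces (uniform_gamma m d) (uniform_gamma (Suc m) d)"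
    and "strictly_interlaces (uniform_gamma m d) (uniform_gamma (Suc m) (Suc d))"
proof -
  note P = uniform_gamma_properties
  obtain xs where f: "neg_rooted (uniform_gamma m d) xs" using P(4)[OF d m] by blast
  have deg: "Suc d div 2 = d div 2 \<or> Suc d div 2 = Suc (d div 2)" by linarith
  show "strictly_interlaces (uniform_gamma m d) (uniform_gamma m (Suc d))"
    using wronskian_uniform_gamma_Suc_right[OF m d] P(1-3)[of d m] P(1-3)[of "Suc d" m] m d deg
    by (intro strictly_interlaces_if_wronskian_pos[OF f]) simp_all
  show "strictly_interlaces (uniform_gamma m d) (uniform_gamma (Suc m) d)" if "d \<ge> 2"
    using wronskian_uniform_gamma_Suc_left[OF that m] P(1-3)[of d m] P(1-3)[of d "Suc m"] m d
    by (intro strictly_interlaces_if_wronskian_pos[OF f]) simp_all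
  show "strictly_interlaces (uniform_gamma m d) (uniform_gamma (Suc m) (Suc d))"
    using wronskian_uniform_gamma_Suc_both[OF m d] P(1-3)[of d m] P(1-3)[of "Suc d" "Suc m"] m d deg
    by (intro strictly_interlaces_if_wronskian_pos[OF f]) simp_all
qed

section \<open>The coefficients for uniform matroids\<close>

text \<open>For \<open>i = 0\<close> the truncated subtraction makes the second binomial coefficient vanish unless
  \<open>h = 0\<close>, as the generalised one does. The coefficients for \<open>d = 0\<close> are set to \<open>0\<close> (the true
  polynomial is \<open>1\<close>), so that the deletion recursion holds for \<open>d = 1\<close>.\<close>

definition kl_sum :: "nat \<Rightarrow> nat \<Rightarrow> nat \<Rightarrow> nat" where
  "kl_sum m s i = (\<Sum>h<m. (s + h choose (h + i + 1)) * (i + h - 1 choose h))"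

definition kl_coeff :: "nat \<Rightarrow> nat \<Rightarrow> nat \<Rightarrow> real" where
  "kl_coeff m d i = (if i = 0 then (if d = 0 then 0 else 1)
     else real (d + m choose i) * real (kl_sum m (d - i) i) / real (d - i))"

text \<open>For j > 0 this is \<open>kl_coeff (Suc m) (2 * j - 1) (j - 1)\<close>, by
  \<open>kl_coeff_recursion\<close> at d = 2j: the coefficient in the largest degree that is allowed
  for corank m + 1 and rank 2j - 1. For m = 0 it is a Catalan number.\<close>

definition top_coeff :: "nat \<Rightarrow> nat \<Rightarrow> real" where
  "top_coeff m j = real (2 * j + m choose (j - 1)) * real (j + m - 1 choose m) / real j"

lemma kl_sum_0: "kl_sum (Suc m) s 0 = s"
proof -
  have "kl_sum (Suc m) s 0 = (\<Sum>h<Suc m. if h = 0 then s else 0)"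
    unfolding kl_sum_def by (intro sum.cong refl) auto
  then show ?thesis by (simp only: sum.delta) simp
qed

lemma kl_coeff_eq:
  assumes "i > 0 \<or> m > 0"
  shows "kl_coeff m d i = real (d + m choose i) * real (kl_sum m (d - i) i) / real (d - i)"
proof (cases "i = 0")
  case True
  then obtain k where "m = Suc k" using assms gr0_conv_Suc by auto
  then show ?thesis using True by (simp add: kl_coeff_def kl_sum_0)
qed (simp add: kl_coeff_def)

lemma kl_coeff_eq_0: "d \<le> 2 * i \<Longrightarrow> kl_coeff m d i = 0"
  by (auto simp: kl_coeff_def kl_sum_def binomial_eq_0)

text \<open>The second sum is \<open>kl_sum (Suc m) s i\<close>. Neither sum has a closed form here,
  but for neighbouring i and the same s Pascal's rule on both factors makes the total
  telescope.\<close>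

lemma kl_sum_telescope:
  "kl_sum (Suc m) s (Suc i) + (\<Sum>h<Suc m. (s + h choose (h + Suc i)) * (i + h - 1 choose h)) =
     (s + m + 1 choose (i + m + 2)) * (i + m choose m)"
proof (induction m)
  case 0
  then show ?case by (simp add: kl_sum_def)
next
  case (Suc m)
  have "kl_sum (Suc (Suc m)) s (Suc i) + (\<Sum>h<Suc (Suc m). (s + h choose (h + Suc i)) * (i + h - 1 choose h)) =
      (s + m + 1 choose (i + m + 2)) * (i + m choose m) +
      (s + Suc m choose (Suc m + Suc i + 1)) * (i + Suc m choose Suc m) +
      (s + Suc m choose (Suc m + Suc i)) * (i + m choose Suc m)"
    unfolding Suc.IH[symmetric] by (simp add: kl_sum_def)
  also have "\<dots> = (s + Suc m + 1 choose (i + Suc m + 2)) * (i + Suc m choose Suc m)"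
    by (simp add: algebra_simps)
  finally show ?case .
qed

lemma real_binomial_fact: "n + k = N \<Longrightarrow> real (N choose k) = fact N / (fact n * fact k)"
  using binomial_fact[of k N, where 'a = real] by auto

text \<open>What remains of \<open>kl_coeff_recursion\<close> after telescoping, with the common
  factor C(i + m - 1, m) removed.\<close>

lemma kl_coeff_arith:
  assumes "i \<le> s" "i > 0"
  shows "real (s + i + m choose i) * real (s + m choose (m + i + 1)) +
     real (s + i + m choose (i - 1)) * real (s + m + 1 choose (m + i + 1)) =
     real s / real i * real (2 * i + m choose (i - 1)) * real (m + (s + i) choose (s - i))"
proof -
  obtain e where s: "s = i + e" using assms le_Suc_ex by blast
  obtain k where i: "i = Suc k" using assms gr0_conv_Suc by blast
  have 1: "real (s + i + m choose i) = fact (s + i + m) / (fact (s + m) * fact i)"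
    by (rule real_binomial_fact) simp
  \<comment> \<open>The factor e covers s = i, where the binomial coefficient is 0 and the quotient
    of factorials would be wrong.\<close>
  have 2: "real (s + m choose (m + i + 1)) = real e * fact (s + m) / (fact e * fact (m + i + 1))"
  proof (cases e)
    case 0
    then show ?thesis using s by simp
  next
    case (Suc f)
    have "real (s + m choose (m + i + 1)) = fact (s + m) / (fact f * fact (m + i + 1))"
      by (rule real_binomial_fact) (use s Suc in simp)
    also have "\<dots> = real e * fact (s + m) / (fact e * fact (m + i + 1))"
      unfolding Suc fact_Suc by (simp del: of_nat_Suc fact_Suc)
    finally show ?thesis .
  qed
  have 3: "real (s + i + m choose (i - 1)) = fact (s + i + m) / (fact (s + m + 1) * fact (i - 1))"
    by (rule real_binomial_fact) (use i in simp)
  have 4: "real (s + m + 1 choose (m + i + 1)) = fact (s + m + 1) / (fact e * fact (m + i + 1))"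
    by (rule real_binomial_fact) (use s in simp)
  have 5: "real (2 * i + m choose (i - 1)) = fact (2 * i + m) / (fact (m + i + 1) * fact (i - 1))"
    by (rule real_binomial_fact) (use i in simp)
  have 6: "real (m + (s + i) choose (s - i)) = fact (s + i + m) / (fact (2 * i + m) * fact e)"
    using real_binomial_fact[of "2 * i + m" e "m + (s + i)"] s by (simp add: ac_simps)
  define A B C G where "A = (fact (s + i + m) :: real)" and "B = (fact (m + i + 1) :: real)"
    and "C = (fact (s + m) :: real)" and "G = (fact (2 * i + m) :: real)"
  define C' where "C' = (fact (s + m + 1) :: real)"
  have nz: "B > 0" "C > 0" "G > 0" "C' > 0" by (simp_all only: A_def B_def C_def C'_def G_def fact_gt_zero)
  have fi: "(fact i :: real) = real i * fact k" and ik: "i - 1 = k" by (simp_all add: i)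
  have rs: "real s = real i + real e" by (simp add: s)
  show ?thesis
    unfolding 1 2 3 4 5 6 unfolding fi ik rs A_def[symmetric] B_def[symmetric] C_def[symmetric] C'_def[symmetric] G_def[symmetric]
    using nz assms by (simp add: divide_simps) (simp add: algebra_simps)
qed

text \<open>Lowering d and i together keeps s = d - i, so all terms contain sums with the same s.
  Pascal's rule on C(d + m + 1, i) then leaves C(d + m, i - 1) times the sum that telescopes, plus
  the last summand of \<open>kl_sum (Suc m) s i\<close>.\<close>

lemma kl_coeff_recursion:
  assumes "i > 0"
  shows "kl_coeff (Suc m) d i + kl_coeff (Suc m) (d - 1) (i - 1) =
    kl_coeff m d i + (if 2 * i \<le> d then top_coeff m i * real (m + d choose (d - 2 * i)) else 0)"
proof (cases "2 * i \<le> d")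
  case False
  then show ?thesis by (simp add: kl_coeff_eq_0)
next
  case True
  obtain k where k: "i = Suc k" using assms gr0_conv_Suc by blast
  define s where "s = d - i"
  have d: "d = s + i" and si: "i \<le> s" using True s_def by auto
  have s0: "s > 0" using si assms by simp
  define B where "B = (\<Sum>h<Suc m. (s + h choose (h + Suc k)) * (k + h - 1 choose h))"
  define a where "a = (s + m choose (m + i + 1)) * (k + m choose m)"
  have A': "kl_sum (Suc m) s i = kl_sum m s i + a"
    by (simp add: kl_sum_def a_def k)
  have e1: "d - 1 - (i - 1) = s" "d - i = s" using d s_def k by auto
  have "kl_sum (Suc m) (d - 1 - (i - 1)) (i - 1) = B"
    unfolding e1 by (simp add: kl_sum_def B_def k)
  then have k2: "real s * kl_coeff (Suc m) (d - 1) (i - 1) = real (s + i + m choose (i - 1)) * real B"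
    using kl_coeff_eq[of "i - 1" "Suc m" "d - 1"] s0 e1 d k by simp
  have k1: "real s * kl_coeff (Suc m) d i =
      (real (s + i + m choose i) + real (s + i + m choose (i - 1))) * real (kl_sum (Suc m) s i)"
    using kl_coeff_eq[of i "Suc m" d] s0 e1 d k by simp
  have k3: "real s * kl_coeff m d i = real (s + i + m choose i) * real (kl_sum m s i)"
    using kl_coeff_eq[of i m d] s0 e1 d k by simp
  have "kl_sum (Suc m) s i + B = (s + m + 1 choose (m + i + 1)) * (k + m choose m)"
    using kl_sum_telescope[of m s k] by (simp add: B_def k add.commute add.left_commute)
  then have AB: "real (kl_sum (Suc m) s i) + real B = real (s + m + 1 choose (m + i + 1)) * real (k + m choose m)"
    by (metis of_nat_add of_nat_mult)
  define N1 N2 where "N1 = real (s + i + m choose i)" and "N2 = real (s + i + m choose (i - 1))"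
  have "real s * (kl_coeff (Suc m) d i + kl_coeff (Suc m) (d - 1) (i - 1)) =
      N1 * real (kl_sum m s i) + N1 * real a + N2 * (real (kl_sum (Suc m) s i) + real B)"
    unfolding distrib_left k1 k2 N1_def[symmetric] N2_def[symmetric]
    by (simp add: A' algebra_simps)
  also have "\<dots> = real s * kl_coeff m d i +
      (N1 * real (s + m choose (m + i + 1)) + N2 * real (s + m + 1 choose (m + i + 1))) * real (k + m choose m)"
    unfolding AB k3 N1_def[symmetric] by (simp add: a_def algebra_simps)
  also have "\<dots> = real s * (kl_coeff m d i + top_coeff m i * real (m + d choose (d - 2 * i)))"
  proof -
    have e: "d - 2 * i = s - i" "i + m - 1 = k + m" using d k by auto
    have "N1 * real (s + m choose (m + i + 1)) + N2 * real (s + m + 1 choose (m + i + 1)) =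
        real s / real i * real (2 * i + m choose (i - 1)) * real (m + d choose (s - i))"
      using kl_coeff_arith[OF si assms, of m] unfolding N1_def N2_def d .
    then show ?thesis
      unfolding top_coeff_def e by (simp add: distrib_left)
  qed
  finally show ?thesis using s0 True by simp
qed

section \<open>From the deletion recursion to the Z-polynomial and back\<close>

definition kl_eval :: "nat \<Rightarrow> nat \<Rightarrow> real \<Rightarrow> real" where
  "kl_eval m d x = (\<Sum>i\<le>d. kl_coeff m d i * x ^ i)"

lemma kl_eval_0: "kl_eval m 0 x = 0"
  by (simp add: kl_eval_def kl_coeff_def)

lemma kl_eval_recursion:
  assumes "d > 0"
  shows "kl_eval (Suc m) d x + x * kl_eval (Suc m) (d - 1) x =
    kl_eval m d x + (\<Sum>j\<in>{1..d div 2}. top_coeff m j * real (m + d choose (d - 2 * j)) * x ^ j)"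
proof -
  obtain e where e: "d = Suc e" using assms gr0_conv_Suc by blast
  let ?t = "\<lambda>j. if 2 * j \<le> d then top_coeff m j * real (m + d choose (d - 2 * j)) else 0"
  have shift: "x * kl_eval (Suc m) (d - 1) x = (\<Sum>i\<in>{1..d}. kl_coeff (Suc m) (d - 1) (i - 1) * x ^ i)"
    unfolding kl_eval_def sum_distrib_left e
    by (rule sum.reindex_bij_witness[of _ "\<lambda>i. i - 1" Suc]) (auto simp: algebra_simps)
  have sp: "kl_eval m' d x = 1 + (\<Sum>i\<in>{1..d}. kl_coeff m' d i * x ^ i)" for m'
  proof -
    have "{..d} = insert 0 {1..d}" by auto
    then show ?thesis using assms by (simp add: kl_eval_def kl_coeff_def)
  qed
  have "(\<Sum>i\<in>{1..d}. kl_coeff (Suc m) d i * x ^ i) + (\<Sum>i\<in>{1..d}. kl_coeff (Suc m) (d - 1) (i - 1) * x ^ i)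
      = (\<Sum>i\<in>{1..d}. (kl_coeff m d i + ?t i) * x ^ i)"
    unfolding sum.distrib[symmetric]
    by (intro sum.cong refl, subst distrib_right[symmetric], subst kl_coeff_recursion) auto
  also have "\<dots> = (\<Sum>i\<in>{1..d}. kl_coeff m d i * x ^ i) + (\<Sum>i\<in>{1..d}. ?t i * x ^ i)"
    by (simp only: distrib_right sum.distrib)
  also have "(\<Sum>i\<in>{1..d}. ?t i * x ^ i) = (\<Sum>j\<in>{1..d div 2}. top_coeff m j * real (m + d choose (d - 2 * j)) * x ^ j)"
    by (rule sum.mono_neutral_cong_right) auto
  finally show ?thesis unfolding sp shift by simp
qed

text \<open>The proper flats are the k-subsets with k < d. The ground set is the only flat of rank d
  and contributes \<open>x ^ d\<close> separately, also because \<open>kl_eval\<close> is 0 in rank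
  0.\<close>

definition Z_eval :: "nat \<Rightarrow> nat \<Rightarrow> real \<Rightarrow> real" where
  "Z_eval m d x = (\<Sum>k<d. real (m + d choose k) * x ^ k * kl_eval m (d - k) x) + x ^ d"

definition gamma_coeff :: "nat \<Rightarrow> nat \<Rightarrow> nat \<Rightarrow> real" where
  "gamma_coeff m d j = (if j = 0 then 1
     else (\<Sum>n<m. top_coeff n j * real (n + d choose (d - 2 * j))))"

text \<open>Pascal's rule splits C(m + 1 + d, k). A shift of the second half puts Q(d - k) + x Q(d -
  k - 1) under the factor C(m + d, k), which is the left side of the deletion recursion. The
  additional terms collapse to powers of 1 + x by trinomial revision.\<close>

lemma Z_eval_Suc:
  assumes "d > 0"
  shows "Z_eval (Suc m) d x = Z_eval m d x +
    (\<Sum>j\<in>{1..d div 2}. top_coeff m j * real (m + d choose (d - 2 * j)) * x ^ j * (1 + x) ^ (d - 2 * j))"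
proof -
  let ?Q = "kl_eval (Suc m)"
  obtain e where e: "d = Suc e" using assms gr0_conv_Suc by blast
  define T where "T k j = top_coeff m j * real (m + (d - k) choose (d - k - 2 * j)) * x ^ j" for k j
  have pascal: "(\<Sum>k<d. real (Suc m + d choose k) * x ^ k * ?Q (d - k) x) =
      (\<Sum>k<d. real (m + d choose k) * x ^ k * ?Q (d - k) x) +
      (\<Sum>k<d. real (m + d choose k) * x ^ Suc k * ?Q (d - k - 1) x)"
  proof -
    have "(\<Sum>k<d. real (Suc m + d choose k) * x ^ k * ?Q (d - k) x) =
      ?Q d x + (\<Sum>k<e. real (Suc m + d choose Suc k) * x ^ Suc k * ?Q (d - Suc k) x)"
      unfolding e by (subst sum.lessThan_Suc_shift) simp
    also have "\<dots> = ?Q d x + (\<Sum>k<e. real (m + d choose Suc k) * x ^ Suc k * ?Q (d - Suc k) x) +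
       (\<Sum>k<e. real (m + d choose k) * x ^ Suc k * ?Q (d - k - 1) x)"
      by (simp add: distrib_right sum.distrib)
    also have "?Q d x + (\<Sum>k<e. real (m + d choose Suc k) * x ^ Suc k * ?Q (d - Suc k) x) =
        (\<Sum>k<d. real (m + d choose k) * x ^ k * ?Q (d - k) x)"
      unfolding e by (subst sum.lessThan_Suc_shift) simp
    \<comment> \<open>The term k = d - 1 may be added because \<open>kl_eval\<close> is 0 in rank
      0.\<close>
    also have "(\<Sum>k<e. real (m + d choose k) * x ^ Suc k * ?Q (d - k - 1) x) =
        (\<Sum>k<d. real (m + d choose k) * x ^ Suc k * ?Q (d - k - 1) x)"
      unfolding e by (simp add: kl_eval_0)
    finally show ?thesis .
  qed
  have "(\<Sum>k<d. real (Suc m + d choose k) * x ^ k * ?Q (d - k) x) =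
      (\<Sum>k<d. real (m + d choose k) * x ^ k * (?Q (d - k) x + x * ?Q (d - k - 1) x))"
    unfolding pascal sum.distrib[symmetric] by (intro sum.cong refl) (simp add: algebra_simps)
  also have "\<dots> = (\<Sum>k<d. real (m + d choose k) * x ^ k * (kl_eval m (d - k) x + (\<Sum>j\<in>{1..(d - k) div 2}. T k j)))"
    by (intro sum.cong refl, subst kl_eval_recursion) (auto simp: T_def)
  also have "\<dots> = (\<Sum>k<d. real (m + d choose k) * x ^ k * kl_eval m (d - k) x) +
      (\<Sum>k<d. \<Sum>j\<in>{1..(d - k) div 2}. real (m + d choose k) * x ^ k * T k j)"
    by (simp add: distrib_left sum.distrib sum_distrib_left)
  also have "(\<Sum>k<d. \<Sum>j\<in>{1..(d - k) div 2}. real (m + d choose k) * x ^ k * T k j) =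
      (\<Sum>k<d. \<Sum>j\<in>{j \<in> {1..d div 2}. k + 2 * j \<le> d}. real (m + d choose k) * x ^ k * T k j)"
    by (intro sum.cong refl) auto
  also have "\<dots> = (\<Sum>j\<in>{1..d div 2}. \<Sum>k\<in>{k \<in> {..<d}. k + 2 * j \<le> d}. real (m + d choose k) * x ^ k * T k j)"
    by (rule sum.swap_restrict) auto
  also have "\<dots> = (\<Sum>j\<in>{1..d div 2}. top_coeff m j * real (m + d choose (d - 2 * j)) * x ^ j * (1 + x) ^ (d - 2 * j))"
  proof (intro sum.cong refl)
    fix j assume j: "j \<in> {1..d div 2}"
    have set: "{k \<in> {..<d}. k + 2 * j \<le> d} = {..d - 2 * j}" using j by auto
    have "real (m + d choose k) * x ^ k * T k j =
        top_coeff m j * real (m + d choose (d - 2 * j)) * x ^ j * (real (d - 2 * j choose k) * x ^ k)"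
      if k: "k \<le> d - 2 * j" for k
    proof -
      have "(m + d choose (d - 2 * j)) * (d - 2 * j choose k) = (m + d choose k) * (m + d - k choose (d - 2 * j - k))"
        by (rule choose_mult) (use k in auto)
      moreover have "m + d - k = m + (d - k)" "d - 2 * j - k = d - k - 2 * j" using k by auto
      ultimately have "real (m + d choose (d - 2 * j)) * real (d - 2 * j choose k) =
          real (m + d choose k) * real (m + (d - k) choose (d - k - 2 * j))"
        by (metis of_nat_mult)
      then show ?thesis unfolding T_def by (simp add: algebra_simps)
    qed
    then have "(\<Sum>k\<le>d - 2 * j. real (m + d choose k) * x ^ k * T k j) =
        top_coeff m j * real (m + d choose (d - 2 * j)) * x ^ j * (\<Sum>k\<le>d - 2 * j. real (d - 2 * j choose k) * x ^ k)"
      unfolding sum_distrib_left by (intro sum.cong refl) auto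
    also have "(\<Sum>k\<le>d - 2 * j. real (d - 2 * j choose k) * x ^ k) = (1 + x) ^ (d - 2 * j)"
      using binomial_ring[of x 1 "d - 2 * j"] by (simp add: add.commute)
    finally show "(\<Sum>k\<in>{k \<in> {..<d}. k + 2 * j \<le> d}. real (m + d choose k) * x ^ k * T k j) =
        top_coeff m j * real (m + d choose (d - 2 * j)) * x ^ j * (1 + x) ^ (d - 2 * j)"
      unfolding set .
  qed
  finally show ?thesis unfolding Z_eval_def by simp
qed

text \<open>Corank 0 is the Boolean case, with all Kazhdan-Lusztig polynomials 1 and Z-polynomial (1
  + x)^d; each step in m adds terms of the required shape.\<close>

lemma Z_eval_gamma_coeff:
  assumes d: "d > 0"
  shows "Z_eval m d x = (\<Sum>j\<le>d div 2. gamma_coeff m d j * x ^ j * (1 + x) ^ (d - 2 * j))"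
proof (induction m)
  case 0
  have "kl_eval 0 e x = 1" if "e > 0" for e
  proof -
    have "kl_eval 0 e x = (\<Sum>i\<le>e. if i = 0 then 1 else 0)"
      unfolding kl_eval_def using that by (intro sum.cong refl) (simp add: kl_coeff_def kl_sum_def)
    then show ?thesis by simp
  qed
  then have "Z_eval 0 d x = (\<Sum>k<d. real (d choose k) * x ^ k) + x ^ d"
    by (simp add: Z_eval_def)
  also have "\<dots> = (\<Sum>k\<le>d. real (d choose k) * x ^ k)"
    by (simp flip: lessThan_Suc_atMost)
  also have "\<dots> = (1 + x) ^ d" using binomial_ring[of x 1 d] by (simp add: add.commute)
  also have "\<dots> = (\<Sum>j\<le>d div 2. if j = 0 then (1 + x) ^ d else 0)" by simp
  also have "\<dots> = (\<Sum>j\<le>d div 2. gamma_coeff 0 d j * x ^ j * (1 + x) ^ (d - 2 * j))"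
    by (intro sum.cong refl) (simp add: gamma_coeff_def)
  finally show ?case .
next
  case (Suc m)
  have split: "{..d div 2} = insert 0 {1..d div 2}" by auto
  show ?case
    unfolding Z_eval_Suc[OF d] Suc split
    by (simp add: gamma_coeff_def sum.distrib[symmetric] algebra_simps)
qed

lemma Z_eval_palindromic:
  assumes "d > 0" "x \<noteq> 0"
  shows "x ^ d * Z_eval m d (1 / x) = Z_eval m d x"
  unfolding Z_eval_gamma_coeff[OF assms(1)] sum_distrib_left
proof (intro sum.cong refl)
  fix j assume "j \<in> {..d div 2}"
  then have "2 * j \<le> d" by auto
  then obtain e where e: "d = 2 * j + e" using le_Suc_ex by blast
  have "x ^ e * (1 + 1 / x) ^ e = (1 + x) ^ e"
    using assms(2) by (simp add: power_mult_distrib[symmetric] distrib_left add.commute)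
  moreover have "x ^ j * (1 / x) ^ j = 1" using assms(2) by (simp add: power_one_over)
  moreover have "x ^ d * (gamma_coeff m d j * (1 / x) ^ j * (1 + 1 / x) ^ (d - 2 * j)) =
      gamma_coeff m d j * x ^ j * (x ^ j * (1 / x) ^ j) * (x ^ e * (1 + 1 / x) ^ e)"
    by (simp add: e power_add mult_2)
  ultimately show "x ^ d * (gamma_coeff m d j * (1 / x) ^ j * (1 + 1 / x) ^ (d - 2 * j)) =
      gamma_coeff m d j * x ^ j * (1 + x) ^ (d - 2 * j)"
    using e by simp
qed

text \<open>This is the defining recursion for uniform matroids, the last sum being the
  characteristic polynomial of the whole matroid. Palindromicity in every rank e \<le> d is a
  triangular system for the reversed polynomials, which binomial inversion solves.\<close>

lemma kl_eval_reversal: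
  assumes "d > 0" "x \<noteq> 0"
  shows "x ^ d * kl_eval m d (1 / x) =
    (\<Sum>k<d. real (m + d choose k) * (x - 1) ^ k * kl_eval m (d - k) x) +
    (\<Sum>k<d. (-1) ^ k * real (m + d choose k) * (x ^ (d - k) - 1))"
proof -
  define a where "a e = x ^ e * kl_eval m e (1 / x)" for e
  define b where "b e = kl_eval m e x" for e
  have pal: "(\<Sum>k<e. real (m + e choose k) * (a (e - k) - x ^ k * b (e - k))) = x ^ e - 1" if "e > 0" for e
  proof -
    have "x ^ e * Z_eval m e (1 / x) = (\<Sum>k<e. real (m + e choose k) * a (e - k)) + 1"
      unfolding Z_eval_def distrib_left sum_distrib_left
    proof (intro arg_cong2[of _ _ _ _ "(+)"] sum.cong refl)
      fix k assume "k \<in> {..<e}"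
      then have "x ^ e = x ^ k * x ^ (e - k)" by (simp flip: power_add)
      then show "x ^ e * (real (m + e choose k) * (1 / x) ^ k * kl_eval m (e - k) (1 / x)) =
          real (m + e choose k) * a (e - k)"
        using assms(2) by (simp add: a_def power_one_over)
    qed (use assms(2) in \<open>simp add: power_one_over\<close>)
    moreover have "Z_eval m e x = (\<Sum>k<e. real (m + e choose k) * (x ^ k * b (e - k))) + x ^ e"
      by (simp add: Z_eval_def b_def mult.assoc)
    ultimately show ?thesis using Z_eval_palindromic[OF that assms(2), of m]
      by (simp add: right_diff_distrib sum_subtractf)
  qed
  \<comment> \<open>Inversion weights for rank d - l. Collecting s = l + k, trinomial revision
    extracts C(m + d, s); the alternating sum over l then removes the reversed polynomials except
    for s = 0, and turns the powers of x into (x - 1)^s.\<close>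
  define w where "w l = (-1) ^ l * real (m + d choose l)" for l
  have "(\<Sum>l<d. w l * (x ^ (d - l) - 1)) =
      (\<Sum>l<d. \<Sum>k<d - l. w l * real (m + (d - l) choose k) * (a (d - l - k) - x ^ k * b (d - l - k)))"
    by (intro sum.cong refl, subst pal[symmetric]) (auto simp: sum_distrib_left mult.assoc)
  also have "\<dots> = (\<Sum>(l, k)\<in>{(l, k). l + k < d}.
      w l * real (m + (d - l) choose k) * (a (d - l - k) - x ^ k * b (d - l - k)))"
    by (subst sum.Sigma) (auto intro!: sum.cong)
  also have "\<dots> = (\<Sum>s<d. \<Sum>l\<le>s.
      w l * real (m + (d - l) choose (s - l)) * (a (d - l - (s - l)) - x ^ (s - l) * b (d - l - (s - l))))"
    by (rule sum.triangle_reindex)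
  also have "\<dots> = (\<Sum>s<d. real (m + d choose s) *
      ((\<Sum>l\<le>s. (-1) ^ l * real (s choose l)) * a (d - s) - (x - 1) ^ s * b (d - s)))"
  proof (intro sum.cong refl)
    fix s assume s: "s \<in> {..<d}"
    have c: "w l * real (m + (d - l) choose (s - l)) * (a (d - l - (s - l)) - x ^ (s - l) * b (d - l - (s - l))) =
        real (m + d choose s) * ((-1) ^ l * real (s choose l) * a (d - s) -
          real (s choose l) * (-1) ^ l * x ^ (s - l) * b (d - s))" if l: "l \<le> s" for l
    proof -
      have "(m + d choose s) * (s choose l) = (m + d choose l) * (m + d - l choose (s - l))"
        by (rule choose_mult) (use l s in auto)
      moreover have "m + d - l = m + (d - l)" using l s by auto
      ultimately have "real (m + d choose l) * real (m + (d - l) choose (s - l)) =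
          real (m + d choose s) * real (s choose l)" by (metis of_nat_mult)
      then have "w l * real (m + (d - l) choose (s - l)) = real (m + d choose s) * ((-1) ^ l * real (s choose l))"
        unfolding w_def by (metis mult.assoc mult.left_commute)
      moreover have "d - l - (s - l) = d - s" using l by simp
      ultimately show ?thesis by (simp add: algebra_simps)
    qed
    have bs: "(\<Sum>l\<le>s. real (s choose l) * (-1) ^ l * x ^ (s - l)) = (x - 1) ^ s"
      using binomial_ring[of "-1" x s] by simp
    have "(\<Sum>l\<le>s. w l * real (m + (d - l) choose (s - l)) * (a (d - l - (s - l)) - x ^ (s - l) * b (d - l - (s - l)))) =
        (\<Sum>l\<le>s. real (m + d choose s) * ((-1) ^ l * real (s choose l) * a (d - s) -
          real (s choose l) * (-1) ^ l * x ^ (s - l) * b (d - s)))"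
      by (intro sum.cong refl c) simp
    then show "(\<Sum>l\<le>s. w l * real (m + (d - l) choose (s - l)) * (a (d - l - (s - l)) - x ^ (s - l) * b (d - l - (s - l)))) =
        real (m + d choose s) * ((\<Sum>l\<le>s. (-1) ^ l * real (s choose l)) * a (d - s) - (x - 1) ^ s * b (d - s))"
      by (simp only: sum_distrib_left[symmetric] sum_subtractf sum_distrib_right[symmetric] bs)
  qed
  also have "\<dots> = (\<Sum>s<d. (if s = 0 then a d else 0) - real (m + d choose s) * (x - 1) ^ s * b (d - s))"
  proof (intro sum.cong refl)
    fix s assume "s \<in> {..<d}"
    have "(\<Sum>l\<le>s. (-1) ^ l * real (s choose l)) = (if s = 0 then 1 else 0)"
      using choose_alternating_sum[of s, where 'a = real] by auto
    then show "real (m + d choose s) * ((\<Sum>l\<le>s. (-1) ^ l * real (s choose l)) * a (d - s) - (x - 1) ^ s * b (d - s)) =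
        (if s = 0 then a d else 0) - real (m + d choose s) * (x - 1) ^ s * b (d - s)"
      by (simp add: right_diff_distrib)
  qed
  also have "\<dots> = a d - (\<Sum>s<d. real (m + d choose s) * (x - 1) ^ s * b (d - s))"
    using assms(1) by (simp add: sum_subtractf)
  finally show ?thesis by (simp add: a_def b_def w_def)
qed

text \<open>For j > 0 both sides are 0 at m = 0 and have equal increments:
  \<open>top_coeff m j\<close> times C(m + d, d - 2j) is the increment in
  \<open>gamma_weight_Suc_left\<close> up to the factorials. For j = 0 both sides are 1.\<close>

lemma gamma_coeff_eq:
  assumes d: "d > 0" and m: "m > 0" and j: "2 * j \<le> d"
  shows "gamma_coeff m d j = fact d * gamma_weight m d j / (fact (d - 2 * j) * fact j * fact j)"
proof (cases "j = 0")
  case True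
  have "(\<Sum>n<m. real (n + d - 1 choose n) * shift_quot n 0) = (\<Sum>n<m. if n = 0 then 1 else 0)"
    by (intro sum.cong refl) (auto simp: shift_quot_def)
  then have "gamma_weight m d 0 = 1" using m by (simp add: gamma_weight_eq[OF d])
  then show ?thesis using True by (simp add: gamma_coeff_def)
next
  case False
  then obtain k where k: "j = Suc k" using not0_implies_Suc by blast
  obtain e where e: "d = 2 * j + e" using j le_Suc_ex by blast
  show ?thesis
  proof (induction m)
    case 0
    then show ?case using False by (simp add: gamma_coeff_def gamma_weight_def)
  next
    case (Suc m)
    define A B G where "A = (fact (m + d) :: real)" and "B = (fact (k + m) :: real)"
      and "G = (fact (2 * j + m) :: real)"
    have "real (2 * j + m choose (j - 1)) = G / (fact (m + j + 1) * fact (j - 1))"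
      unfolding G_def by (rule real_binomial_fact) (use k in simp)
    moreover have "fact (m + j + 1) = (real j + real m + 1) * (real j + real m) * B"
      by (simp add: k B_def ac_simps)
    ultimately have 1: "real (2 * j + m choose (j - 1)) = G / ((real j + real m + 1) * (real j + real m) * B * fact k)"
      by (simp add: k)
    have 2: "real (j + m - 1 choose m) = B / (fact k * fact m)"
      unfolding B_def using k by (intro real_binomial_fact[THEN trans]) auto
    have 3: "real (m + d choose (d - 2 * j)) = A / (G * fact e)"
      unfolding A_def G_def using real_binomial_fact[of "2 * j + m" e "m + d"] e by simp
    have 4: "real (m + d choose d) = A / (fact m * fact d)"
      unfolding A_def by (rule real_binomial_fact) simp
    have fj: "(fact j :: real) = real j * fact k" by (simp add: k)
    have pos: "A > 0" "B > 0" "G > 0" by (simp_all only: A_def B_def G_def fact_gt_zero)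
    have de: "d - 2 * j = e" using e by simp
    have "top_coeff m j * real (m + d choose (d - 2 * j)) =
        fact d * (real (m + d choose d) * (real j / ((real j + real m) * (real j + real (Suc m))))) /
        (fact e * fact j * fact j)"
      unfolding top_coeff_def 1 2 3 4 fj using pos False
      by (simp add: divide_simps)
    moreover have "gamma_coeff (Suc m) d j = gamma_coeff m d j + top_coeff m j * real (m + d choose (d - 2 * j))"
      using False by (simp add: gamma_coeff_def)
    ultimately show ?case
      using Suc gamma_weight_Suc_left[OF d, of m j] False unfolding de
      by (simp add: distrib_left add_divide_distrib)
  qed
qed

lemma Z_eval_uniform_gamma:
  assumes d: "d > 0" and m: "m > 0" and x: "x \<noteq> -1"
  shows "Z_eval m d x = (1 + x) ^ d * poly (uniform_gamma m d) (x / (1 + x)\<^sup>2)"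
proof -
  have "poly (uniform_gamma m d) y = (\<Sum>j\<le>d div 2. gamma_coeff m d j * y ^ j)" for y
  proof -
    have "poly (uniform_gamma m d) y = (\<Sum>j\<le>d div 2. coeff (uniform_gamma m d) j * y ^ j)"
      using uniform_gamma_properties(1)[OF d m] by (simp add: poly_altdef)
    also have "\<dots> = (\<Sum>j\<le>d div 2. gamma_coeff m d j * y ^ j)"
      by (intro sum.cong refl) (simp add: uniform_gamma_def coeff_trinom_poly gamma_coeff_eq[OF d m])
    finally show ?thesis .
  qed
  then show ?thesis
    unfolding Z_eval_gamma_coeff[OF d] sum_distrib_left
  proof (simp only: sum_distrib_left, intro sum.cong refl)
    fix j assume "j \<in> {..d div 2}"
    then have "2 * j \<le> d" by auto
    then obtain e where e: "d = 2 * j + e" using le_Suc_ex by blast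
    have "1 + x \<noteq> 0" using x by linarith
    then show "gamma_coeff m d j * x ^ j * (1 + x) ^ (d - 2 * j) =
        (1 + x) ^ d * (gamma_coeff m d j * (x / (1 + x)\<^sup>2) ^ j)"
      unfolding e by (simp add: power_add power_divide flip: power_mult)
  qed
qed

section \<open>Flats, contractions and polynomials of uniform matroids\<close>

definition unif :: "'a set \<Rightarrow> nat \<Rightarrow> 'a matroid" where
  "unif E d = \<lparr>ground = E, indeps = {I. I \<subseteq> E \<and> card I \<le> d}\<rparr>"

lemma uniform_matroid_unif: "uniform_matroid m d = unif {..<m + d} d"
  by (simp add: uniform_matroid_def unif_def)

lemma ground_unif [simp]: "ground (unif E d) = E"
  by (simp add: unif_def)

lemma indeps_unif_iff [simp]: "I \<in> indeps (unif E d) \<longleftrightarrow> I \<subseteq> E \<and> card I \<le> d"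
  by (simp add: unif_def)

lemma is_matroid_unif:
  assumes "finite E" shows "is_matroid (unif E d)"
  unfolding is_matroid_def
proof (intro conjI ballI allI impI)
  fix I J assume IJ: "I \<in> indeps (unif E d)" "J \<in> indeps (unif E d)" "card J < card I"
  then have fin: "finite J" using assms finite_subset by auto
  have "\<not> I \<subseteq> J" using IJ(3) card_mono[OF fin, of I] by linarith
  then obtain e where "e \<in> I - J" by blast
  then show "\<exists>e\<in>I - J. insert e J \<in> indeps (unif E d)"
    using IJ fin by (intro bexI[of _ e]) auto
next
  fix I J assume "I \<in> indeps (unif E d)" "J \<subseteq> I"
  then show "J \<in> indeps (unif E d)"
    using assms card_mono[of I J] finite_subset[of I E] by auto
qed (use assms in auto)

lemma rank_of_unif:
  assumes "finite E" "X \<subseteq> E"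
  shows "rank_of (unif E d) X = min (card X) d"
proof -
  interpret finite_matroid "unif E d" by unfold_locales (rule is_matroid_unif[OF assms(1)])
  have fin: "finite X" using assms finite_subset by auto
  show ?thesis
  proof (rule antisym)
    show "rk X \<le> min (card X) d" by (rule rank_le) (use fin card_mono in auto)
    obtain I where "I \<subseteq> X" "card I = min (card X) d"
      using obtain_subset_with_card_n[of "min (card X) d" X] by auto
    then show "min (card X) d \<le> rk X" using card_le_rank[of I X] assms by auto
  qed
qed

context
  fixes E :: "'a set" and d :: nat
  assumes E: "finite E" and dE: "d \<le> card E" and d: "d > 0"
begin

interpretation U: finite_matroid "unif E d"
  by unfold_locales (rule is_matroid_unif[OF E])

lemma mrank_unif: "mrank (unif E d) = d"
  using dE by (simp add: mrank_def rank_of_unif[OF E])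

lemma flats_unif: "flats (unif E d) = insert E {F. F \<subseteq> E \<and> card F < d}"
proof (intro equalityI subsetI)
  fix F assume F: "F \<in> flats (unif E d)"
  then have FE: "F \<subseteq> E" by (simp add: flats_def)
  show "F \<in> insert E {F. F \<subseteq> E \<and> card F < d}"
  proof (cases "F = E")
    case False
    then obtain e where e: "e \<in> E - F" using FE by blast
    then have "rank_of (unif E d) F < rank_of (unif E d) (insert e F)" using F by (simp add: flats_def)
    then have "min (card F) d < min (card (insert e F)) d"
      using e FE rank_of_unif[OF E, of F d] rank_of_unif[OF E, of "insert e F" d] by auto
    then show ?thesis using FE by auto
  qed simp
next
  fix F assume "F \<in> insert E {F. F \<subseteq> E \<and> card F < d}"
  then consider "F = E" | "F \<subseteq> E" "card F < d" by auto
  then show "F \<in> flats (unif E d)"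
  proof cases
    case 2
    have "rank_of (unif E d) F < rank_of (unif E d) (insert e F)" if "e \<in> E - F" for e
      using 2 that E rank_of_unif[OF E, of F d] rank_of_unif[OF E, of "insert e F" d]
      by (simp add: finite_subset)
    then show ?thesis using 2 by (simp add: flats_def)
  qed (simp add: flats_def)
qed

text \<open>The new ground set is not an initial segment of the naturals, which is why
  \<open>unif\<close> takes an arbitrary set. The corank card E - d stays the same, so induction on
  d can keep m fixed.\<close>

lemma contraction_unif:
  assumes F: "F \<subseteq> E" "card F \<le> d"
  shows "contraction (unif E d) F = unif (E - F) (d - card F)"
proof -
  have "rank_of (unif E d) (I \<union> F) = card I + rank_of (unif E d) F \<longleftrightarrow> card I \<le> d - card F"
    if I: "I \<subseteq> E - F" for I
  proof -
    have "card (I \<union> F) = card I + card F"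
      using I F E by (intro card_Un_disjoint) (auto intro: finite_subset)
    moreover have "I \<union> F \<subseteq> E" using I F by auto
    ultimately show ?thesis
      using rank_of_unif[OF E, of "I \<union> F" d] rank_of_unif[OF E F(1), of d] F by auto
  qed
  then show ?thesis by (auto simp: contraction_def unif_def)
qed

lemma kl_rec_contraction_unif_ground: "kl_rec (contraction (unif E d) E) = 1"
proof -
  interpret C: finite_matroid "contraction (unif E d) E"
    by unfold_locales (rule U.is_matroid_contraction, simp)
  have "mrank (contraction (unif E d) E) = 0"
    using U.mrank_contraction[of E] by (simp add: mrank_def)
  then show ?thesis using C.kl_rec_eq by simp
qed

lemma bot_flat_unif: "U.bot_flat = {}"
proof -
  have "U.bot_flat \<subseteq> {}" by (rule U.bot_flat_least) (use flats_unif d in auto)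
  then show ?thesis by simp
qed

lemma sum_subsets_by_card:
  fixes f :: "nat \<Rightarrow> real"
  assumes A: "finite A"
  shows "(\<Sum>F\<in>{F. F \<subseteq> A \<and> card F < n}. f (card F)) = (\<Sum>k<n. real (card A choose k) * f k)"
proof -
  let ?S = "{F. F \<subseteq> A \<and> card F < n}"
  have "(\<Sum>F\<in>?S. f (card F)) = (\<Sum>k<n. \<Sum>F\<in>{F \<in> ?S. card F = k}. f (card F))"
    by (rule sum.group[symmetric]) (use A in auto)
  also have "\<dots> = (\<Sum>k<n. real (card A choose k) * f k)"
  proof (intro sum.cong refl)
    fix k assume "k \<in> {..<n}"
    then have "{F \<in> ?S. card F = k} = {F. F \<subseteq> A \<and> card F = k}" by auto
    moreover have "(\<Sum>F\<in>{F. F \<subseteq> A \<and> card F = k}. f (card F)) = (\<Sum>F\<in>{F. F \<subseteq> A \<and> card F = k}. f k)"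
      by (intro sum.cong) auto
    ultimately show "(\<Sum>F\<in>{F \<in> ?S. card F = k}. f (card F)) = real (card A choose k) * f k"
      by (simp add: n_subsets[OF A])
  qed
  finally show ?thesis .
qed

text \<open>Below a proper flat the lattice is Boolean, so the recursion is the alternating binomial
  sum without its last term.\<close>

lemma moebius_unif:
  assumes "G \<subseteq> E" "card G < d"
  shows "moebius (flats (unif E d)) {} G = (-1) ^ card G"
  using assms
proof (induction "card G" arbitrary: G rule: less_induct)
  case less
  show ?case
  proof (cases "G = {}")
    case False
    have fin: "finite G" using less.prems E finite_subset by auto
    have sub: "{z \<in> flats (unif E d). {} \<subseteq> z \<and> z \<subset> G} = {F. F \<subseteq> G \<and> card F < card G}"
    proof (intro equalityI subsetI)
      fix z assume "z \<in> {z \<in> flats (unif E d). {} \<subseteq> z \<and> z \<subset> G}"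
      then show "z \<in> {F. F \<subseteq> G \<and> card F < card G}" using psubset_card_mono[OF fin, of z] by auto
    qed (use less.prems flats_unif in auto)
    have "moebius (flats (unif E d)) {} G = - (\<Sum>z\<in>{F. F \<subseteq> G \<and> card F < card G}. moebius (flats (unif E d)) {} z)"
      using moebius_less[OF U.finite_flats, of "{}" G] False unfolding sub by auto
    also have "\<dots> = - (\<Sum>z\<in>{F. F \<subseteq> G \<and> card F < card G}. (-1) ^ card z)"
      by (intro arg_cong[of _ _ uminus] sum.cong refl less.hyps) (use less.prems in auto)
    finally have "real_of_int (moebius (flats (unif E d)) {} G) =
        - (\<Sum>z\<in>{F. F \<subseteq> G \<and> card F < card G}. (-1) ^ card z)" by simp
    also have "\<dots> = - (\<Sum>k<card G. (-1) ^ k * real (card G choose k))"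
      unfolding sum_subsets_by_card[OF fin] by (simp add: mult.commute)
    also have "\<dots> = (-1) ^ card G"
      using choose_alternating_sum[of "card G", where 'a = real] False fin
      by (simp add: lessThan_Suc_atMost[symmetric] card_gt_0_iff)
    finally show ?thesis by (metis of_int_eq_iff of_int_minus of_int_1 of_int_power)
  qed simp
qed

lemma moebius_unif_ground:
  "real_of_int (moebius (flats (unif E d)) {} E) = - (\<Sum>k<d. (-1) ^ k * real (card E choose k))"
proof -
  have "{} \<subset> E" using dE d by auto
  moreover have "{z \<in> flats (unif E d). {} \<subseteq> z \<and> z \<subset> E} = {F. F \<subseteq> E \<and> card F < d}"
    using flats_unif dE by auto
  ultimately have "moebius (flats (unif E d)) {} E = - (\<Sum>z\<in>{F. F \<subseteq> E \<and> card F < d}. moebius (flats (unif E d)) {} z)"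
    using moebius_less[OF U.finite_flats, of "{}" E] by simp
  also have "\<dots> = - (\<Sum>z\<in>{F. F \<subseteq> E \<and> card F < d}. (-1) ^ card z)"
    by (intro arg_cong[of _ _ uminus] sum.cong refl moebius_unif) auto
  finally have "real_of_int (moebius (flats (unif E d)) {} E) = - (\<Sum>z\<in>{F. F \<subseteq> E \<and> card F < d}. (-1) ^ card z)"
    by simp
  then show ?thesis unfolding sum_subsets_by_card[OF E] by (simp add: mult.commute)
qed

lemma ev_charpoly_restr_unif:
  assumes F: "F \<subseteq> E" "card F < d"
  shows "ev (charpoly_restr (unif E d) F) x = (x - 1) ^ card F"
proof -
  have fin: "finite F" using F E finite_subset by auto
  have int: "interval (flats (unif E d)) {} F = {G. G \<subseteq> F \<and> card G < Suc (card F)}"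
  proof (intro equalityI subsetI)
    fix G assume "G \<in> interval (flats (unif E d)) {} F"
    then show "G \<in> {G. G \<subseteq> F \<and> card G < Suc (card F)}"
      using card_mono[OF fin, of G] by (auto simp: interval_def)
  next
    fix G assume "G \<in> {G. G \<subseteq> F \<and> card G < Suc (card F)}"
    then show "G \<in> interval (flats (unif E d)) {} F"
      using F by (auto simp: interval_def flats_unif)
  qed
  have "ev (charpoly_restr (unif E d) F) x =
      (\<Sum>G\<in>{G. G \<subseteq> F \<and> card G < Suc (card F)}. (-1) ^ card G * x ^ (card F - card G))"
    unfolding U.charpoly_restr_eq bot_flat_unif U.char_fun_def ev_sum ev_simps int
  proof (intro sum.cong refl)
    fix G assume "G \<in> {G. G \<subseteq> F \<and> card G < Suc (card F)}"
    then have G: "G \<subseteq> E" "card G < d" using F by auto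
    then show "of_int (moebius (flats (unif E d)) {} G) * x ^ (U.rk F - U.rk G) = (-1) ^ card G * x ^ (card F - card G)"
      using F by (simp add: moebius_unif rank_of_unif[OF E])
  qed
  also have "\<dots> = (\<Sum>k\<le>card F. real (card F choose k) * (-1) ^ k * x ^ (card F - k))"
    unfolding sum_subsets_by_card[OF fin, where f = "\<lambda>k. (-1) ^ k * x ^ (card F - k)"] lessThan_Suc_atMost
    by (simp add: mult.assoc)
  also have "\<dots> = (x - 1) ^ card F" using binomial_ring[of "-1" x "card F"] by simp
  finally show ?thesis .
qed

text \<open>The Moebius value at the top is minus the sum of all others. Merged into the sum it
  gives the - 1 in each term, the form that occurs in \<open>kl_eval_reversal\<close>.\<close>

lemma ev_charpoly_restr_unif_ground:
  "ev (charpoly_restr (unif E d) E) x = (\<Sum>k<d. (-1) ^ k * real (card E choose k) * (x ^ (d - k) - 1))"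
proof -
  have int: "interval (flats (unif E d)) {} E = insert E {G. G \<subseteq> E \<and> card G < d}"
    by (auto simp: interval_def flats_unif)
  have fin: "finite {G. G \<subseteq> E \<and> card G < d}" using E by simp
  have summand: "of_int (moebius (flats (unif E d)) {} G) * x ^ (U.rk E - U.rk G) = (-1) ^ card G * x ^ (d - card G)"
    if "G \<subseteq> E" "card G < d" for G
    using that dE by (simp add: moebius_unif rank_of_unif[OF E] min_absorb2)
  have "ev (charpoly_restr (unif E d) E) x = of_int (moebius (flats (unif E d)) {} E) +
      (\<Sum>G\<in>{G. G \<subseteq> E \<and> card G < d}. (-1) ^ card G * x ^ (d - card G))"
    unfolding U.charpoly_restr_eq bot_flat_unif U.char_fun_def ev_sum ev_simps int
    using fin dE by (simp add: summand)
  also have "(\<Sum>G\<in>{G. G \<subseteq> E \<and> card G < d}. (-1) ^ card G * x ^ (d - card G)) =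
      (\<Sum>k<d. (-1) ^ k * real (card E choose k) * x ^ (d - k))"
    unfolding sum_subsets_by_card[OF E, where f = "\<lambda>k. (-1) ^ k * x ^ (d - k)"]
    by (intro sum.cong refl) simp
  finally show ?thesis unfolding moebius_unif_ground by (simp add: right_diff_distrib sum_subtractf)
qed

end

lemma sum_flats_unif:
  assumes "finite E" "d \<le> card E" "d > 0"
  shows "(\<Sum>F\<in>flats (unif E d). f F) = f E + (\<Sum>F\<in>{F. F \<subseteq> E \<and> card F < d}. f F)"
  unfolding flats_unif[OF assms] using assms by (subst sum.insert) auto

text \<open>Both the true polynomial and the candidate satisfy the recursion with the same terms at
  nonempty flats, by induction. Their difference therefore equals its own reversal in length d, and
  its degree is below d / 2, so it is 0.\<close>

lemma ev_kl_rec_unif: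
  assumes "finite E" "card E = m + d" "d > 0"
  shows "ev (kl_rec (unif E d)) x = kl_eval m d x"
  using assms
proof (induction d arbitrary: E x rule: less_induct)
  case (less d)
  note E = less.prems
  have dE: "d \<le> card E" using E by simp
  note U = E(1) dE E(3)
  let ?M = "unif E d" and ?R = "map_poly of_int :: int poly \<Rightarrow> real poly"
  \<comment> \<open>The candidate is a real polynomial: that the numbers \<open>kl_coeff\<close> are
    integers is a consequence of the comparison, not an input.\<close>
  define c where "c = (\<Sum>i\<in>{i. 2 * i < d}. monom (kl_coeff m d i) i)"
  have cc: "coeff c i = kl_coeff m d i" for i
    by (simp add: c_def coeff_sum finite_low kl_coeff_eq_0 if_distrib[of "\<lambda>x. coeff x _"] cong: if_cong)
  have "degree c \<le> (d - 1) div 2"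
    by (rule degree_le) (auto simp: cc intro!: kl_coeff_eq_0)
  then have dc: "2 * degree c < d" using E by linarith
  have pc: "poly c x = kl_eval m d x" for x
    unfolding kl_eval_def using dc by (subst poly_eq_sum_coeffs[of c d]) (auto simp: cc)
  have "2 * degree (kl_rec ?M) < d"
    using kl_assignment_kl_rec is_matroid_unif[OF E(1)] mrank_unif[OF U] E(3)
    unfolding kl_assignment_def by metis
  then have dk: "2 * degree (?R (kl_rec ?M)) < d" by (simp add: degree_map_poly_of_int)
  have "?R (kl_rec ?M) - c = 0"
  proof (rule eq_0_if_reversal_eq[of d _ "?R (kl_rec ?M) - c"])
    fix x :: real assume x: "x \<noteq> 0"
    have IH: "ev (kl_rec (contraction ?M F)) x = kl_eval m (d - card F) x"
      if F: "F \<subseteq> E" "card F < d" "F \<noteq> {}" for F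
    proof -
      have fin: "finite F" using F E finite_subset by auto
      then have "card F > 0" using F by auto
      moreover have "card (E - F) = m + (d - card F)" using fin F E by (simp add: card_Diff_subset)
      ultimately show ?thesis
        using less.IH[of "d - card F" "E - F" x] F E contraction_unif[OF U F(1)] by simp
    qed
    have emp: "contraction ?M {} = ?M" using contraction_unif[OF U, of "{}"] by simp
    have "x ^ d * ev (kl_rec ?M) (1 / x) =
        ev (\<Sum>F\<in>flats ?M. charpoly_restr ?M F * kl_rec (contraction ?M F)) x"
      using kl_assignment_kl_rec is_matroid_unif[OF E(1)] x mrank_unif[OF U]
      unfolding kl_assignment_def ev_def by metis
    also have "\<dots> = (\<Sum>k<d. (-1) ^ k * real (card E choose k) * (x ^ (d - k) - 1)) +
        (\<Sum>F\<in>{F. F \<subseteq> E \<and> card F < d}. (x - 1) ^ card F * ev (kl_rec (contraction ?M F)) x)"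
      unfolding sum_flats_unif[OF U]
      by (simp add: ev_simps ev_sum ev_charpoly_restr_unif[OF U] ev_charpoly_restr_unif_ground[OF U]
          kl_rec_contraction_unif_ground[OF U])
    \<comment> \<open>The induction hypothesis covers every F except the empty set, whose
      contraction is the matroid itself. Its deviation is split off and becomes the right side of
      the reversal equation.\<close>
    also have "(\<Sum>F\<in>{F. F \<subseteq> E \<and> card F < d}. (x - 1) ^ card F * ev (kl_rec (contraction ?M F)) x) =
        (\<Sum>F\<in>{F. F \<subseteq> E \<and> card F < d}. (x - 1) ^ card F * kl_eval m (d - card F) x +
          (if F = {} then ev (kl_rec ?M) x - kl_eval m d x else 0))"
      by (intro sum.cong refl) (auto simp: IH emp)
    also have "\<dots> = (\<Sum>F\<in>{F. F \<subseteq> E \<and> card F < d}. (x - 1) ^ card F * kl_eval m (d - card F) x) +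
          (ev (kl_rec ?M) x - kl_eval m d x)"
      using E by (simp add: sum.distrib)
    also have "(\<Sum>F\<in>{F. F \<subseteq> E \<and> card F < d}. (x - 1) ^ card F * kl_eval m (d - card F) x) =
        (\<Sum>k<d. real (m + d choose k) * (x - 1) ^ k * kl_eval m (d - k) x)"
      using sum_subsets_by_card[OF U E(1), where n = d and f = "\<lambda>k. (x - 1) ^ k * kl_eval m (d - k) x"]
      by (simp add: E(2) mult.assoc)
    finally have "x ^ d * ev (kl_rec ?M) (1 / x) = x ^ d * kl_eval m d (1 / x) + (ev (kl_rec ?M) x - kl_eval m d x)"
      unfolding kl_eval_reversal[OF E(3) x] by (simp add: E(2))
    then show "x ^ d * poly (?R (kl_rec ?M) - c) (1 / x) = poly (?R (kl_rec ?M) - c) x"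
      by (simp add: pc right_diff_distrib flip: ev_def)
  qed (use dk dc degree_diff_le_max[of "?R (kl_rec ?M)" c] in linarith)+
  then show ?case by (simp add: ev_def flip: pc)
qed

lemma ev_Z_poly_unif:
  assumes E: "finite E" "card E = m + d" "d > 0"
  shows "ev (Z_poly (unif E d)) x = Z_eval m d x"
proof -
  have U: "finite E" "d \<le> card E" "d > 0" using E by auto
  let ?M = "unif E d"
  interpret finite_matroid ?M by unfold_locales (rule is_matroid_unif[OF E(1)])
  have kl: "kl_poly (contraction ?M F) = kl_rec (contraction ?M F)" if "F \<subseteq> E" for F
    by (rule kl_poly_eq, rule is_matroid_contraction) (use that in simp)
  have IH: "ev (kl_rec (contraction ?M F)) x = kl_eval m (d - card F) x" if F: "F \<subseteq> E" "card F < d" for F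
  proof -
    have fin: "finite F" using F E finite_subset by auto
    have "card (E - F) = m + (d - card F)" using fin F E by (simp add: card_Diff_subset)
    then show ?thesis using ev_kl_rec_unif[of "E - F" m "d - card F" x] F E contraction_unif[OF U F(1)] by simp
  qed
  have "ev (Z_poly ?M) x = x ^ d + (\<Sum>F\<in>{F. F \<subseteq> E \<and> card F < d}. x ^ card F * kl_eval m (d - card F) x)"
    unfolding Z_poly_def sum_flats_unif[OF U]
    using U(2) by (simp add: ev_simps ev_sum kl IH kl_rec_contraction_unif_ground[OF U] rank_of_unif[OF E(1)])
  also have "(\<Sum>F\<in>{F. F \<subseteq> E \<and> card F < d}. x ^ card F * kl_eval m (d - card F) x) =
      (\<Sum>k<d. real (m + d choose k) * x ^ k * kl_eval m (d - k) x)"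
    using sum_subsets_by_card[OF U E(1), where n = d and f = "\<lambda>k. x ^ k * kl_eval m (d - k) x"]
    by (simp add: E(2) mult.assoc)
  finally show ?thesis by (simp add: Z_eval_def)
qed

theorem gamma_poly_uniform_matroid:
  assumes m: "m > 0" and d: "d > 0"
  shows "gamma_poly (uniform_matroid m d) = uniform_gamma m d"
proof -
  let ?M = "uniform_matroid m d"
  have r: "mrank ?M = d"
    unfolding uniform_matroid_unif by (rule mrank_unif) (use d in auto)
  have Z: "poly (map_poly of_int (Z_poly ?M)) x = Z_eval m d x" for x
    unfolding uniform_matroid_unif ev_def[symmetric] by (rule ev_Z_poly_unif) (use d in auto)
  show ?thesis
    unfolding gamma_poly_def r Z
  proof (rule the_equality)
    show "degree (uniform_gamma m d) \<le> d div 2 \<and>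
      (\<forall>x. x \<noteq> -1 \<longrightarrow> Z_eval m d x = (1 + x) ^ d * poly (uniform_gamma m d) (x / (1 + x)\<^sup>2))"
      using Z_eval_uniform_gamma[OF d m] uniform_gamma_properties(1)[OF d m] by simp
  next
    fix g assume g: "degree g \<le> d div 2 \<and>
      (\<forall>x. x \<noteq> -1 \<longrightarrow> Z_eval m d x = (1 + x) ^ d * poly g (x / (1 + x)\<^sup>2))"
    have root: "poly (g - uniform_gamma m d) (x / (1 + x)\<^sup>2) = 0" if "x > 0" for x
    proof -
      have "x \<noteq> -1" "(1 + x) ^ d \<noteq> 0" using that by auto
      then have "(1 + x) ^ d * poly g (x / (1 + x)\<^sup>2) = (1 + x) ^ d * poly (uniform_gamma m d) (x / (1 + x)\<^sup>2)"
        using g Z_eval_uniform_gamma[OF d m] by metis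
      then show ?thesis using that by simp
    qed
    \<comment> \<open>Equal values occur only for y = x or y = 1 / x, so the argument of the
      gamma-polynomial takes infinitely many values on (0, 1), which determines g.\<close>
    have "inj_on (\<lambda>x::real. x / (1 + x)\<^sup>2) {0<..<1}"
    proof (rule inj_onI)
      fix x y :: real assume xy: "x \<in> {0<..<1}" "y \<in> {0<..<1}" "x / (1 + x)\<^sup>2 = y / (1 + y)\<^sup>2"
      then have "x * (1 + y)\<^sup>2 = y * (1 + x)\<^sup>2" by (auto simp: field_simps)
      then have "(x - y) * (1 - x * y) = 0" by (simp add: power2_eq_square algebra_simps)
      moreover have "x * y < 1" using xy mult_strict_mono[of x 1 y 1] by auto
      ultimately show "x = y" by simp
    qed
    then have "infinite ((\<lambda>x::real. x / (1 + x)\<^sup>2) ` {0<..<1})"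
      by (simp add: finite_image_iff)
    moreover have "(\<lambda>x::real. x / (1 + x)\<^sup>2) ` {0<..<1} \<subseteq> {y. poly (g - uniform_gamma m d) y = 0}"
      using root by auto
    ultimately have "g - uniform_gamma m d = 0" using poly_roots_finite infinite_super by blast
    then show "g = uniform_gamma m d" by simp
  qed
qed

theorem theorem1p3:
  shows "(\<forall>m d. m \<ge> 1 \<and> d \<ge> 1 \<longrightarrow>
            strictly_interlaces (gamma_poly (uniform_matroid m d))
                                (gamma_poly (uniform_matroid m (d + 1)))) \<and>
         (\<forall>m d. m \<ge> 1 \<and> d \<ge> 2 \<longrightarrow>
            strictly_interlaces (gamma_poly (uniform_matroid m d))
                                (gamma_poly (uniform_matroid (m + 1) d))) \<and>
         (\<forall>m d. m \<ge> 1 \<and> d \<ge> 1 \<longrightarrow>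
            strictly_interlaces (gamma_poly (uniform_matroid m d))
                                (gamma_poly (uniform_matroid (m + 1) (d + 1))))"
  using uniform_gamma_interlacing by (simp add: gamma_poly_uniform_matroid Suc_le_eq)

end
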